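(* Let $\mathcal X:y^n=f(x)$ be a superelliptic curve over $\mathbb F_q$ as in the context. Assume that $q=p$ is prime, that $\mathcal X$ has at least one $\mathbb F_q$-rational point over $\mathbb A^1(\mathbb F_q)$, and that $$c\lfloor M/2\rfloor\ge(n-1)d.$$ Then $$h_{\max}(\mathcal X)\le h^*=c\lfloor M/2\rfloor+1-g_{\mathcal X}=\ell\bigl(\lfloor M/2\rfloor D_\infty\bigr),$$ with equality if and only if $\mathcal X$ is totally split, in which case the value is attained at $s=\lfloor M/2\rfloor$ and at $s=M-\lfloor M/2\rfloor$; and if $\mathcal X$ is not totally split then $h_{\max}(\mathcal X)\le h^*-1$. For fixed $(n,d,q)$ subject to the displayed inequality $c\lfloor M/2\rfloor\ge(n-1)d$, the function $h_{\max}$ therefore attains its maximum exactly on the totally split locus, where it equals $\ell(\lfloor M/2\rfloor D_\infty)$.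
   Context: Setting. $q$ is a power of a prime $p$; $n\ge2$, $d\ge3$ are integers with $n\mid q-1$ (so $p\nmid n$); $c=\gcd(n,d)$; $f\in\mathbb F_q[x]$ is separable of degree $d$ with no root in $\mathbb F_q$. $\mathcal X$ is the smooth projective model of $y^n=f(x)$ over $\mathbb F_q$, of genus $g_{\mathcal X}=\frac{(n-1)(d-1)+1-c}{2}$. $D_\infty$ is the reduced divisor of the $c$ geometric points over $x=\infty$. $D$ is the sum of all $\mathbb F_q$-rational points of $\mathcal X$ over $\mathbb A^1(\mathbb F_q)$ and $N=\deg D$. $\mathcal X$ is totally split if $f(a)\in(\mathbb F_q^* )^n$ for every $a\in\mathbb F_q$ (equivalently $N=qn$); the totally split locus is the set of totally split curves among the curves of this form with the given $(n,d,q)$. Codes. $L(G)=\{h\in\mathbb F_q(\mathcal X)^*:\operatorname{div}(h)+G\ge0\}\cup\{0\}$, $\ell(G)=\dim_{\mathbb F_q} L(G)$. For $s\ge1$, $\mathcal C_s=C_L(D,sD_\infty)\subseteq\mathbb F_q^N$ is the image of evaluation of $L(sD_\infty)$ at the points of $D$ (equivalently the span of the vectors $(x(P)^iy(P)^j)_{P}$, $i\ge0$, $0\le j\le n-1$, $\frac nc i+\frac dc j\le s$). $\operatorname{Hull}(C)=C\cap C^\perp$ for the standard bilinear form. $M=\frac{(q-1)n}{c}-1$, $h^*=c\lfloor M/2\rfloor+1-g_{\mathcal X}$, and $h_{\max}(\mathcal X)=\max_{s\ge1}\dim\operatorname{Hull}(\mathcal C_s)$.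
   Formalization: The claim that h_max attains its maximum exactly on the totally split locus is stated only when that locus is nonempty; it can be empty (q=101, n=2, d=3, by Hasse–Weil), and then the maximum is attained off it. *)

theory Defs
  imports
    "HOL-Algebra.Algebraic_Closure_Type"
    "HOL-Computational_Algebra.Computational_Algebra"
    "HOL-Library.Cardinality"
    "HOL-Library.Function_Algebras"
begin

section \<open>The curves\<close>

text \<open>The base field \<open>\<bbbF>\<^sub>q\<close> is a finite type \<open>'a\<close> with \<open>q = CARD('a)\<close>.\<close>

definition superelliptic_polys :: "nat \<Rightarrow> 'a :: {finite, field} poly set" where
  "superelliptic_polys d =
     {f. degree f = d \<and> coprime f (pderiv f) \<and> (\<forall>a. poly f a \<noteq> 0)}"

definition totally_split :: "nat \<Rightarrow> 'a :: {finite, field} poly \<Rightarrow> bool" where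
  "totally_split n f \<longleftrightarrow> (\<forall>a. \<exists>b. b \<noteq> 0 \<and> poly f a = b ^ n)"

definition totally_split_locus :: "nat \<Rightarrow> nat \<Rightarrow> 'a :: {finite, field} poly set" where
  "totally_split_locus n d = {f \<in> superelliptic_polys d. totally_split n f}"


section \<open>The function field\<close>

text \<open>
  \<open>\<bbbF>\<^sub>q(\<X>)\<close> is realised as the subfield \<open>\<bbbF>\<^sub>q(x)(y)\<close> of an algebraic closure of the rational
  function field \<open>\<bbbF>\<^sub>q(x)\<close>, where \<open>y\<close> is an \<open>n\<close>-th root of \<open>f(x)\<close>.  For \<open>n dvd q - 1\<close> the
  \<open>n\<close>-th roots of \<open>f(x)\<close> differ by constants in \<open>\<bbbF>\<^sub>q\<close>, so the subfield does not depend on the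
  root chosen.
\<close>

type_synonym 'a ffield = "'a poly fract alg_closure"

definition ff_const :: "'a :: {finite, field} \<Rightarrow> 'a ffield" where
  "ff_const \<alpha> = to_ac (to_fract [:\<alpha>:])"

definition ff_x :: "'a :: {finite, field} ffield" where
  "ff_x = to_ac (to_fract [:0, 1:])"

definition ff_y :: "nat \<Rightarrow> 'a :: {finite, field} poly \<Rightarrow> 'a ffield" where
  "ff_y n f = (SOME y. y ^ n = to_ac (to_fract f))"

text \<open>As \<open>y\<close> is algebraic over \<open>\<bbbF>\<^sub>q(x)\<close>, the polynomial expressions in \<open>y\<close> form a field.\<close>

definition function_field :: "nat \<Rightarrow> 'a :: {finite, field} poly \<Rightarrow> 'a ffield set" where
  "function_field n f = {poly (map_poly to_ac u) (ff_y n f) | u. True}"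


section \<open>Places and divisors\<close>

text \<open>
  The closed points of the smooth projective model are the places of the function field over
  \<open>\<bbbF>\<^sub>q\<close>.  A place \<open>P\<close> is represented by its normalised discrete valuation \<open>v\<^sub>P\<close>, with the
  (irrelevant) value 0 outside \<open>\<bbbF>\<^sub>q(\<X>)\<^sup>*\<close>, in particular at 0, so that distinct functions
  are distinct places.
\<close>

type_synonym 'a place = "'a ffield \<Rightarrow> int"

definition places :: "nat \<Rightarrow> 'a :: {finite, field} poly \<Rightarrow> 'a place set" where
  "places n f =
     {v. let K = function_field n f - {0} in
         (\<forall>g\<in>K. \<forall>h\<in>K. v (g * h) = v g + v h) \<and>
         (\<forall>g\<in>K. \<forall>h\<in>K. g + h \<noteq> 0 \<longrightarrow> v (g + h) \<ge> min (v g) (v h)) \<and>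
         (\<forall>\<alpha>. \<alpha> \<noteq> 0 \<longrightarrow> v (ff_const \<alpha>) = 0) \<and>
         v ` K = UNIV \<and>
         (\<forall>h. h \<notin> K \<longrightarrow> v h = 0)}"

type_synonym 'a divisor = "'a place \<Rightarrow> int"

text \<open>
  The points over \<open>x = \<infinity>\<close> are the poles of \<open>x\<close>.  Their residue fields are separable over
  \<open>\<bbbF>\<^sub>q\<close>, so as a divisor over \<open>\<bbbF>\<^sub>q\<close> the reduced sum of the geometric points over \<open>\<infinity>\<close> is the
  sum, with multiplicity one, of the places over \<open>\<infinity>\<close>.
\<close>

definition D_inf :: "nat \<Rightarrow> 'a :: {finite, field} poly \<Rightarrow> 'a divisor" where
  "D_inf n f P = (if P \<in> places n f \<and> P ff_x < 0 then 1 else 0)"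

definition RR_space :: "nat \<Rightarrow> 'a :: {finite, field} poly \<Rightarrow> 'a divisor \<Rightarrow> 'a ffield set" where
  "RR_space n f G =
     {h \<in> function_field n f. h \<noteq> 0 \<longrightarrow> (\<forall>P\<in>places n f. P h + G P \<ge> 0)}"

definition RR_dim :: "nat \<Rightarrow> 'a :: {finite, field} poly \<Rightarrow> 'a divisor \<Rightarrow> nat" where
  "RR_dim n f G = vector_space.dim (\<lambda>\<alpha> h. ff_const \<alpha> * h) (RR_space n f G)"


section \<open>Rational points and evaluation\<close>

definition val_ring :: "nat \<Rightarrow> 'a :: {finite, field} poly \<Rightarrow> 'a place \<Rightarrow> 'a ffield set" where
  "val_ring n f P = {h \<in> function_field n f. h = 0 \<or> P h \<ge> 0}"

definition val_ideal :: "nat \<Rightarrow> 'a :: {finite, field} poly \<Rightarrow> 'a place \<Rightarrow> 'a ffield set" where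
  "val_ideal n f P = {h \<in> function_field n f. h = 0 \<or> P h > 0}"

text \<open>A place is rational iff its residue field consists of the classes of the constants.\<close>

definition rational_place :: "nat \<Rightarrow> 'a :: {finite, field} poly \<Rightarrow> 'a place \<Rightarrow> bool" where
  "rational_place n f P \<longleftrightarrow>
     P \<in> places n f \<and> (\<forall>h\<in>val_ring n f P. \<exists>\<alpha>. h - ff_const \<alpha> \<in> val_ideal n f P)"

definition affine_points :: "nat \<Rightarrow> 'a :: {finite, field} poly \<Rightarrow> 'a place set" where
  "affine_points n f = {P. rational_place n f P \<and> ff_x \<in> val_ring n f P}"

definition eval_at :: "nat \<Rightarrow> 'a :: {finite, field} poly \<Rightarrow> 'a place \<Rightarrow> 'a ffield \<Rightarrow> 'a" where
  "eval_at n f P h = (THE \<alpha>. h - ff_const \<alpha> \<in> val_ideal n f P)"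


section \<open>Codes\<close>

text \<open>
  \<open>\<bbbF>\<^sub>q\<^sup>N\<close> is the space of functions from the set \<open>I\<close> of the \<open>N\<close> coordinate positions to
  \<open>\<bbbF>\<^sub>q\<close>, extended by 0 outside \<open>I\<close>; here \<open>I\<close> is the support of \<open>D\<close>.
\<close>

definition dual_code :: "'i set \<Rightarrow> ('i \<Rightarrow> 'a :: field) set \<Rightarrow> ('i \<Rightarrow> 'a) set" where
  "dual_code I C = {u. (\<forall>i. i \<notin> I \<longrightarrow> u i = 0) \<and> (\<forall>w\<in>C. (\<Sum>i\<in>I. u i * w i) = 0)}"

definition code_hull :: "'i set \<Rightarrow> ('i \<Rightarrow> 'a :: field) set \<Rightarrow> ('i \<Rightarrow> 'a) set" where
  "code_hull I C = C \<inter> dual_code I C"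

definition code_dim :: "('i \<Rightarrow> 'a :: field) set \<Rightarrow> nat" where
  "code_dim C = vector_space.dim (\<lambda>\<alpha> u i. \<alpha> * u i) C"

definition AG_code ::
  "nat \<Rightarrow> 'a :: {finite, field} poly \<Rightarrow> 'a divisor \<Rightarrow> ('a place \<Rightarrow> 'a) set" where
  "AG_code n f G =
     (\<lambda>h P. if P \<in> affine_points n f then eval_at n f P h else 0) ` RR_space n f G"

definition C_code :: "nat \<Rightarrow> 'a :: {finite, field} poly \<Rightarrow> nat \<Rightarrow> ('a place \<Rightarrow> 'a) set" where
  "C_code n f s = AG_code n f (\<lambda>P. int s * D_inf n f P)"

definition hull_dim :: "nat \<Rightarrow> 'a :: {finite, field} poly \<Rightarrow> nat \<Rightarrow> nat" where
  "hull_dim n f s = code_dim (code_hull (affine_points n f) (C_code n f s))"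

definition h_max :: "nat \<Rightarrow> 'a :: {finite, field} poly \<Rightarrow> nat" where
  "h_max n f = Max (hull_dim n f ` {1..})"


section \<open>Numerical parameters\<close>

text \<open>The genus of \<open>y\<^sup>n = f(x)\<close>, as given by the Riemann--Hurwitz formula (the numerator is even).\<close>

definition superelliptic_genus :: "nat \<Rightarrow> nat \<Rightarrow> nat" where
  "superelliptic_genus n d = ((n - 1) * (d - 1) + 1 - gcd n d) div 2"

definition M_param :: "nat \<Rightarrow> nat \<Rightarrow> nat \<Rightarrow> nat" where
  "M_param q n d = (q - 1) * n div gcd n d - 1"

definition h_star :: "nat \<Rightarrow> nat \<Rightarrow> nat \<Rightarrow> int" where
  "h_star q n d =
     int (gcd n d * (M_param q n d div 2)) + 1 - int (superelliptic_genus n d)"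

end

theory Submission
  imports Defs
begin

text \<open>
  Notation: \<open>D\<^sub>\<infinity>\<close> is the divisor at infinity, \<open>\<ell>(s) = dim L(s D\<^sub>\<infinity>)\<close>, \<open>c = gcd n d\<close>, \<open>S\<close> is the set of
  \<open>a\<close> for which \<open>f(a)\<close> is an \<open>n\<close>-th power, and \<open>\<sigma> = card S\<close>; the curve is totally split iff \<open>\<sigma> = q\<close>.

  The space \<open>L(s D\<^sub>\<infinity>)\<close> has the basis \<open>x\<^sup>i y\<^sup>j\<close> with \<open>j < n\<close> and \<open>n i + d j \<le> c s\<close> (\<open>RR_space_eq\<close>).  Over
  \<open>a \<in> S\<close> the fibre consists of the \<open>n\<close>-th roots of \<open>f(a)\<close>, so the sum of \<open>y\<^sup>k\<close> over a fibre vanishes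
  unless \<open>n\<close> divides \<open>k\<close>.  The bilinear form therefore pairs the component of \<open>y\<^sup>j\<close> only with that of
  \<open>y\<^sup>n\<^sup>-\<^sup>j\<close> (that of \<open>1\<close> with itself), and the hull splits into components which concern polynomials in
  \<open>x\<close> evaluated on \<open>S\<close>, with \<open>f\<close> as a weight if \<open>j > 0\<close>.

  The bound \<open>\<ell>(m)\<close> for the hull comes from three ranges of \<open>s\<close>.
  If \<open>s \<le> m\<close>, the hull lies in a code of dimension at most \<open>\<ell>(m)\<close> (\<open>card_hull_small\<close>).
  If \<open>c s \<ge> (\<sigma> - 1) n\<close>, already the dual code has dimension less than \<open>\<ell>(m)\<close>, by the
  hypothesis \<open>(n - 1) d \<le> c m\<close>.
  Between these ranges, let \<open>T\<close> and \<open>E\<close> be the monic polynomials with simple roots at \<open>S\<close> and at its complement.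
  A word given by \<open>U(x) y\<^sup>j\<close> is orthogonal to the code iff \<open>U f = E V + T Q\<close> with \<open>deg (E V)\<close> bounded,
  where \<open>f\<close> is omitted if \<open>j = 0\<close>.  Up to the factor \<open>E\<close>, the solutions \<open>U\<close> with \<open>Q = 0\<close> form the \<open>j\<close>-component
  of a Riemann--Roch space of degree \<open>A = (\<sigma> - 1) n - c - c s\<close>, and the possible \<open>Q\<close> lie in the
  \<open>(j - 1)\<close>-component of one of degree \<open>B = c s + (n - 1) d - \<sigma> n\<close>, with \<open>Q = 0\<close> if \<open>j = 0\<close>.  Since
  \<open>A + B = (n - 1) d - n - c\<close>, the two together stay below \<open>\<ell>(m)\<close> if \<open>B \<ge> 0\<close>; if \<open>B < 0\<close>, then \<open>Q = 0\<close> and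
  the first part suffices as \<open>A \<le> c m\<close> (\<open>card_hull_large\<close>, \<open>xcount_sum_lt\<close>).

  In the last two ranges equality is impossible when \<open>\<sigma> < q\<close>.  In the first one it is excluded by the
  constant function \<open>1\<close>, whose inner product with itself is \<open>n \<sigma>\<close>: this is nonzero in the field because \<open>q\<close>
  is prime and \<open>0 < \<sigma> < q\<close>.  If the curve is totally split, then \<open>S\<close> is the whole field, where power sums of
  exponent below \<open>q - 1\<close> vanish; this makes \<open>L(m D\<^sub>\<infinity>)\<close> orthogonal to \<open>L((M - m) D\<^sub>\<infinity>)\<close>, so that the hulls
  at \<open>m\<close> and at \<open>M - m\<close> both contain a copy of \<open>L(m D\<^sub>\<infinity>)\<close> (\<open>card_hull_totally_split\<close>).

  The geometric input concerns places.  Substituting \<open>x = \<alpha> + t\<^sup>n\<close> or \<open>x = t\<^sup>-\<^sup>n\<close> makes \<open>f(x)\<close> an \<open>n\<close>-th power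
  of a Laurent series over the algebraic closure of the base field; this embeds the function field into
  Laurent series, and the order in \<open>t\<close>, rescaled, is a place (\<open>place_exists\<close>).  A function in
  \<open>L(s D\<^sub>\<infinity>)\<close> is tested on all places obtained by replacing \<open>y\<close> by \<open>z y\<close> with \<open>z\<^sup>n = 1\<close>; averaging over \<open>z\<close>
  isolates each term \<open>r(x) y\<^sup>j\<close>.  For the converse inclusion every place over infinity is shown to have the
  expected ramification (\<open>pole_orders\<close>).  Finally the rational places with \<open>x\<close> regular correspond to the points
  \<open>(a, b)\<close> with \<open>b\<^sup>n = f(a)\<close> (\<open>bij_betw_affine_points\<close>).

  As the base field is finite, dimensions are compared through cardinalities: a finite space of
  dimension \<open>k\<close> has \<open>q\<^sup>k\<close> elements.
\<close>

section \<open>Counting monomials by floor sums\<close>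

text \<open>
  The number of exponents \<open>i\<close> with \<open>n i + d j \<le> w\<close> in closed form.  For \<open>w = gcd n d * s\<close> these are the
  monomials \<open>x\<^sup>i y\<^sup>j\<close>, with \<open>j\<close> fixed, that have poles of order at most \<open>s\<close> at infinity.
\<close>

definition xcount :: "nat \<Rightarrow> nat \<Rightarrow> nat \<Rightarrow> nat \<Rightarrow> nat" where
  "xcount n d w j = (if d * j \<le> w then (w - d * j) div n + 1 else 0)"

lemma less_xcount_iff:
  assumes "n > 0"
  shows "i < xcount n d w j \<longleftrightarrow> n * i + d * j \<le> w"
  using assms by (auto simp: xcount_def less_Suc_eq_le less_eq_div_iff_mult_less_eq algebra_simps)

text \<open>
  The floor is \<open>- 1\<close> just below the range where exponents exist, so the case distinction in
  \<open>xcount\<close> disappears there.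
\<close>

lemma int_xcount:
  assumes "n > 0" "d * j \<le> w + n"
  shows "int (xcount n d w j) = (int w - int d * int j) div int n + 1"
proof (cases "d * j \<le> w")
  case True
  then have "int w - int d * int j = int (w - d * j)"
    by (simp add: of_nat_diff)
  then show ?thesis using True by (simp add: xcount_def zdiv_int)
next
  case False
  have "(int w - int d * int j) div int n = -1"
  proof (rule int_div_pos_eq[where r = "int w + int n - int d * int j"])
    show "0 \<le> int w + int n - int d * int j"
      using assms(2) by (metis diff_ge_0_iff_ge of_nat_add of_nat_le_iff of_nat_mult)
    show "int w + int n - int d * int j < int n"
      using False by (metis add_diff_cancel_right' diff_less_0_iff_less linorder_not_le of_nat_less_iff of_nat_mult less_diff_eq diff_add_eq add.commute add_less_same_cancel1)
  qed auto
  then show ?thesis using False by (simp add: xcount_def)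
qed

lemma xcount_mono: "n > 0 \<Longrightarrow> w \<le> w' \<Longrightarrow> xcount n d w j \<le> xcount n d w' j"
  by (rule leI) (metis less_xcount_iff le_trans less_irrefl)

lemma xcount_add_n:
  assumes "n > 0" "d * j \<le> w + n"
  shows "xcount n d (w + n) j = xcount n d w j + 1"
proof (cases "d * j \<le> w")
  case True
  then have "w + n - d * j = (w - d * j) + n" by simp
  then show ?thesis using True assms by (simp add: xcount_def del: diff_add_assoc2 add_diff_assoc2)
next
  case False
  then have "w + n - d * j < n" using assms(1) by linarith
  then show ?thesis using False assms by (simp add: xcount_def)
qed

text \<open>
  Division by \<open>c\<close> reduces this to \<open>floor (z / n) + floor ((- 1 - z) / n) = - 1\<close> for integers.
\<close>

lemma div_add_div_reflect:
  fixes z n c :: int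
  assumes "n > 0" "c dvd n" "c dvd z" "c > 0"
  shows "z div n + (- c - z) div n = -1"
proof -
  obtain n' where n': "n = c * n'" using assms by (elim dvdE)
  obtain z' where z': "z = c * z'" using assms by (elim dvdE)
  have "n' > 0" using assms n' by (simp add: zero_less_mult_iff)
  have "- c - z = c * (- 1 - z')" by (simp add: z' algebra_simps)
  then have "(- c - z) div n = (- 1 - z') div n'" using assms n' by simp
  also have "\<dots> = - 1 - z' div n'"
  proof (rule int_div_pos_eq[where r = "n' - 1 - z' mod n'"])
    show "- 1 - z' = n' * (- 1 - z' div n') + (n' - 1 - z' mod n')"
      using mult_div_mod_eq[of n' z'] by (simp add: algebra_simps)
    show "0 \<le> n' - 1 - z' mod n'" "n' - 1 - z' mod n' < n'"
      using \<open>n' > 0\<close> pos_mod_bound[of n' z'] pos_mod_sign[of n' z'] by linarith+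
  qed
  finally show ?thesis using assms n' z' by simp
qed

definition floor_sum :: "nat \<Rightarrow> nat \<Rightarrow> int \<Rightarrow> int" where
  "floor_sum n d w = (\<Sum>j<n. (w - int d * int j) div int n)"

text \<open>
  Adding \<open>d\<close> shifts the summation index by one, so the two sums differ in their end terms only.
\<close>

lemma floor_sum_add_d:
  assumes "n > 0"
  shows "floor_sum n d (w + int d) = floor_sum n d w + int d"
proof -
  obtain k where k: "n = Suc k" using assms gr0_implies_Suc by blast
  define g where "g j = (w + int d - int d * int j) div int n" for j :: nat
  have "floor_sum n d (w + int d) = (\<Sum>j<n. g j)"
    by (simp add: floor_sum_def g_def)
  also have "\<dots> = g 0 + (\<Sum>j<k. g (Suc j))"
    unfolding k by (rule sum.lessThan_Suc_shift)
  finally have 1: "floor_sum n d (w + int d) = g 0 + (\<Sum>j<k. g (Suc j))" .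
  have "floor_sum n d w = (\<Sum>j<n. g (Suc j))"
    by (simp add: floor_sum_def g_def algebra_simps)
  then have 2: "floor_sum n d w = (\<Sum>j<k. g (Suc j)) + g n"
    by (simp add: k)
  have "g n = (w + int d + int n * (- int d)) div int n"
    by (simp add: g_def algebra_simps)
  also have "\<dots> = g 0 - int d"
    using assms by (subst div_mult_self2) (auto simp: g_def)
  finally show ?thesis using 1 2 by simp
qed

lemma floor_sum_add_n:
  assumes "n > 0"
  shows "floor_sum n d (w + int n) = floor_sum n d w + int n"
proof -
  have "(w + int n - int d * int j) div int n = (w - int d * int j) div int n + 1" for j
    using assms div_add_self2[of "int n" "w - int d * int j"] by (simp add: algebra_simps)
  then show ?thesis by (simp add: floor_sum_def sum.distrib)
qed

lemma shift_int_mult: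
  fixes F :: "int \<Rightarrow> int"
  assumes "\<And>w. F (w + t) = F w + t"
  shows "F (w + k * t) = F w + k * t"
proof (induction k rule: int_induct[where k = 0])
  case base
  show ?case by simp
next
  case (step1 i)
  have "F (w + (i + 1) * t) = F ((w + i * t) + t)" by (simp add: algebra_simps)
  then show ?case using step1 assms[of "w + i * t"] by (simp add: algebra_simps)
next
  case (step2 i)
  have "F (w + i * t) = F ((w + (i - 1) * t) + t)" by (simp add: algebra_simps)
  then show ?case using step2 assms[of "w + (i - 1) * t"] by (simp add: algebra_simps)
qed

text \<open>
  Let \<open>F = floor_sum n d\<close>.  The function \<open>F(w) - w\<close> is invariant under adding \<open>n\<close> and under adding \<open>d\<close>, hence constant on the
  multiples of \<open>gcd n d\<close>.  The constant \<open>F(0)\<close> follows from a second relation, obtained by reversing the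
  order of summation and reflecting each term.
\<close>

lemma floor_sum_eq:
  assumes "n > 0" "int (gcd n d) dvd w"
  shows "2 * floor_sum n d w = 2 * w + int (gcd n d) - int n - int d * (int n - 1)"
proof -
  let ?F = "floor_sum n d" and ?c = "int (gcd n d)"
  have lin: "?F w = w + ?F 0" if dvd: "?c dvd w" for w
  proof -
    obtain u v where uv: "u * int n + v * int d = ?c"
      using bezout_int[of "int n" "int d"] by auto
    obtain t where t: "w = ?c * t" using dvd by (elim dvdE)
    have w: "w = (0 + (u * t) * int n) + (v * t) * int d"
      using uv t by (simp add: algebra_simps) (metis distrib_left)
    have "?F w = ?F (0 + (u * t) * int n) + (v * t) * int d"
      unfolding w by (rule shift_int_mult) (rule floor_sum_add_d[OF assms(1)])
    also have "?F (0 + (u * t) * int n) = ?F 0 + (u * t) * int n"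
      by (rule shift_int_mult) (rule floor_sum_add_n[OF assms(1)])
    finally show ?thesis using w by simp
  qed
  have refl: "?F 0 + (\<Sum>j<n. (int d * int j - ?c) div int n) = - int n"
  proof -
    have "?F 0 + (\<Sum>j<n. (int d * int j - ?c) div int n) =
        (\<Sum>j<n. (0 - int d * int j) div int n + (- ?c - (0 - int d * int j)) div int n)"
      by (simp add: floor_sum_def sum.distrib algebra_simps)
    also have "\<dots> = (\<Sum>j<n. -1)"
      by (intro sum.cong refl div_add_div_reflect) (use assms in auto)
    finally show ?thesis by simp
  qed
  have "(\<Sum>j<n. (int d * int j - ?c) div int n)
      = (\<Sum>j<n. (int d * int (n - Suc j) - ?c) div int n)"
    by (rule sum.nat_diff_reindex[symmetric])
  also have "\<dots> = ?F (int d * (int n - 1) - ?c)"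
    unfolding floor_sum_def
    by (intro sum.cong refl arg_cong2[where f = "(div)"]) (auto simp: of_nat_diff algebra_simps)
  also have "\<dots> = int d * (int n - 1) - ?c + ?F 0"
    by (intro lin) auto
  finally show ?thesis using refl lin[OF assms(2)] by simp
qed

text \<open>
  Evenness of the numerator is read off from the value of the floor sum at \<open>0\<close>.
\<close>

lemma double_genus:
  assumes "n \<ge> 2" "d \<ge> 2"
  shows "2 * int (superelliptic_genus n d) = (int n - 1) * (int d - 1) + 1 - int (gcd n d)"
proof -
  have "int (gcd n d) dvd 0" by simp
  then have F: "2 * floor_sum n d 0 = int (gcd n d) - int n - int d * (int n - 1)"
    using floor_sum_eq[of n d 0] assms by simp
  have "gcd n d \<le> d" using assms by (simp add: gcd_le2_nat)
  also have "d = 1 * (d - 1) + 1" using assms by simp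
  also have "\<dots> \<le> (n - 1) * (d - 1) + 1"
    using assms by (intro add_right_mono mult_right_mono) auto
  finally have le: "gcd n d \<le> (n - 1) * (d - 1) + 1" .
  have eq: "int ((n - 1) * (d - 1) + 1 - gcd n d) = (int n - 1) * (int d - 1) + 1 - int (gcd n d)"
    using assms le by (simp add: of_nat_diff)
  also have "\<dots> = 2 * (1 - int n - floor_sum n d 0)"
    using F by (simp add: algebra_simps)
  finally have "even ((n - 1) * (d - 1) + 1 - gcd n d)"
    by (metis dvd_triv_left even_of_nat)
  then have "2 * superelliptic_genus n d = (n - 1) * (d - 1) + 1 - gcd n d"
    by (simp add: superelliptic_genus_def)
  then show ?thesis using eq by linarith
qed

text \<open>
  In terms of the monomial basis this is the Riemann--Roch formula for the multiples of large degree of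
  the divisor at infinity.
\<close>

lemma sum_xcount:
  assumes "n \<ge> 2" "d \<ge> 2" "gcd n d dvd w" "(n - 1) * d \<le> w"
  shows "int (\<Sum>j<n. xcount n d w j) = int w + 1 - int (superelliptic_genus n d)"
proof -
  have "int (xcount n d w j) = (int w - int d * int j) div int n + 1" if "j < n" for j
  proof (rule int_xcount)
    have "d * j \<le> d * (n - 1)" using that by (intro mult_left_mono) auto
    also have "\<dots> \<le> w + n" using assms(4) by (simp add: mult.commute)
    finally show "d * j \<le> w + n" .
  qed (use assms in auto)
  then have "int (\<Sum>j<n. xcount n d w j) = floor_sum n d (int w) + int n"
    by (simp add: floor_sum_def sum.distrib)
  moreover have "int (gcd n d) dvd int w" using assms(3) by (simp add: of_nat_dvd_iff)
  ultimately show ?thesis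
    using floor_sum_eq[of n d "int w"] double_genus[of n d] assms by (simp add: algebra_simps)
qed

text \<open>
  The numerical form of residue duality: exponents missing from the graded piece dual to \<open>j\<close> are counted by
  \<open>xcount\<close> for a complementary weight.  It holds because all quantities are multiples of \<open>c\<close>, so that
  reflection of a floor loses exactly \<open>c\<close>.
\<close>

lemma xcount_reflect:
  assumes "n > 0" "c dvd n" "c dvd d" "c dvd w" "c > 0" "w + c \<le> k * n"
  shows "k - (w + d * j) div n = xcount n d (k * n - c - w) j"
proof -
  let ?z = "w + d * j"
  have dvd: "int c dvd int ?z" using assms by (metis dvd_add dvd_mult2 of_nat_dvd_iff)
  have r: "int ?z div int n + (- int c - int ?z) div int n = -1"
    using assms dvd by (intro div_add_div_reflect) (auto simp: of_nat_dvd_iff)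
  have eq: "int (k * n - c - w) - int d * int j = (- int c - int ?z) + int k * int n"
    using assms by (simp add: of_nat_diff algebra_simps)
  show ?thesis
  proof (cases "d * j \<le> k * n - c - w")
    case True
    then have "int (xcount n d (k * n - c - w) j) = (- int c - int ?z) div int n + int k + 1"
      using assms(1) div_mult_self1[of "int n" "- int c - int ?z" "int k"]
      unfolding int_xcount[OF assms(1) trans_le_add1[OF True]] eq by simp
    then have *: "int (xcount n d (k * n - c - w) j) = int k - int (?z div n)"
      using r by (simp add: zdiv_int)
    then show ?thesis by linarith
  next
    case False
    then have lt: "k * n < c + ?z" using assms(6) by linarith
    have "k * n \<le> ?z"
    proof (rule ccontr)
      assume "\<not> k * n \<le> ?z"
      moreover have "c dvd k * n - ?z"
        using assms dvd by (intro dvd_diff_nat) (auto simp: of_nat_dvd_iff)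
      ultimately have "c \<le> k * n - ?z" by (intro dvd_imp_le) auto
      then show False using lt assms(5) by linarith
    qed
    then have "k \<le> ?z div n" using assms(1) by (simp add: less_eq_div_iff_mult_less_eq)
    then show ?thesis using False by (simp add: xcount_def)
  qed
qed

lemma xcount_add_le:
  assumes "n > 0" "a + b + n \<le> w"
  shows "xcount n d a j + xcount n d b j \<le> xcount n d w j"
proof (cases "d * j \<le> a \<and> d * j \<le> b")
  case True
  have "n * ((a - d * j) div n) \<le> a - d * j" "n * ((b - d * j) div n) \<le> b - d * j"
    by simp_all
  then have "n * ((a - d * j) div n + (b - d * j) div n + 1) + d * j \<le> w"
    using True assms(2) unfolding distrib_left by linarith
  then have "(a - d * j) div n + (b - d * j) div n + 1 < xcount n d w j"
    by (simp add: less_xcount_iff assms)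
  then show ?thesis using True by (simp add: xcount_def)
next
  case False
  then have "xcount n d a j = 0 \<or> xcount n d b j = 0" by (auto simp: xcount_def)
  then show ?thesis
    using xcount_mono[OF assms(1), of a w d j] xcount_mono[OF assms(1), of b w d j] assms(2) by auto
qed

text \<open>
  Subadditivity of the dimension with a spare \<open>n\<close>.  The shifted \<open>b\<close>-sum omits the exponent \<open>n - 1\<close>; at
  this exponent the spare \<open>n\<close> makes the inequality strict, the count for \<open>w\<close> being positive there.
\<close>

lemma xcount_sum_lt:
  assumes "n > 0" "a + b + n + 1 \<le> w" "(n - 1) * d \<le> w" 
  shows "(\<Sum>j<n. xcount n d a j + (if j = 0 then 0 else xcount n d b (j - 1)))
       < (\<Sum>j<n. xcount n d w j)"
proof -
  obtain k where k: "n = Suc k" using assms(1) gr0_implies_Suc by blast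
  have "(\<Sum>j<n. if j = 0 then 0 else xcount n d b (j - 1)) = (\<Sum>j<k. xcount n d b j)"
    unfolding k by (subst sum.lessThan_Suc_shift) simp
  then have "(\<Sum>j<n. xcount n d a j + (if j = 0 then 0 else xcount n d b (j - 1)))
      = (\<Sum>j<k. xcount n d a j + xcount n d b j) + xcount n d a k"
    by (simp add: sum.distrib k)
  also have "(\<Sum>j<k. xcount n d a j + xcount n d b j) \<le> (\<Sum>j<k. xcount n d w j)"
    by (intro sum_mono xcount_add_le) (use assms in auto)
  also have "xcount n d a k < xcount n d w k"
  proof (rule ccontr)
    assume "\<not> ?thesis"
    moreover have "0 < xcount n d w k"
      using assms(3) less_xcount_iff[OF assms(1), of 0 d w k] by (simp add: k mult.commute)
    ultimately have "xcount n d w k - 1 < xcount n d a k" by linarith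
    then have "n * (xcount n d w k - 1) + d * k \<le> a" by (simp add: less_xcount_iff assms)
    then have "n * xcount n d w k + d * k \<le> a + n"
      using \<open>0 < xcount n d w k\<close> by (cases "xcount n d w k") auto
    then have "xcount n d w k < xcount n d w k"
      using assms by (subst less_xcount_iff) auto
    then show False by simp
  qed
  finally show ?thesis by (simp add: k)
qed

text \<open>
  The term at \<open>j\<close> on the left is at most the ceiling of \<open>d j / n\<close>; it is compared with the term at
  \<open>n - 1 - j\<close> on the right, which exceeds the floor of \<open>d j / n\<close>.
\<close>

lemma sum_dual_xcount_lt:
  assumes "n > 0" "(k - 1) * n \<le> w" "(n - 1) * d \<le> w'" 
  shows "(\<Sum>j<n. k - xcount n d w j) < (\<Sum>j<n. xcount n d w' j)"
proof -
  have le: "k - xcount n d w j \<le> (d * j + n - 1) div n" for j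
  proof (rule ccontr)
    let ?e = "(d * j + n - 1) div n"
    assume "\<not> ?thesis"
    then have lt: "xcount n d w j < k - ?e" by simp
    have "d * j + n - 1 < n * (?e + 1)"
      using assms(1) by (metis Suc_eq_plus1 dividend_less_times_div mult_Suc_right)
    then have "d * j \<le> n * ?e" using assms(1) by simp
    moreover have "n * xcount n d w j + n * ?e \<le> (k - 1) * n"
    proof -
      have "xcount n d w j + ?e \<le> k - 1" using lt by simp
      then have "n * (xcount n d w j + ?e) \<le> n * (k - 1)" by (rule mult_left_mono) simp
      then show ?thesis by (simp add: algebra_simps)
    qed
    ultimately have "n * xcount n d w j + d * j \<le> w" using assms(2) by linarith
    then have "xcount n d w j < xcount n d w j" by (simp only: less_xcount_iff[OF assms(1)])
    then show False by simp
  qed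
  have gt: "d * j div n < xcount n d w' (n - Suc j)" if "j < n" for j
  proof -
    have "n * (d * j div n) \<le> d * j" by simp
    then have "n * (d * j div n) + d * (n - Suc j) \<le> d * j + d * (n - Suc j)" by simp
    also have "\<dots> = d * (n - 1)" using that by (simp flip: distrib_left)
    finally show ?thesis using assms(3) by (simp add: less_xcount_iff[OF assms(1)] mult.commute)
  qed
  have ceil: "(d * j + n - 1) div n \<le> d * j div n + 1" for j
  proof -
    have "(d * j + n - 1) div n \<le> (d * j + n) div n" by (intro div_le_mono) simp
    then show ?thesis using assms(1) by simp
  qed
  have "(\<Sum>j<n. k - xcount n d w j) < (\<Sum>j<n. xcount n d w' (n - Suc j))"
  proof (rule sum_strict_mono_strong[of _ 0])
    have "k - xcount n d w 0 \<le> 0" using le[of 0] assms(1) by simp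
    then show "k - xcount n d w 0 < xcount n d w' (n - Suc 0)" using gt[of 0] assms(1) by simp
  next
    fix j assume "j \<in> {..<n}"
    then show "k - xcount n d w j \<le> xcount n d w' (n - Suc j)"
      using le[of j] ceil[of j] gt[of j] by simp
  qed (use assms in auto)
  also have "\<dots> = (\<Sum>j<n. xcount n d w' j)" by (rule sum.nat_diff_reindex)
  finally show ?thesis .
qed

section \<open>Finite fields\<close>

text \<open>
  Translation by \<open>1\<close> permutes the field, so it does not change the sum of all elements.
\<close>

lemma of_nat_card_field: "(of_nat CARD('a) :: 'a :: {finite, field}) = 0"
proof -
  have "(\<Sum>x\<in>UNIV. x :: 'a) = (\<Sum>x\<in>UNIV. x + 1)"
    by (rule sum.reindex_bij_witness[of _ "\<lambda>x. x + 1" "\<lambda>x. x - 1"]) auto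
  then show ?thesis by (simp add: sum.distrib)
qed

lemma card_field_ge_2: "CARD('a :: {finite, field}) \<ge> 2"
proof -
  have "card {0, 1 :: 'a} \<le> CARD('a)" by (intro card_mono) auto
  then show ?thesis by simp
qed

text \<open>
  Multiplication by \<open>a\<close> permutes the nonzero elements, so it does not change their product.
\<close>

lemma power_card_minus_1:
  fixes a :: "'a :: {finite, field}"
  assumes "a \<noteq> 0"
  shows "a ^ (CARD('a) - 1) = 1"
proof -
  have "(\<Prod>x\<in>UNIV - {0}. x) = (\<Prod>x\<in>UNIV - {0}. a * x)"
    by (rule prod.reindex_bij_witness[of _ "\<lambda>x. a * x" "\<lambda>x. x / a"]) (use assms in auto)
  also have "\<dots> = a ^ (CARD('a) - 1) * (\<Prod>x\<in>UNIV - {0}. x)"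
    by (simp add: prod.distrib card_Diff_singleton)
  finally show ?thesis by simp
qed

lemma of_nat_dvd_card_minus_1:
  assumes "n dvd CARD('a :: {finite, field}) - 1"
  shows "(of_nat n :: 'a) \<noteq> 0"
proof
  assume "(of_nat n :: 'a) = 0"
  moreover obtain k where k: "CARD('a) - 1 = n * k" using assms by (elim dvdE)
  ultimately have "(of_nat (CARD('a) - 1) :: 'a) = 0" by simp
  then have "(of_nat (CARD('a) - 1) :: 'a) + 1 = 1" by simp
  moreover have "(of_nat (CARD('a) - 1) :: 'a) + 1 = of_nat CARD('a)"
    by (metis One_nat_def Suc_pred of_nat_Suc add.commute zero_less_card_finite)
  ultimately show False by (simp add: of_nat_card_field)
qed

lemma card_eq_power_le:
  fixes c :: "'a :: idom"
  assumes "k > 0"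
  shows "card {x. x ^ k = c} \<le> k" "finite {x. x ^ k = c}"
proof -
  let ?p = "monom 1 k - [:c:]"
  have "coeff ?p k = 1" using assms by (cases k) simp_all
  then have nz: "?p \<noteq> 0" by (metis coeff_0 zero_neq_one)
  have eq: "{x. poly ?p x = 0} = {x. x ^ k = c}" by (simp add: poly_monom)
  have "degree ?p \<le> k" by (intro degree_diff_le) (auto simp: degree_monom_le)
  then show "card {x. x ^ k = c} \<le> k" using card_poly_roots_bound[OF nz] eq by simp
  show "finite {x. x ^ k = c}" using poly_roots_finite[OF nz] eq by simp
qed

text \<open>
  Every nonzero element is a root of \<open>X\<^sup>n - 1\<close> or of the cofactor of \<open>X\<^sup>n - 1\<close> in
  \<open>X\<^sup>q\<^sup>-\<^sup>1 - 1\<close>, and the cofactor has at most \<open>q - 1 - n\<close> roots.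
\<close>

lemma card_roots_of_unity:
  assumes n: "n dvd CARD('a :: {finite, field}) - 1" "n > 0"
  shows "card {z :: 'a. z ^ n = 1} = n"
proof (rule antisym)
  show "card {z :: 'a. z ^ n = 1} \<le> n" by (rule card_eq_power_le[OF n(2)])
  obtain k where k: "CARD('a) - 1 = n * k" using n(1) by (elim dvdE)
  have "k > 0" using k card_field_ge_2[where 'a = 'a] by (cases k) auto
  let ?g = "\<Sum>i<k. monom (1 :: 'a) (n * i)"
  have "coeff ?g 0 = (\<Sum>i<k. if i = 0 then 1 else 0)"
    using n by (simp add: coeff_sum cong: if_cong)
  then have "coeff ?g 0 = 1" using \<open>k > 0\<close> by (simp add: sum.delta)
  then have gnz: "?g \<noteq> 0" by auto
  have "degree ?g \<le> n * (k - 1)"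
  proof (rule degree_sum_le)
    fix i assume "i \<in> {..<k}"
    then have "n * i \<le> n * (k - 1)" by (intro mult_left_mono) auto
    then show "degree (monom (1 :: 'a) (n * i)) \<le> n * (k - 1)"
      using degree_monom_le le_trans by blast
  qed simp
  then have cg: "card {x. poly ?g x = 0} \<le> n * (k - 1)"
    using card_poly_roots_bound[OF gnz] by linarith
  have "UNIV - {0} \<subseteq> {z :: 'a. z ^ n = 1} \<union> {x. poly ?g x = 0}"
  proof safe
    fix x :: 'a assume x: "x \<noteq> 0" "poly ?g x \<noteq> 0"
    have "1 - x ^ (n * k) = (1 - x ^ n) * (\<Sum>i<k. (x ^ n) ^ i)"
      by (simp add: power_mult one_diff_power_eq)
    also have "x ^ (n * k) = 1" using power_card_minus_1[OF x(1)] k by simp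
    also have "(\<Sum>i<k. (x ^ n) ^ i) = poly ?g x" by (simp add: poly_sum poly_monom power_mult)
    finally show "x ^ n = 1" using x by simp
  qed
  then have "card (UNIV - {0 :: 'a}) \<le> card ({z :: 'a. z ^ n = 1} \<union> {x. poly ?g x = 0})"
    by (intro card_mono) auto
  also have "\<dots> \<le> card {z :: 'a. z ^ n = 1} + card {x. poly ?g x = 0}"
    by (rule card_Un_le)
  finally have "n * k \<le> card {z :: 'a. z ^ n = 1} + n * (k - 1)"
    using cg k by (simp add: card_Diff_singleton)
  then show "n \<le> card {z :: 'a. z ^ n = 1}"
    using \<open>k > 0\<close> by (cases k) simp_all
qed

text \<open>
  If \<open>n\<close> does not divide \<open>j\<close>, some root of unity \<open>w\<close> has \<open>w\<^sup>j \<noteq> 1\<close>, since \<open>X\<^sup>j - 1\<close> with \<open>j\<close>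
  reduced modulo \<open>n\<close> has too few roots; multiplication by \<open>w\<close> then scales the sum by \<open>w\<^sup>j\<close>.
\<close>

lemma sum_roots_of_unity:
  assumes n: "n dvd CARD('a :: {finite, field}) - 1" "n > 0"
  shows "(\<Sum>z | z ^ n = (1 :: 'a). z ^ j) = (if n dvd j then of_nat n else 0)"
proof (cases "n dvd j")
  case True
  then obtain k where "j = n * k" by (elim dvdE)
  then have "(\<Sum>z | z ^ n = (1 :: 'a). z ^ j) = (\<Sum>z | z ^ n = (1 :: 'a). 1)"
    by (intro sum.cong) (auto simp: power_mult)
  then show ?thesis using True card_roots_of_unity[OF n] by simp
next
  case False
  then have r: "j mod n > 0" "j mod n < n" using n(2) by (auto simp: dvd_eq_mod_eq_0)
  have "\<exists>w :: 'a. w ^ n = 1 \<and> w ^ j \<noteq> 1"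
  proof (rule ccontr)
    assume *: "\<not> ?thesis"
    have "{z :: 'a. z ^ n = 1} \<subseteq> {z. z ^ (j mod n) = 1}"
    proof safe
      fix z :: 'a assume z: "z ^ n = 1"
      have "z ^ j = z ^ (n * (j div n) + j mod n)" by simp
      also have "\<dots> = z ^ (j mod n)" using z by (simp only: power_add power_mult) simp
      finally show "z ^ (j mod n) = 1" using * z by auto
    qed
    then have "n \<le> card {z :: 'a. z ^ (j mod n) = 1}"
      using card_roots_of_unity[OF n] card_mono[OF card_eq_power_le(2)[OF r(1)]] by metis
    then show False using card_eq_power_le(1)[OF r(1), of "1 :: 'a"] r(2) by linarith
  qed
  then obtain w :: 'a where w: "w ^ n = 1" "w ^ j \<noteq> 1" by blast
  then have "w \<noteq> 0" using n(2) by (auto simp: power_0_left)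
  have "(\<Sum>z | z ^ n = (1 :: 'a). z ^ j) = (\<Sum>z | z ^ n = (1 :: 'a). (w * z) ^ j)"
    by (rule sum.reindex_bij_witness[of _ "\<lambda>z. w * z" "\<lambda>z. z / w"])
      (use w \<open>w \<noteq> 0\<close> in \<open>auto simp: power_mult_distrib power_divide\<close>)
  also have "\<dots> = w ^ j * (\<Sum>z | z ^ n = (1 :: 'a). z ^ j)"
    by (simp add: power_mult_distrib sum_distrib_left)
  finally have "(1 - w ^ j) * (\<Sum>z | z ^ n = (1 :: 'a). z ^ j) = 0" by (simp add: algebra_simps)
  then show ?thesis using w(2) False by auto
qed

lemma sum_nth_roots:
  assumes n: "n dvd CARD('a :: {finite, field}) - 1" "n > 0" and b: "b ^ n = a" "a \<noteq> (0 :: 'a)"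
  shows "(\<Sum>z | z ^ n = a. z ^ j) = (if n dvd j then of_nat n * a ^ (j div n) else 0)"
proof -
  have "b \<noteq> 0" using b n(2) by (auto simp: power_0_left)
  have "(\<Sum>z | z ^ n = a. z ^ j) = (\<Sum>z | z ^ n = 1. (b * z) ^ j)"
    by (rule sum.reindex_bij_witness[of _ "\<lambda>z. b * z" "\<lambda>z. z / b"])
      (use b \<open>b \<noteq> 0\<close> in \<open>auto simp: power_mult_distrib power_divide\<close>)
  also have "\<dots> = b ^ j * (\<Sum>z | z ^ n = (1 :: 'a). z ^ j)"
    by (simp add: power_mult_distrib sum_distrib_left)
  also have "\<dots> = (if n dvd j then of_nat n * a ^ (j div n) else 0)"
    using b by (auto simp: sum_roots_of_unity[OF n] simp flip: power_mult)
  finally show ?thesis .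
qed

lemma sum_powers_field:
  assumes "i \<le> CARD('a :: {finite, field}) - 1"
  shows "(\<Sum>a\<in>(UNIV :: 'a set). a ^ i) = (if i = CARD('a) - 1 then - 1 else 0)"
proof -
  let ?m = "CARD('a) - 1"
  have m: "?m > 0" using card_field_ge_2[where 'a = 'a] by simp
  have "{z :: 'a. z ^ ?m = 1} = UNIV - {0}"
    using power_card_minus_1 m by (auto simp: power_0_left)
  then have "(\<Sum>a\<in>(UNIV :: 'a set). a ^ i) = 0 ^ i + (\<Sum>z | z ^ ?m = (1 :: 'a). z ^ i)"
    by (subst sum.remove[of UNIV 0]) auto
  also have "(\<Sum>z | z ^ ?m = (1 :: 'a). z ^ i) = (if ?m dvd i then of_nat ?m else 0)"
    by (rule sum_roots_of_unity) (use m in auto)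
  also have "(of_nat ?m :: 'a) = - 1"
    using m by (simp add: of_nat_diff of_nat_card_field)
  finally have eq: "(\<Sum>a\<in>(UNIV :: 'a set). a ^ i) = 0 ^ i + (if ?m dvd i then - 1 else 0)" .
  consider "i = 0" | "0 < i" "i < ?m" | "i = ?m" using assms by linarith
  then show ?thesis
  proof cases
    case 2
    then have "\<not> ?m dvd i" using dvd_imp_le by fastforce
    then show ?thesis using eq 2 by simp
  qed (use eq m in auto)
qed

section \<open>Polynomials of bounded degree\<close>

definition bounded_polys :: "nat \<Rightarrow> 'a :: zero poly set" where
  "bounded_polys k = {p. \<forall>i\<ge>k. coeff p i = 0}"

lemma bounded_polys_iff: "p \<in> bounded_polys k \<longleftrightarrow> p = 0 \<or> degree p < k"
proof
  assume "p \<in> bounded_polys k"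
  then have "degree p \<ge> k \<Longrightarrow> lead_coeff p = 0" by (simp add: bounded_polys_def)
  then show "p = 0 \<or> degree p < k" by (auto simp: not_le)
next
  assume "p = 0 \<or> degree p < k"
  then show "p \<in> bounded_polys k" by (auto simp: bounded_polys_def coeff_eq_0)
qed

lemma bounded_polys_0 [simp]: "bounded_polys 0 = {0}"
  by (auto simp: bounded_polys_iff)

lemma zero_in_bounded_polys [simp]: "0 \<in> bounded_polys k"
  by (simp add: bounded_polys_def)

lemma bounded_polys_add: "p \<in> bounded_polys k \<Longrightarrow> q \<in> bounded_polys k \<Longrightarrow> p + q \<in> bounded_polys k"
  by (simp add: bounded_polys_def)

lemma bounded_polys_diff:
  "p \<in> bounded_polys k \<Longrightarrow> q \<in> bounded_polys k \<Longrightarrow> p - q \<in> bounded_polys (k :: nat)"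
  for p q :: "'a :: ab_group_add poly"
  by (simp add: bounded_polys_def)

lemma bounded_polys_smult: "p \<in> bounded_polys k \<Longrightarrow> smult c p \<in> bounded_polys k"
  by (simp add: bounded_polys_def)

lemma bounded_polys_mono: "p \<in> bounded_polys k \<Longrightarrow> k \<le> l \<Longrightarrow> p \<in> bounded_polys l"
  by (auto simp: bounded_polys_def)

lemma card_bounded_polys:
  "finite (bounded_polys k :: 'a :: {finite, field} poly set)
   \<and> card (bounded_polys k :: 'a poly set) = CARD('a) ^ k"
proof (induction k)
  case 0
  then show ?case by simp
next
  case (Suc k)
  let ?f = "\<lambda>(a, p). pCons a p :: 'a poly"
  have eq: "bounded_polys (Suc k) = ?f ` (UNIV \<times> bounded_polys k)"
  proof safe
    fix p :: "'a poly" assume p: "p \<in> bounded_polys (Suc k)"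
    obtain a p' where pp: "p = pCons a p'" by (cases p)
    then have "coeff p' i = 0" if "i \<ge> k" for i
      using p that by (auto simp: bounded_polys_def coeff_pCons dest!: spec[of _ "Suc i"])
    then show "p \<in> ?f ` (UNIV \<times> bounded_polys k)"
      using pp by (auto simp: bounded_polys_def)
  qed (auto simp: bounded_polys_def coeff_pCons split: nat.split)
  have "inj_on ?f (UNIV \<times> bounded_polys k)" by (auto simp: inj_on_def)
  then show ?case using Suc by (simp add: eq card_image card_cartesian_product)
qed

lemma bounded_poly_eq_0:
  fixes p :: "'a :: idom poly"
  assumes "p \<in> bounded_polys (card R)" "finite R" "\<And>a. a \<in> R \<Longrightarrow> poly p a = 0"
  shows "p = 0"
proof (rule ccontr)
  assume "p \<noteq> 0"
  then have "card R \<le> card {x. poly p x = 0}"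
    using assms by (intro card_mono poly_roots_finite) auto
  also have "\<dots> \<le> degree p" by (rule card_poly_roots_bound[OF \<open>p \<noteq> 0\<close>])
  finally show False using assms(1) \<open>p \<noteq> 0\<close> by (auto simp: bounded_polys_iff)
qed

text \<open>
  Evaluation is injective on polynomials of degree below \<open>q\<close>, and there are as many of them as functions.
\<close>

lemma interpolation_exists:
  fixes g :: "'a :: {finite, field} \<Rightarrow> 'a"
  obtains p where "p \<in> bounded_polys CARD('a)" "\<And>a. poly p a = g a"
proof -
  let ?B = "bounded_polys CARD('a) :: 'a poly set"
  have inj: "inj_on poly ?B"
  proof
    fix p p' :: "'a poly" assume p: "p \<in> ?B" "p' \<in> ?B" "poly p = poly p'"
    have "p - p' = 0"
      by (rule bounded_poly_eq_0[of _ UNIV]) (use p bounded_polys_diff in auto)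
    then show "p = p'" by simp
  qed
  have "poly ` ?B = UNIV"
  proof (rule card_subset_eq)
    show "card (poly ` ?B) = card (UNIV :: ('a \<Rightarrow> 'a) set)"
      by (simp add: card_image[OF inj] card_bounded_polys card_fun)
  qed auto
  then have "g \<in> poly ` ?B" by simp
  then show ?thesis using that by auto
qed

definition root_poly :: "'a :: field set \<Rightarrow> 'a poly" where
  "root_poly R = (\<Prod>a\<in>R. [:- a, 1:])"

lemma root_poly_nz: "finite R \<Longrightarrow> root_poly R \<noteq> 0"
  by (auto simp: root_poly_def)

lemma degree_root_poly: "finite R \<Longrightarrow> degree (root_poly R) = card R"
  by (simp add: root_poly_def degree_prod_eq_sum_degree)

lemma poly_root_poly_eq_0_iff: "finite R \<Longrightarrow> poly (root_poly R) x = 0 \<longleftrightarrow> x \<in> R"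
  by (auto simp: root_poly_def poly_prod)

lemma root_poly_dvd:
  assumes "finite R" "\<And>a. a \<in> R \<Longrightarrow> poly p a = 0"
  shows "root_poly R dvd p"
  using assms
proof (induction R rule: finite_induct)
  case empty
  then show ?case by (simp add: root_poly_def)
next
  case (insert a R)
  then obtain p' where p': "p = root_poly R * p'" by (auto elim!: dvdE)
  have "poly (root_poly R) a \<noteq> 0" using insert by (simp add: poly_root_poly_eq_0_iff)
  then have "poly p' a = 0" using insert.prems[of a] p' by simp
  then have "[:- a, 1:] dvd p'" by (simp add: poly_eq_0_iff_dvd)
  then have "[:- a, 1:] * root_poly R dvd p' * root_poly R" by (intro mult_dvd_mono) auto
  then show ?case using insert p' by (simp add: root_poly_def mult.commute)
qed

lemma dvd_bounded_polysE:
  fixes g :: "'a :: field poly"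
  assumes "g dvd p" "g \<noteq> 0" "p \<in> bounded_polys k"
  obtains h where "p = g * h" "h \<in> bounded_polys (k - degree g)"
proof -
  obtain h where h: "p = g * h" using assms(1) by (elim dvdE)
  have "h \<in> bounded_polys (k - degree g)"
    using assms(2,3) by (cases "h = 0") (auto simp: h bounded_polys_iff degree_mult_eq)
  then show ?thesis using that h by blast
qed

lemma poly_as_sum_of_le:
  fixes p :: "'a :: comm_ring_1 poly"
  assumes "degree p \<le> k"
  shows "poly p x = (\<Sum>i\<le>k. coeff p i * x ^ i)"
  unfolding poly_altdef
  by (rule sum.mono_neutral_left) (use assms in \<open>auto simp: coeff_eq_0\<close>)

lemma sum_poly_field:
  fixes p :: "'a :: {finite, field} poly"
  assumes "p \<in> bounded_polys CARD('a)"
  shows "(\<Sum>a\<in>UNIV. poly p a) = - coeff p (CARD('a) - 1)"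
proof -
  let ?q = "CARD('a)"
  have q: "?q = Suc (?q - 1)" by simp
  have deg: "degree p \<le> ?q - 1"
    using assms q by (auto simp: bounded_polys_iff)
  have "(\<Sum>a\<in>UNIV. poly p a) = (\<Sum>a\<in>UNIV. \<Sum>i\<le>?q - 1. coeff p i * a ^ i)"
    by (intro sum.cong refl) (rule poly_as_sum_of_le[OF deg])
  also have "\<dots> = (\<Sum>i\<le>?q - 1. coeff p i * (\<Sum>a\<in>UNIV. a ^ i))"
    by (subst sum.swap) (simp add: sum_distrib_left)
  also have "\<dots> = (\<Sum>i\<le>?q - 1. if i = ?q - 1 then - coeff p i else 0)"
    by (intro sum.cong refl) (auto simp: sum_powers_field)
  finally show ?thesis by simp
qed

section \<open>Duality for evaluation of polynomials on a subset of a finite field\<close>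

text \<open>
  Power sums extract coefficients: once the coefficients above \<open>q - 1 - i\<close> vanish, the sum of
  \<open>p(a) a\<^sup>i\<close> is minus the coefficient at \<open>q - 1 - i\<close>.  The orthogonality relations thus remove the top
  coefficients one at a time.
\<close>

lemma orthogonal_imp_bounded:
  fixes p :: "'a :: {finite, field} poly"
  assumes p: "p \<in> bounded_polys CARD('a)"
    and orth: "\<And>i. i < k \<Longrightarrow> (\<Sum>a\<in>UNIV. poly p a * a ^ i) = 0"
  shows "p \<in> bounded_polys (CARD('a) - k)"
  using orth
proof (induction k)
  case 0
  then show ?case using p by simp
next
  case (Suc k)
  then have IH: "p \<in> bounded_polys (CARD('a) - k)" by auto
  show ?case
  proof (cases "k < CARD('a)")
    case True
    have "p * monom 1 k \<in> bounded_polys CARD('a)"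
      using IH True by (cases "p = 0") (auto simp: bounded_polys_iff degree_mult_eq degree_monom_eq)
    then have "(\<Sum>a\<in>UNIV. poly (p * monom 1 k) a) = - coeff (p * monom 1 k) (CARD('a) - 1)"
      by (rule sum_poly_field)
    also have "(\<Sum>a\<in>UNIV. poly (p * monom 1 k) a) = 0"
      using Suc.prems[of k] by (simp add: poly_monom)
    finally have "coeff p (CARD('a) - 1 - k) = 0"
      using True by (simp add: mult.commute[of p] coeff_monom_mult split: if_splits)
    have "coeff p i = 0" if "i \<ge> CARD('a) - Suc k" for i
    proof (cases "i = CARD('a) - 1 - k")
      case False
      then have "i \<ge> CARD('a) - k" using that by simp
      then show ?thesis using IH by (simp add: bounded_polys_def)
    qed (use \<open>coeff p (CARD('a) - 1 - k) = 0\<close> in simp)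
    then show ?thesis by (simp add: bounded_polys_def)
  qed (use IH in simp)
qed

lemma card_Compl_eq: "card (- S) = CARD('a) - card S" for S :: "'a :: finite set"
  by (simp add: Compl_eq_Diff_UNIV card_Diff_subset)

text \<open>
  A word on \<open>S\<close>, extended by zero to the field and interpolated, becomes a multiple of the polynomial
  with roots off \<open>S\<close>; orthogonality bounds the degree of the interpolating polynomial.  This describes
  the dual of a Reed--Solomon code on \<open>S\<close> without division by the derivative of \<open>root_poly S\<close>.
\<close>

lemma orthogonal_word_poly:
  fixes S :: "'a :: {finite, field} set" and g :: "'a \<Rightarrow> 'a"
  assumes orth: "\<And>i. i < k \<Longrightarrow> (\<Sum>a\<in>S. g a * a ^ i) = 0"
  obtains V where "V \<in> bounded_polys (card S - k)"
    "root_poly (- S) * V \<in> bounded_polys (CARD('a) - k)"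
    "\<And>a. a \<in> S \<Longrightarrow> poly (root_poly (- S) * V) a = g a"
proof -
  obtain p :: "'a poly" where p: "p \<in> bounded_polys CARD('a)"
      "\<And>a. poly p a = (if a \<in> S then g a else 0)"
    by (rule interpolation_exists[of "\<lambda>a. if a \<in> S then g a else 0"]) blast
  have "p \<in> bounded_polys (CARD('a) - k)"
  proof (rule orthogonal_imp_bounded[OF p(1)])
    fix i assume "i < k"
    have "(\<Sum>a\<in>UNIV. poly p a * a ^ i) = (\<Sum>a\<in>S. g a * a ^ i)"
      by (rule sum.mono_neutral_cong_right) (auto simp: p(2))
    then show "(\<Sum>a\<in>UNIV. poly p a * a ^ i) = 0" using orth[OF \<open>i < k\<close>] by simp
  qed
  moreover have "root_poly (- S) dvd p" by (rule root_poly_dvd) (auto simp: p(2))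
  ultimately obtain V where V: "p = root_poly (- S) * V"
      "V \<in> bounded_polys (CARD('a) - k - degree (root_poly (- S)))"
    using root_poly_nz dvd_bounded_polysE by (metis finite)
  have "CARD('a) - k - degree (root_poly (- S)) = card S - k"
    using card_mono[of UNIV S] by (simp add: degree_root_poly card_Compl_eq)
  then show ?thesis using that V p \<open>p \<in> bounded_polys (CARD('a) - k)\<close> by auto
qed

lemma card_orthogonal_words:
  fixes S :: "'a :: {finite, field} set" and h :: "'a \<Rightarrow> 'a"
  assumes "\<And>a. h a \<noteq> 0"
  shows "card {g. (\<forall>a. a \<notin> S \<longrightarrow> g a = 0) \<and> (\<forall>i<k. (\<Sum>a\<in>S. g a * h a * a ^ i) = 0)}
    \<le> CARD('a) ^ (card S - k)"
proof -
  let ?A = "{g. (\<forall>a. a \<notin> S \<longrightarrow> g a = 0) \<and> (\<forall>i<k. (\<Sum>a\<in>S. g a * h a * a ^ i) = 0)}"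
  let ?f = "\<lambda>V a. if a \<in> S then poly (root_poly (- S) * V) a / h a else 0"
  have "?A \<subseteq> ?f ` bounded_polys (card S - k)"
  proof
    fix g assume g: "g \<in> ?A"
    obtain V where "V \<in> bounded_polys (card S - k)"
      "\<And>a. a \<in> S \<Longrightarrow> poly (root_poly (- S) * V) a = g a * h a"
      by (rule orthogonal_word_poly[where k = k and S = S and g = "\<lambda>a. g a * h a"]) (use g in auto)
    then show "g \<in> ?f ` bounded_polys (card S - k)"
      using g assms by (intro image_eqI[of _ _ V]) (auto simp: fun_eq_iff)
  qed
  then have "card ?A \<le> card (?f ` bounded_polys (card S - k))"
    by (intro card_mono finite_imageI) (simp add: card_bounded_polys)
  also have "\<dots> \<le> card (bounded_polys (card S - k) :: 'a poly set)"
    by (intro card_image_le) (simp add: card_bounded_polys)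
  finally show ?thesis by (simp add: card_bounded_polys)
qed

lemma card_le_fibres:
  assumes "finite B" "F ` A \<subseteq> B" "\<And>b. b \<in> B \<Longrightarrow> finite {x \<in> A. F x = b} \<and> card {x \<in> A. F x = b} \<le> m"
  shows "card A \<le> card B * m"
proof -
  have "A = (\<Union>b\<in>B. {x \<in> A. F x = b})" using assms(2) by auto
  then have "card A \<le> (\<Sum>b\<in>B. card {x \<in> A. F x = b})"
    using card_UN_le[OF assms(1), of "\<lambda>b. {x \<in> A. F x = b}"] by simp
  also have "\<dots> \<le> (\<Sum>b\<in>B. m)" by (intro sum_mono) (use assms(3) in auto)
  finally show ?thesis by simp
qed

text \<open>
  Write \<open>E = root_poly (- S)\<close> and \<open>T = root_poly S\<close>.  Orthogonality means \<open>U h = E V + T Q\<close> with bounded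
  degrees.  The polynomial \<open>Q\<close> has at most \<open>k + e - card S\<close> coefficients.  Two \<open>U\<close> with the same \<open>Q\<close> differ by a
  multiple of \<open>E\<close> because \<open>h\<close> has no roots, and at most \<open>card S - k' - e\<close> coefficients of the cofactor are free.
\<close>

lemma card_hull_component:
  fixes S :: "'a :: {finite, field} set" and h :: "'a poly"
  assumes h: "\<And>a. poly h a \<noteq> 0" "degree h = e" and le: "CARD('a) - k' \<le> k + e"
  shows "card {U \<in> bounded_polys k. \<forall>i<k'. (\<Sum>a\<in>S. poly U a * poly h a * a ^ i) = 0}
    \<le> CARD('a) ^ ((k + e - card S) + (card S - k' - e))"
proof -
  define A where "A = {U \<in> bounded_polys k. \<forall>i<k'. (\<Sum>a\<in>S. poly U a * poly h a * a ^ i) = 0}"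
  let ?E = "root_poly (- S)" and ?T = "root_poly S"
  let ?V = "bounded_polys (card S - k') :: 'a poly set"
  have hnz: "h \<noteq> 0" using h(1) by auto
  have "\<exists>Q \<in> bounded_polys (k + e - card S). \<exists>V \<in> ?V.
      ?E * V \<in> bounded_polys (CARD('a) - k') \<and> U * h = ?E * V + ?T * Q" if U: "U \<in> A" for U
  proof -
    obtain V where V: "V \<in> ?V" "?E * V \<in> bounded_polys (CARD('a) - k')"
      "\<And>a. a \<in> S \<Longrightarrow> poly (?E * V) a = poly U a * poly h a"
      by (rule orthogonal_word_poly[where k = k' and S = S and g = "\<lambda>a. poly U a * poly h a"])
        (use U in \<open>auto simp: A_def\<close>)
    have "U * h \<in> bounded_polys (k + e)"
      using that h(2) hnz by (cases "U = 0") (auto simp: A_def bounded_polys_iff degree_mult_eq)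
    then have "U * h - ?E * V \<in> bounded_polys (k + e)"
      by (rule bounded_polys_diff) (use V(2) le bounded_polys_mono in blast)
    moreover have "?T dvd U * h - ?E * V" by (rule root_poly_dvd) (use V(3) in auto)
    ultimately obtain Q where "U * h - ?E * V = ?T * Q" "Q \<in> bounded_polys (k + e - degree ?T)"
      using root_poly_nz dvd_bounded_polysE by (metis finite)
    then show ?thesis using V by (auto simp: degree_root_poly diff_eq_eq add.commute)
  qed
  then obtain Q V where QV: "\<And>U. U \<in> A \<Longrightarrow> Q U \<in> bounded_polys (k + e - card S)"
    "\<And>U. U \<in> A \<Longrightarrow> ?E * V U \<in> bounded_polys (CARD('a) - k')"
    "\<And>U. U \<in> A \<Longrightarrow> U * h = ?E * V U + ?T * Q U" by metis
  have fib: "finite {U \<in> A. Q U = b} \<and> card {U \<in> A. Q U = b} \<le> CARD('a) ^ (card S - k' - e)" for b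
  proof (cases "{U \<in> A. Q U = b} = {}")
    case True
    then show ?thesis unfolding True by simp
  next
    case False
    then obtain U0 where U0: "U0 \<in> A" "Q U0 = b" by auto
    let ?g = "\<lambda>W. U0 + ?E * W"
    have sub: "{U \<in> A. Q U = b} \<subseteq> ?g ` bounded_polys (card S - k' - e)"
    proof safe
      fix U assume U: "U \<in> A" "b = Q U"
      have eq: "(U - U0) * h = ?E * V U - ?E * V U0"
        using QV(3)[OF U(1)] QV(3)[OF U0(1)] U0 U by (simp add: algebra_simps)
      have "?E dvd U - U0"
      proof (rule root_poly_dvd)
        fix a assume "a \<in> - S"
        then have "poly ?E a = 0" by (simp add: poly_root_poly_eq_0_iff)
        then have "poly ((U - U0) * h) a = 0" by (simp add: eq)
        then show "poly (U - U0) a = 0" using h(1)[of a] by simp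
      qed simp
      then obtain W where W: "U - U0 = ?E * W" by (elim dvdE)
      have "(U - U0) * h \<in> bounded_polys (CARD('a) - k')"
        unfolding eq by (intro bounded_polys_diff QV U U0)
      then have "W * (?E * h) \<in> bounded_polys (CARD('a) - k')"
        by (simp add: W algebra_simps)
      then have "W \<in> bounded_polys (CARD('a) - k' - degree (?E * h))"
        using hnz root_poly_nz[of "- S"]
        by (cases "W = 0") (auto simp: bounded_polys_iff degree_mult_eq)
      moreover have "CARD('a) - k' - degree (?E * h) = card S - k' - e"
        using hnz root_poly_nz[of "- S"] h(2) card_mono[of UNIV S]
        by (simp add: degree_mult_eq degree_root_poly card_Compl_eq)
      ultimately show "U \<in> ?g ` bounded_polys (card S - k' - e)"
        using W by (intro image_eqI[of _ _ W]) (auto simp: algebra_simps)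
    qed
    have fin: "finite (?g ` bounded_polys (card S - k' - e))"
      by (intro finite_imageI) (simp add: card_bounded_polys)
    have "card (?g ` bounded_polys (card S - k' - e)) \<le> card (bounded_polys (card S - k' - e) :: 'a poly set)"
      by (intro card_image_le) (simp add: card_bounded_polys)
    then show ?thesis
      using finite_subset[OF sub fin] card_mono[OF fin sub] by (simp add: card_bounded_polys)
  qed
  have "card A \<le> card (bounded_polys (k + e - card S) :: 'a poly set) * CARD('a) ^ (card S - k' - e)"
    by (rule card_le_fibres[of _ Q]) (use QV fib in \<open>auto simp: card_bounded_polys\<close>)
  then show ?thesis by (simp add: A_def card_bounded_polys power_add)
qed

section \<open>Dimension and cardinality\<close>

text \<open>
  Coordinates with respect to a basis.
\<close>

lemma card_subspace:
  fixes scale :: "'a :: {finite, field} \<Rightarrow> 'b :: ab_group_add \<Rightarrow> 'b"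
  assumes "vector_space scale" "module.subspace scale V" "finite V"
  shows "card V = CARD('a) ^ vector_space.dim scale V"
proof -
  interpret vector_space scale by fact
  obtain B where B: "B \<subseteq> V" "independent B" "V \<subseteq> span B" "card B = dim V"
    by (rule basis_exists[of V])
  have finB: "finite B" using B(1) assms(3) finite_subset by blast
  have spanB: "span B = V" using B assms(2) span_minimal by blast
  let ?g = "\<lambda>u. \<Sum>b\<in>B. scale (u b) b"
  have "V = ?g ` (B \<rightarrow>\<^sub>E UNIV)"
  proof -
    have "range ?g \<subseteq> ?g ` (B \<rightarrow>\<^sub>E UNIV)"
    proof
      fix x assume "x \<in> range ?g"
      then obtain u where u: "x = ?g u" by blast
      have "x = ?g (restrict u B)" unfolding u by (rule sum.cong) simp_all
      moreover have "restrict u B \<in> B \<rightarrow>\<^sub>E UNIV" by simp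
      ultimately show "x \<in> ?g ` (B \<rightarrow>\<^sub>E UNIV)" by blast
    qed
    then have "range ?g = ?g ` (B \<rightarrow>\<^sub>E UNIV)" by (intro antisym) auto
    then show ?thesis using span_finite[OF finB] spanB by simp
  qed
  moreover have "inj_on ?g (B \<rightarrow>\<^sub>E UNIV)"
  proof
    fix u v assume uv: "u \<in> B \<rightarrow>\<^sub>E UNIV" "v \<in> B \<rightarrow>\<^sub>E UNIV" "?g u = ?g v"
    have "(\<Sum>b\<in>B. scale (u b - v b) b) = 0"
      using uv(3) by (simp add: scale_left_diff_distrib sum_subtractf)
    then have "u b = v b" if "b \<in> B" for b
      using independentD[OF B(2) finB order_refl, of "\<lambda>b. u b - v b" b] that by simp
    then show "u = v" using uv by (intro PiE_ext) auto
  qed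
  ultimately have "card V = card (B \<rightarrow>\<^sub>E (UNIV :: 'a set))"
    using card_image[of ?g "B \<rightarrow>\<^sub>E UNIV"] by presburger
  then show ?thesis using B(4) finB by (simp add: card_PiE)
qed

section \<open>Evaluation codes graded by the power of y\<close>

text \<open>
  The coefficient families of the functions \<open>\<Sum>j<n. U\<^sub>j(x) y\<^sup>j\<close> in \<open>L(s D\<^sub>\<infinity>)\<close>, for \<open>w = gcd n d * s\<close>.
  Setting \<open>U\<^sub>j = 0\<close> for \<open>j \<ge> n\<close> makes the family unique.
\<close>

definition polys_below :: "nat \<Rightarrow> nat \<Rightarrow> nat \<Rightarrow> (nat \<Rightarrow> 'a :: zero poly) set" where
  "polys_below n d w = {U. (\<forall>j<n. U j \<in> bounded_polys (xcount n d w j)) \<and> (\<forall>j\<ge>n. U j = 0)}"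

lemma card_polys_below:
  fixes n d w :: nat
  shows "finite (polys_below n d w :: (nat \<Rightarrow> 'a :: {finite, field} poly) set)
    \<and> card (polys_below n d w :: (nat \<Rightarrow> 'a poly) set) = CARD('a) ^ (\<Sum>j<n. xcount n d w j)"
proof -
  let ?B = "\<lambda>j. bounded_polys (xcount n d w j) :: 'a poly set"
  let ?g = "\<lambda>U j. if j < n then U j else (0 :: 'a poly)"
  have eq: "(polys_below n d w :: (nat \<Rightarrow> 'a poly) set) = ?g ` (PiE {..<n} ?B)"
  proof safe
    fix U :: "nat \<Rightarrow> 'a poly" assume U: "U \<in> polys_below n d w"
    then have "U = ?g (restrict U {..<n})" by (auto simp: polys_below_def fun_eq_iff)
    moreover have "restrict U {..<n} \<in> PiE {..<n} ?B" using U by (auto simp: polys_below_def)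
    ultimately show "U \<in> ?g ` (PiE {..<n} ?B)" by blast
  qed (auto simp: polys_below_def PiE_iff)
  have "inj_on ?g (PiE {..<n} ?B)"
  proof
    fix U V assume UV: "U \<in> PiE {..<n} ?B" "V \<in> PiE {..<n} ?B" "?g U = ?g V"
    then have "U j = V j" if "j < n" for j using that fun_cong[OF UV(3), of j] by simp
    then show "U = V" using UV by (intro PiE_ext) auto
  qed
  moreover have "finite (PiE {..<n} ?B)" by (intro finite_PiE) (auto simp: card_bounded_polys)
  ultimately show ?thesis
    unfolding eq by (simp add: card_image card_PiE card_bounded_polys power_sum)
qed

text \<open>
  The coordinate positions are kept abstract, with coordinate functions \<open>px\<close> and \<open>py\<close>, so that the
  estimates for the hull involve polynomials and power sums only; the positions become places
  at the end.
\<close>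

locale graded_code =
  fixes n d :: nat and f :: "'a :: {finite, field} poly"
    and I :: "'i set" and px py :: "'i \<Rightarrow> 'a"
  assumes n_pos: "n > 0" and n_dvd: "n dvd CARD('a) - 1"
    and degree_f: "degree f = d" and f_nz: "poly f a \<noteq> 0"
    and bij_points: "bij_betw (\<lambda>P. (px P, py P)) I {(a, b). b ^ n = poly f a}"
begin

definition split_set :: "'a set" where
  "split_set = {a. \<exists>b. b ^ n = poly f a}"

text \<open>
  The exponent of the power of \<open>y\<close> to which \<open>y\<^sup>j\<close> is not orthogonal on a fibre.
\<close>

definition conj_idx :: "nat \<Rightarrow> nat" where
  "conj_idx j = (if j = 0 then 0 else n - j)"

text \<open>
  The product of \<open>y\<^sup>j\<close> and its conjugate power of \<open>y\<close>, as a polynomial in \<open>x\<close>.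
\<close>

definition weight :: "nat \<Rightarrow> 'a poly" where
  "weight j = (if j = 0 then 1 else f)"

definition word :: "(nat \<Rightarrow> 'a poly) \<Rightarrow> 'i \<Rightarrow> 'a" where
  "word U P = (if P \<in> I then \<Sum>j<n. poly (U j) (px P) * py P ^ j else 0)"

definition graded_hull :: "nat \<Rightarrow> ('i \<Rightarrow> 'a) set" where
  "graded_hull w = code_hull I (word ` polys_below n d w)"

lemma of_nat_n: "(of_nat n :: 'a) \<noteq> 0"
  by (rule of_nat_dvd_card_minus_1[OF n_dvd])

lemma poly_weight_nz: "poly (weight j) a \<noteq> 0"
  by (simp add: weight_def f_nz)

lemma degree_weight: "degree (weight j) = (if j = 0 then 0 else d)"
  by (simp add: weight_def degree_f)

lemma conj_idx_less: "j < n \<Longrightarrow> conj_idx j < n"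
  by (auto simp: conj_idx_def)

lemma conj_idx_conj_idx: "j < n \<Longrightarrow> conj_idx (conj_idx j) = j"
  by (auto simp: conj_idx_def)

lemma sum_conj_idx: "(\<Sum>j<n. g (conj_idx j)) = (\<Sum>j<n. g j)"
  by (rule sum.reindex_bij_witness[of _ conj_idx conj_idx])
    (auto simp: conj_idx_less conj_idx_conj_idx)

text \<open>
  Sum over the fibres of \<open>x\<close>, each of which is the set of \<open>n\<close>-th roots of \<open>f(a)\<close>.
\<close>

lemma sum_over_points:
  fixes F :: "'a \<Rightarrow> 'a"
  shows "(\<Sum>P\<in>I. F (px P) * py P ^ k)
    = (if n dvd k then of_nat n * (\<Sum>a\<in>split_set. F a * poly f a ^ (k div n)) else 0)"
proof -
  have "(\<Sum>P\<in>I. F (px P) * py P ^ k) = (\<Sum>(a, b)\<in>{(a, b). b ^ n = poly f a}. F a * b ^ k)"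
    using sum.reindex_bij_betw[OF bij_points, of "\<lambda>(a, b). F a * b ^ k"] by simp
  also have "{(a, b). b ^ n = poly f a} = Sigma split_set (\<lambda>a. {b. b ^ n = poly f a})"
    by (auto simp: split_set_def)
  also have "(\<Sum>(a, b)\<in>\<dots>. F a * b ^ k) = (\<Sum>a\<in>split_set. \<Sum>b | b ^ n = poly f a. F a * b ^ k)"
    by (subst sum.Sigma) auto
  also have "\<dots> = (\<Sum>a\<in>split_set. F a * (if n dvd k then of_nat n * poly f a ^ (k div n) else 0))"
  proof (intro sum.cong refl)
    fix a assume "a \<in> split_set"
    then obtain b where "b ^ n = poly f a" by (auto simp: split_set_def)
    then show "(\<Sum>b | b ^ n = poly f a. F a * b ^ k)
        = F a * (if n dvd k then of_nat n * poly f a ^ (k div n) else 0)"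
      by (simp add: sum_nth_roots[OF n_dvd n_pos _ f_nz] flip: sum_distrib_left)
  qed
  finally show ?thesis by (simp add: sum_distrib_left mult_ac)
qed

text \<open>
  Only the component \<open>U\<^sub>j\<close> survives the sum over the fibres.
\<close>

lemma word_inner:
  fixes p :: "'a \<Rightarrow> 'a"
  assumes "j < n"
  shows "(\<Sum>P\<in>I. word U P * (p (px P) * py P ^ conj_idx j))
    = of_nat n * (\<Sum>a\<in>split_set. poly (U j) a * poly (weight j) a * p a)"
proof -
  have dvd: "n dvd i + conj_idx j \<longleftrightarrow> i = j" if "i < n" for i
  proof
    assume "n dvd i + conj_idx j"
    then obtain k where k: "i + conj_idx j = n * k" by (elim dvdE)
    have "n * k < n * 2" using that assms conj_idx_less[OF assms] k by linarith
    then have "k = 0 \<or> k = 1" by (cases k) auto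
    then show "i = j" using k that assms by (auto simp: conj_idx_def split: if_splits)
  qed (use assms in \<open>auto simp: conj_idx_def\<close>)
  have "(\<Sum>P\<in>I. word U P * (p (px P) * py P ^ conj_idx j))
      = (\<Sum>P\<in>I. \<Sum>i<n. (poly (U i) (px P) * p (px P)) * py P ^ (i + conj_idx j))"
    by (intro sum.cong refl) (simp add: word_def sum_distrib_left sum_distrib_right power_add mult_ac)
  also have "\<dots> = (\<Sum>i<n. \<Sum>P\<in>I. (poly (U i) (px P) * p (px P)) * py P ^ (i + conj_idx j))"
    by (rule sum.swap)
  also have "\<dots> = (\<Sum>i<n. if i = j
      then of_nat n * (\<Sum>a\<in>split_set. poly (U j) a * p a * poly f a ^ ((j + conj_idx j) div n)) else 0)"
    by (intro sum.cong refl, subst sum_over_points[of "\<lambda>a. poly (U _) a * p a"]) (auto simp: dvd)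
  also have "\<dots> = of_nat n * (\<Sum>a\<in>split_set. poly (U j) a * p a * poly f a ^ ((j + conj_idx j) div n))"
    using assms by simp
  also have "\<dots> = of_nat n * (\<Sum>a\<in>split_set. poly (U j) a * poly (weight j) a * p a)"
    using assms by (auto simp: conj_idx_def weight_def mult_ac)
  finally show ?thesis .
qed

lemma polys_below_mono: "w \<le> w' \<Longrightarrow> polys_below n d w \<subseteq> polys_below n d w'"
  using xcount_mono[OF n_pos] bounded_polys_mono by (fastforce simp: polys_below_def)

lemma single_term_in_polys_below:
  assumes "p \<in> bounded_polys (xcount n d w j)" "j < n"
  shows "(\<lambda>i. if i = j then p else 0) \<in> polys_below n d w"
  using assms by (auto simp: polys_below_def)

lemma word_single_term:
  assumes "P \<in> I" "j < n"
  shows "word (\<lambda>i. if i = j then p else 0) P = poly p (px P) * py P ^ j"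
proof -
  have "word (\<lambda>i. if i = j then p else 0) P
      = (\<Sum>i<n. if i = j then poly p (px P) * py P ^ j else 0)"
    unfolding word_def if_P[OF assms(1)] by (intro sum.cong refl) simp
  then show ?thesis using assms by simp
qed

text \<open>
  Testing a word of the hull against single monomials decouples its components.
\<close>

lemma hull_components:
  assumes "u \<in> graded_hull w"
  obtains U where "U \<in> polys_below n d w" "u = word U"
    "\<And>j i. j < n \<Longrightarrow> i < xcount n d w (conj_idx j) \<Longrightarrow>
      (\<Sum>a\<in>split_set. poly (U j) a * poly (weight j) a * a ^ i) = 0"
proof -
  obtain U where U: "U \<in> polys_below n d w" "u = word U"
    using assms by (auto simp: graded_hull_def code_hull_def)
  have "(\<Sum>a\<in>split_set. poly (U j) a * poly (weight j) a * a ^ i) = 0"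
    if "j < n" "i < xcount n d w (conj_idx j)" for j i
  proof -
    let ?G = "\<lambda>k. if k = conj_idx j then monom (1 :: 'a) i else 0"
    have "?G \<in> polys_below n d w"
      using that by (intro single_term_in_polys_below)
        (auto simp: conj_idx_less bounded_polys_iff degree_monom_eq)
    then have "(\<Sum>P\<in>I. u P * word ?G P) = 0"
      using assms by (auto simp: graded_hull_def code_hull_def dual_code_def)
    also have "(\<Sum>P\<in>I. u P * word ?G P) = (\<Sum>P\<in>I. word U P * (px P ^ i * py P ^ conj_idx j))"
      using that by (intro sum.cong refl)
        (simp add: word_single_term conj_idx_less poly_monom U(2))
    also have "\<dots> = of_nat n * (\<Sum>a\<in>split_set. poly (U j) a * poly (weight j) a * a ^ i)"
      by (rule word_inner[OF that(1), of U "\<lambda>x. x ^ i"])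
    finally show ?thesis using of_nat_n by simp
  qed
  then show ?thesis using that U by blast
qed

subsection \<open>Upper bounds for the hull\<close>

lemma finite_code: "finite (word ` polys_below n d w)"
  using card_polys_below[where 'a = 'a] by simp

lemma card_code_le: "card (word ` polys_below n d w) \<le> CARD('a) ^ (\<Sum>j<n. xcount n d w j)"
  using card_image_le[of "polys_below n d w" word] card_polys_below[where 'a = 'a, of n d w] by simp

lemma hull_subset_code: "graded_hull w \<subseteq> word ` polys_below n d w"
  by (auto simp: graded_hull_def code_hull_def)

lemma finite_hull: "finite (graded_hull w)"
  using finite_subset[OF hull_subset_code finite_code] .

text \<open>
  The \<open>j\<close>-th component of the hull, as functions on the field that vanish off \<open>split_set\<close>; polynomials
  themselves would not do, as different ones may give the same word.
\<close>

definition component :: "nat \<Rightarrow> nat \<Rightarrow> ('a \<Rightarrow> 'a) set" where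
  "component w j = (\<lambda>p a. if a \<in> split_set then poly p a else 0) `
     {p \<in> bounded_polys (xcount n d w j). \<forall>i<xcount n d w (conj_idx j).
        (\<Sum>a\<in>split_set. poly p a * poly (weight j) a * a ^ i) = 0}"

lemma card_hull_le_prod: "card (graded_hull w) \<le> (\<Prod>j<n. card (component w j))"
proof -
  let ?g = "\<lambda>h P. if P \<in> I then \<Sum>j<n. h j (px P) * py P ^ j else (0 :: 'a)"
  have "graded_hull w \<subseteq> ?g ` (PiE {..<n} (component w))"
  proof
    fix u assume "u \<in> graded_hull w"
    then obtain U where U: "U \<in> polys_below n d w" "u = word U"
      "\<And>j i. j < n \<Longrightarrow> i < xcount n d w (conj_idx j) \<Longrightarrow>
        (\<Sum>a\<in>split_set. poly (U j) a * poly (weight j) a * a ^ i) = 0"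
      by (rule hull_components) blast
    let ?h = "\<lambda>j\<in>{..<n}. \<lambda>a. if a \<in> split_set then poly (U j) a else 0"
    have "?h \<in> PiE {..<n} (component w)"
      using U(1,3) by (auto simp: component_def polys_below_def)
    moreover have "u = ?g ?h"
    proof
      fix P
      have "px P \<in> split_set" if "P \<in> I"
        using bij_betwE[OF bij_points] that by (auto simp: split_set_def)
      then show "u P = ?g ?h P" by (auto simp: U(2) word_def intro!: sum.cong)
    qed
    ultimately show "u \<in> ?g ` (PiE {..<n} (component w))" by blast
  qed
  moreover have fin: "finite (PiE {..<n} (component w))" by (intro finite_PiE) auto
  ultimately have "card (graded_hull w) \<le> card (PiE {..<n} (component w))"
    by (meson card_image_le card_mono finite_imageI le_trans)
  then show ?thesis by (simp add: card_PiE)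
qed

lemma card_hull_le:
  assumes "\<And>j. j < n \<Longrightarrow> card (component w j) \<le> CARD('a) ^ e j"
  shows "card (graded_hull w) \<le> CARD('a) ^ (\<Sum>j<n. e j)"
proof -
  have "(\<Prod>j<n. card (component w j)) \<le> (\<Prod>j<n. CARD('a) ^ e j)"
    by (intro prod_mono) (use assms in auto)
  then show ?thesis using card_hull_le_prod[of w] by (simp add: power_sum)
qed

lemma card_component_le_dual:
  "card (component w j) \<le> CARD('a) ^ (card split_set - xcount n d w (conj_idx j))"
proof -
  have "component w j \<subseteq> {g. (\<forall>a. a \<notin> split_set \<longrightarrow> g a = 0) \<and>
      (\<forall>i<xcount n d w (conj_idx j). (\<Sum>a\<in>split_set. g a * poly (weight j) a * a ^ i) = 0)}"
    by (auto simp: component_def)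
  then have "card (component w j) \<le> card {g. (\<forall>a. a \<notin> split_set \<longrightarrow> g a = 0) \<and>
      (\<forall>i<xcount n d w (conj_idx j). (\<Sum>a\<in>split_set. g a * poly (weight j) a * a ^ i) = 0)}"
    by (intro card_mono) auto
  also have "\<dots> \<le> CARD('a) ^ (card split_set - xcount n d w (conj_idx j))"
    by (rule card_orthogonal_words) (rule poly_weight_nz)
  finally show ?thesis .
qed

text \<open>
  The dimension of the dual code, where the index reversal by \<open>conj_idx\<close> disappears in the sum.
\<close>

lemma card_hull_le_dual:
  "card (graded_hull w) \<le> CARD('a) ^ (\<Sum>j<n. card split_set - xcount n d w j)"
  using card_hull_le[of w "\<lambda>j. card split_set - xcount n d w (conj_idx j)", OF card_component_le_dual]
  by (simp add: sum_conj_idx[of "\<lambda>j. card split_set - xcount n d w j"])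

text \<open>
  A bound for the number of coefficients of the quotients \<open>Q\<close> in \<open>U f = E V + T Q\<close> for the component
  \<open>j + 1\<close>.  The index is shifted because \<open>y\<^sup>n\<^sup>-\<^sup>1\<close> times \<open>U y\<^sup>j\<^sup>+\<^sup>1\<close> is \<open>U f y\<^sup>j\<close>.  The case distinction
  stands for a weight that may be negative as an integer and then admits only \<open>Q = 0\<close>.
\<close>

definition overlap :: "nat \<Rightarrow> nat \<Rightarrow> nat" where
  "overlap w j = (if card split_set * n \<le> w + (n - 1) * d
     then xcount n d (w + (n - 1) * d - card split_set * n) j else 0)"

text \<open>
  This is \<open>card_hull_component\<close> for \<open>h = weight j\<close>, with its degree bounds rewritten as monomial
  counts by \<open>xcount_reflect\<close>.
\<close>

lemma card_component_le:
  assumes c: "c dvd n" "c dvd d" "c dvd w" "c > 0"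
    and w: "(n - 1) * d \<le> w" "(CARD('a) - 1) * n \<le> 2 * w + c" "w + c \<le> (card split_set - 1) * n"
    and j: "j < n"
  shows "card (component w j) \<le> CARD('a) ^ (xcount n d ((card split_set - 1) * n - c - w) j
      + (if j = 0 then 0 else overlap w (j - 1)))"
proof -
  let ?q = "CARD('a)" and ?\<sigma> = "card split_set"
  let ?k = "xcount n d w j" and ?k' = "xcount n d w (conj_idx j)"
  let ?e = "if j = 0 then 0 else d"
  have "?\<sigma> \<le> ?q" by (intro card_mono) auto
  then have "(?\<sigma> - 1) * n \<le> (?q - 1) * n" by (intro mult_right_mono diff_le_mono) auto
  then have w': "w + c \<le> (?q - 1) * n" using w(3) by linarith
  \<comment> \<open>The degree \<open>d\<close> of the weight makes up for the difference between the exponents \<open>n - j\<close> and \<open>- j\<close>.\<close>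
  have k': "?k' + ?e = (w + d * j) div n + 1"
  proof (cases "j = 0")
    case True
    then show ?thesis by (simp add: conj_idx_def xcount_def)
  next
    case False
    have "d * (n - j) \<le> d * (n - 1)" using False by (intro mult_left_mono) auto
    then have le: "d * (n - j) \<le> w" using w(1) by (metis mult.commute le_trans)
    have "w + d * j = (w - d * (n - j)) + n * d"
      using le j by (simp add: algebra_simps diff_mult_distrib2)
    then have "(w + d * j) div n = (w - d * (n - j)) div n + d" using n_pos by simp
    then show ?thesis using le False by (simp add: conj_idx_def xcount_def)
  qed
  \<comment> \<open>The degree bound for \<open>U f\<close> is at least the one for \<open>E V\<close>.\<close>
  have "?q - ?k' - ?e = (?q - 1) - (w + d * j) div n" using k' by linarith
  also have "\<dots> = xcount n d ((?q - 1) * n - c - w) j"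
    by (rule xcount_reflect) (use n_pos c w' in auto)
  also have "\<dots> \<le> ?k" by (rule xcount_mono[OF n_pos]) (use w(2) in linarith)
  finally have le: "?q - ?k' \<le> ?k + ?e" by linarith
  \<comment> \<open>The solutions with \<open>Q = 0\<close>.\<close>
  have "?\<sigma> - ?k' - ?e = (?\<sigma> - 1) - (w + d * j) div n" using k' by linarith
  also have "\<dots> = xcount n d ((?\<sigma> - 1) * n - c - w) j"
    by (rule xcount_reflect) (use n_pos c w in auto)
  finally have e1: "?\<sigma> - ?k' - ?e = xcount n d ((?\<sigma> - 1) * n - c - w) j" .
  \<comment> \<open>The coefficients of \<open>Q\<close>.\<close>
  have kw: "n * (?k - 1) + d * j \<le> w" if "?k > 0"
    using that less_xcount_iff[OF n_pos, of "?k - 1" d w j] by simp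
  have e2: "?k + ?e - ?\<sigma> \<le> (if j = 0 then 0 else overlap w (j - 1))"
  proof (cases "j = 0")
    case True
    have "n * ?\<sigma> \<le> w" if "?k > ?\<sigma>" using that True by (simp add: less_xcount_iff[OF n_pos])
    moreover have "(?\<sigma> - 1) * n \<le> n * ?\<sigma>" by simp
    ultimately show ?thesis using True w(3) c(4) by (cases "?k \<le> ?\<sigma>") auto
  next
    case False
    then obtain i where i: "j = Suc i" by (cases j) auto
    show ?thesis
    proof (cases "?k + d \<le> ?\<sigma>")
      case False
      have "(n - 1) * d = d * i + d * (n - Suc i)"
        using j i by (simp add: mult.commute flip: distrib_left)
      then have "d * j \<le> w + d" using w(1) i by simp
      have "?k > 0"
      proof (rule ccontr)
        assume "\<not> ?k > 0"
        then have "w < d * j" using less_xcount_iff[OF n_pos, of 0 d w j] by simp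
        moreover have "d * j \<le> (n - 1) * d"
          using j unfolding mult.commute[of d] by (intro mult_right_mono) auto
        ultimately show False using w(1) by linarith
      qed
      have big: "n * (?k + d - ?\<sigma> - 1) + d * i + ?\<sigma> * n \<le> w + (n - 1) * d"
      proof -
        have "n * (?k + d - ?\<sigma> - 1) + n * ?\<sigma> = n * (?k - 1) + n * d"
          using False \<open>?k > 0\<close> by (simp flip: distrib_left)
        moreover have "n * d = (n - 1) * d + d" using n_pos by (cases n) simp_all
        ultimately show ?thesis using kw[OF \<open>?k > 0\<close>] i by (simp add: mult.commute)
      qed
      then have le: "?\<sigma> * n \<le> w + (n - 1) * d" by linarith
      have "?k + d - ?\<sigma> - 1 < xcount n d (w + (n - 1) * d - ?\<sigma> * n) i"
        unfolding less_xcount_iff[OF n_pos] using big by linarith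
      then show ?thesis using i le by (simp add: overlap_def)
    qed (use i in simp)
  qed
  have "card (component w j) \<le> card {p \<in> bounded_polys ?k. \<forall>i<?k'.
      (\<Sum>a\<in>split_set. poly p a * poly (weight j) a * a ^ i) = 0}"
    unfolding component_def
    by (intro card_image_le finite_subset[OF _ conjunct1[OF card_bounded_polys[of ?k]]]) auto
  also have "\<dots> \<le> ?q ^ ((?k + ?e - ?\<sigma>) + (?\<sigma> - ?k' - ?e))"
    by (rule card_hull_component) (use poly_weight_nz degree_weight le in auto)
  also have "\<dots> \<le> ?q ^ (xcount n d ((?\<sigma> - 1) * n - c - w) j + (if j = 0 then 0 else overlap w (j - 1)))"
    using e1 e2 by (intro power_increasing) auto
  finally show ?thesis .
qed

lemma card_less_power:
  assumes "x \<le> CARD('a) ^ a" "a < b" shows "x < CARD('a) ^ b"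
proof -
  have "CARD('a) ^ a < CARD('a) ^ b"
    using assms(2) card_field_ge_2[where 'a = 'a] by (intro power_strict_increasing) auto
  then show ?thesis using assms(1) by linarith
qed

text \<open>
  For \<open>w \<ge> (\<sigma> - 1) n\<close> the dual code is small enough.  Otherwise the hull consists of a part of weight
  \<open>A = (\<sigma> - 1) n - c - w\<close> and, possibly, an overlap of weight \<open>B = w + (n - 1) d - \<sigma> n\<close>.  If \<open>B \<ge> 0\<close>, the relation
  \<open>A + B = (n - 1) d - n - c\<close> gives strict inequality; if \<open>B < 0\<close>, only \<open>A \<le> w0\<close> remains, and even
  \<open>A + n \<le> w0\<close> when the code misses a fibre.
\<close>

theorem card_hull_large:
  assumes c: "c dvd n" "c dvd d" "c dvd w" "c > 0"
    and w: "(n - 1) * d \<le> w" "(CARD('a) - 1) * n \<le> 2 * w + c"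
    and w0: "(n - 1) * d \<le> w0" "(CARD('a) - 1) * n \<le> w + w0 + c"
    and S: "split_set \<noteq> {}"
  shows "card (graded_hull w) \<le> CARD('a) ^ (\<Sum>j<n. xcount n d w0 j)"
    and "split_set \<noteq> UNIV \<Longrightarrow> card (graded_hull w) < CARD('a) ^ (\<Sum>j<n. xcount n d w0 j)"
proof -
  let ?q = "CARD('a)" and ?\<sigma> = "card split_set"
  let ?H = "\<Sum>j<n. xcount n d w0 j"
  have \<sigma>: "?\<sigma> \<ge> 1" using S by (simp add: Suc_le_eq card_gt_0_iff)
  have \<sigma>q: "?\<sigma> \<le> ?q" by (intro card_mono) auto
  have "card (graded_hull w) \<le> ?q ^ ?H \<and> (split_set \<noteq> UNIV \<longrightarrow> card (graded_hull w) < ?q ^ ?H)"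
  proof (cases "(?\<sigma> - 1) * n \<le> w")
    case True
    have "(\<Sum>j<n. ?\<sigma> - xcount n d w j) < ?H"
      by (rule sum_dual_xcount_lt[OF n_pos True w0(1)])
    then show ?thesis using card_less_power[OF card_hull_le_dual] by (auto simp: less_imp_le)
  next
    case False
    have "c dvd (?\<sigma> - 1) * n - w" using c by (intro dvd_diff_nat) auto
    then have "c \<le> (?\<sigma> - 1) * n - w" using False by (intro dvd_imp_le) auto
    then have w3: "w + c \<le> (?\<sigma> - 1) * n" using False by linarith
    let ?A = "(?\<sigma> - 1) * n - c - w"
    have bound: "card (graded_hull w) \<le> ?q ^ (\<Sum>j<n. xcount n d ?A j + (if j = 0 then 0 else overlap w (j - 1)))"
      by (rule card_hull_le) (rule card_component_le[OF c w w3])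
    have sn: "(?\<sigma> - 1) * n + n = ?\<sigma> * n" using \<sigma> by (cases ?\<sigma>) auto
    show ?thesis
    proof (cases "?\<sigma> * n \<le> w + (n - 1) * d")
      case True
      have "(\<Sum>j<n. xcount n d ?A j + (if j = 0 then 0 else overlap w (j - 1))) < ?H"
        unfolding overlap_def if_P[OF True]
        by (rule xcount_sum_lt[OF n_pos _ w0(1)]) (use True w3 sn w0(1) c(4) in linarith)
      then show ?thesis using card_less_power[OF bound] by (auto simp: less_imp_le)
    next
      case False
      then have eq: "(\<Sum>j<n. xcount n d ?A j + (if j = 0 then 0 else overlap w (j - 1)))
          = (\<Sum>j<n. xcount n d ?A j)"
        by (intro sum.cong) (auto simp: overlap_def)
      have "(?\<sigma> - 1) * n \<le> (?q - 1) * n" using \<sigma>q by (intro mult_right_mono diff_le_mono) auto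
      then have A: "?A \<le> w0" using w0(2) by linarith
      have "(\<Sum>j<n. xcount n d ?A j) \<le> ?H" by (intro sum_mono xcount_mono n_pos A)
      then have "?q ^ (\<Sum>j<n. xcount n d ?A j) \<le> ?q ^ ?H" by (intro power_increasing) auto
      then have 1: "card (graded_hull w) \<le> ?q ^ ?H" using bound eq by simp
      have 2: "card (graded_hull w) < ?q ^ ?H" if "split_set \<noteq> UNIV"
      proof -
        have "?\<sigma> < ?q" using that by (intro psubset_card_mono) auto
        then have "?\<sigma> * n \<le> (?q - 1) * n" by (intro mult_right_mono) auto
        then have A: "?A + n \<le> w0" using w0(2) sn w3 by linarith
        have "(\<Sum>j<n. xcount n d ?A j) < ?H"
        proof (rule sum_strict_mono_strong[of _ 0])
          have "xcount n d ?A 0 < xcount n d (?A + n) 0" using n_pos by (simp add: xcount_add_n)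
          also have "\<dots> \<le> xcount n d w0 0" by (intro xcount_mono n_pos A)
          finally show "xcount n d ?A 0 < xcount n d w0 0" .
        qed (use n_pos xcount_mono[OF n_pos] A in auto)
        then show ?thesis using card_less_power bound eq by simp
      qed
      show ?thesis using 1 2 by blast
    qed
  qed
  then show "card (graded_hull w) \<le> ?q ^ ?H" "split_set \<noteq> UNIV \<Longrightarrow> card (graded_hull w) < ?q ^ ?H" by auto
qed

text \<open>
  The code itself is small enough.  The word of the constant function \<open>1\<close> has inner product
  \<open>n * card split_set\<close> with itself, which keeps it out of the hull when this is nonzero.
\<close>

theorem card_hull_small:
  assumes "w \<le> w0"
  shows "card (graded_hull w) \<le> CARD('a) ^ (\<Sum>j<n. xcount n d w0 j)"
    and "(of_nat (card split_set) :: 'a) \<noteq> 0 \<Longrightarrow> card (graded_hull w) < CARD('a) ^ (\<Sum>j<n. xcount n d w0 j)"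
proof -
  have "CARD('a) ^ (\<Sum>j<n. xcount n d w j) \<le> CARD('a) ^ (\<Sum>j<n. xcount n d w0 j)"
    using xcount_mono[OF n_pos assms] by (intro power_increasing sum_mono) auto
  then have C: "card (word ` polys_below n d w) \<le> CARD('a) ^ (\<Sum>j<n. xcount n d w0 j)"
    using card_code_le[of w] by linarith
  then show "card (graded_hull w) \<le> CARD('a) ^ (\<Sum>j<n. xcount n d w0 j)"
    using card_mono[OF finite_code hull_subset_code] le_trans by blast
  assume nz: "(of_nat (card split_set) :: 'a) \<noteq> 0"
  let ?U = "\<lambda>i. if i = 0 then (1 :: 'a poly) else 0"
  have U: "?U \<in> polys_below n d w"
    by (intro single_term_in_polys_below) (auto simp: n_pos bounded_polys_iff xcount_def)
  have "(\<Sum>P\<in>I. word ?U P * word ?U P) = (\<Sum>P\<in>I. word ?U P * (1 * py P ^ conj_idx 0))"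
    by (intro sum.cong refl) (simp add: word_single_term n_pos conj_idx_def)
  also have "\<dots> = of_nat n * of_nat (card split_set)"
    by (subst word_inner[OF n_pos, of ?U "\<lambda>_. 1"]) (simp add: weight_def)
  finally have "(\<Sum>P\<in>I. word ?U P * word ?U P) \<noteq> 0" using nz of_nat_n by simp
  then have "word ?U \<notin> graded_hull w" using U by (auto simp: graded_hull_def code_hull_def dual_code_def)
  then have "graded_hull w \<subset> word ` polys_below n d w" using U hull_subset_code by blast
  then have "card (graded_hull w) < card (word ` polys_below n d w)" by (rule psubset_card_mono[OF finite_code])
  then show "card (graded_hull w) < CARD('a) ^ (\<Sum>j<n. xcount n d w0 j)" using C by linarith
qed

subsection \<open>The totally split case\<close>

text \<open>
  Inner products with a power of \<open>y\<close> times a function of \<open>x\<close> supported at one element recover the values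
  of each \<open>U\<^sub>j\<close>, and the degrees are small enough for these to determine \<open>U\<^sub>j\<close>.
\<close>

lemma inj_on_word:
  assumes "split_set = UNIV" "w < (CARD('a) - 1) * n"
  shows "inj_on word (polys_below n d w)"
proof
  fix U V assume UV: "U \<in> polys_below n d w" "V \<in> polys_below n d w" "word U = word V"
  have "U j = V j" if j: "j < n" for j
  proof -
    have "xcount n d w j \<le> CARD('a)"
    proof (rule leI, rule notI)
      assume "CARD('a) < xcount n d w j"
      then have "n * CARD('a) \<le> w" by (simp add: less_xcount_iff[OF n_pos])
      moreover have "(CARD('a) - 1) * n \<le> n * CARD('a)" by (simp add: mult.commute)
      ultimately show False using assms(2) by linarith
    qed
    then have bd: "U j - V j \<in> bounded_polys CARD('a)"
      using UV j by (intro bounded_polys_diff) (auto simp: polys_below_def intro: bounded_polys_mono)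
    have "U j - V j = 0"
    proof (rule bounded_poly_eq_0[of _ UNIV])
      fix a :: 'a
      let ?p = "\<lambda>x. if x = a then 1 else (0 :: 'a)"
      have pt: "(\<Sum>P\<in>I. word W P * (?p (px P) * py P ^ conj_idx j))
          = of_nat n * (poly (W j) a * poly (weight j) a)" for W
      proof -
        have "(\<Sum>x\<in>split_set. poly (W j) x * poly (weight j) x * ?p x)
            = (\<Sum>x\<in>split_set. if x = a then poly (W j) x * poly (weight j) x else 0)"
          by (intro sum.cong) auto
        then show ?thesis unfolding word_inner[OF j, of W ?p] by (simp add: assms(1))
      qed
      have "of_nat n * (poly (U j) a * poly (weight j) a) = of_nat n * (poly (V j) a * poly (weight j) a)"
        unfolding pt[symmetric] UV(3) by (rule refl)
      then have "poly (U j) a * poly (weight j) a = poly (V j) a * poly (weight j) a"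
        using of_nat_n by (rule mult_left_cancel[THEN iffD1, rotated])
      then show "poly (U j - V j) a = 0" using poly_weight_nz[of j a] by simp
    qed (use bd in auto)
    then show ?thesis by simp
  qed
  moreover have "U j = V j" if "\<not> j < n" for j using that UV by (simp add: polys_below_def)
  ultimately show "U = V" by blast
qed

text \<open>
  All products that contribute are polynomials in \<open>x\<close> of degree below \<open>q - 1\<close>, whose values sum to zero
  over the field.
\<close>

lemma word_orthogonal:
  assumes "split_set = UNIV" "w + w' < (CARD('a) - 1) * n" "U \<in> polys_below n d w" "V \<in> polys_below n d w'"
  shows "(\<Sum>P\<in>I. word U P * word V P) = 0"
proof -
  have term0: "(\<Sum>P\<in>I. word U P * (poly (V (conj_idx j)) (px P) * py P ^ conj_idx j)) = 0"
    if j: "j < n" for j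
  proof -
    let ?p = "U j * weight j * V (conj_idx j)"
    have "(\<Sum>a\<in>UNIV. poly ?p a) = 0"
    proof (cases "?p = 0")
      case False
      then have nz: "U j \<noteq> 0" "V (conj_idx j) \<noteq> 0" "weight j \<noteq> 0" by auto
      have "degree (U j) < xcount n d w j"
        using assms(3) j nz(1) by (auto simp: polys_below_def bounded_polys_iff)
      then have 1: "n * degree (U j) + d * j \<le> w" by (simp add: less_xcount_iff[OF n_pos])
      have "degree (V (conj_idx j)) < xcount n d w' (conj_idx j)"
        using assms(4) conj_idx_less[OF j] nz(2) by (auto simp: polys_below_def bounded_polys_iff)
      then have 2: "n * degree (V (conj_idx j)) + d * conj_idx j \<le> w'"
        by (simp add: less_xcount_iff[OF n_pos])
      have 3: "d * j + d * conj_idx j = n * degree (weight j)"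
        using j by (auto simp: conj_idx_def degree_weight mult.commute simp flip: distrib_left)
      have "n * degree ?p = n * degree (U j) + n * degree (weight j) + n * degree (V (conj_idx j))"
        using nz by (simp add: degree_mult_eq algebra_simps)
      also have "\<dots> \<le> w + w'" using 1 2 3 by linarith
      also have "\<dots> < n * (CARD('a) - 1)" using assms(2) by (simp add: mult.commute)
      finally have "degree ?p < CARD('a) - 1" by simp
      then show ?thesis
        by (subst sum_poly_field) (auto simp: bounded_polys_iff coeff_eq_0)
    qed (simp only: poly_0 sum.neutral_const)
    then show ?thesis
      by (subst word_inner[OF j, of U "poly (V (conj_idx j))"]) (simp add: assms(1))
  qed
  have "(\<Sum>P\<in>I. word U P * word V P)
      = (\<Sum>P\<in>I. \<Sum>j<n. word U P * (poly (V j) (px P) * py P ^ j))"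
    by (intro sum.cong refl) (simp add: word_def[of V] sum_distrib_left)
  also have "\<dots> = (\<Sum>j<n. \<Sum>P\<in>I. word U P * (poly (V j) (px P) * py P ^ j))"
    by (rule sum.swap)
  also have "\<dots> = (\<Sum>j<n. \<Sum>P\<in>I. word U P * (poly (V (conj_idx j)) (px P) * py P ^ conj_idx j))"
    by (rule sum_conj_idx[symmetric, of "\<lambda>j. \<Sum>P\<in>I. word U P * (poly (V j) (px P) * py P ^ j)"])
  also have "\<dots> = 0" by (intro sum.neutral) (use term0 in auto)
  finally show ?thesis .
qed

theorem card_hull_totally_split:
  assumes "split_set = UNIV" "w0 \<le> w" "w + w0 < (CARD('a) - 1) * n"
  shows "CARD('a) ^ (\<Sum>j<n. xcount n d w0 j) \<le> card (graded_hull w)"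
proof -
  have "word ` polys_below n d w0 \<subseteq> graded_hull w"
  proof safe
    fix U :: "nat \<Rightarrow> 'a poly" assume U: "U \<in> polys_below n d w0"
    then have "U \<in> polys_below n d w" using polys_below_mono[OF assms(2)] by blast
    moreover have "(\<Sum>P\<in>I. word U P * word V P) = 0" if "V \<in> polys_below n d w" for V
      by (rule word_orthogonal[OF assms(1) _ U that]) (use assms(3) in simp)
    ultimately show "word U \<in> graded_hull w"
      by (auto simp: graded_hull_def code_hull_def dual_code_def word_def)
  qed
  then have "card (word ` polys_below n d w0) \<le> card (graded_hull w)" by (intro card_mono finite_hull)
  moreover have "card (word ` polys_below n d w0) = card (polys_below n d w0 :: (nat \<Rightarrow> 'a poly) set)"
    by (intro card_image inj_on_word[OF assms(1)]) (use assms(3) in simp)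
  ultimately show ?thesis using card_polys_below[where 'a = 'a] by simp
qed

end

section \<open>Ring homomorphisms and polynomials\<close>

text \<open>
  Unbundled ring homomorphisms between type-class rings; evaluation of univariate polynomials, and by
  iteration of bivariate ones, is obtained by extending a homomorphism of coefficients.
\<close>

definition is_hom :: "('r :: comm_ring_1 \<Rightarrow> 's :: comm_ring_1) \<Rightarrow> bool" where
  "is_hom h \<longleftrightarrow> h 0 = 0 \<and> h 1 = 1 \<and> (\<forall>a b. h (a + b) = h a + h b \<and> h (a * b) = h a * h b)"

context
  fixes h :: "'r :: comm_ring_1 \<Rightarrow> 's :: comm_ring_1"
  assumes h: "is_hom h"
begin

lemma hom_0: "h 0 = 0" and hom_1: "h 1 = 1"
  and hom_add: "h (a + b) = h a + h b" and hom_mult: "h (a * b) = h a * h b"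
  using h by (auto simp: is_hom_def)

lemma hom_uminus: "h (- a) = - h a"
  using hom_add[of a "- a"] hom_0 by (simp add: eq_neg_iff_add_eq_0 add.commute)

lemma hom_diff: "h (a - b) = h a - h b"
  using hom_add[of a "- b"] hom_uminus by simp

lemma hom_power: "h (a ^ k) = h a ^ k"
  by (induction k) (simp_all add: hom_1 hom_mult)

lemma hom_sum: "h (sum g S) = (\<Sum>i\<in>S. h (g i))"
  by (induction S rule: infinite_finite_induct) (simp_all add: hom_0 hom_add)

lemma map_poly_hom_pCons: "map_poly h (pCons a p) = pCons (h a) (map_poly h p)"
  by (simp add: map_poly_pCons hom_0)

lemma is_hom_map_poly: "is_hom (map_poly h)"
  unfolding is_hom_def
  by (auto simp: poly_eq_iff coeff_map_poly hom_0 hom_1 hom_add hom_mult coeff_mult hom_sum)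

lemma is_hom_poly_map_poly: "is_hom (\<lambda>p. poly (map_poly h p) x)"
  using is_hom_map_poly by (auto simp: is_hom_def)

end

lemma is_hom_to_ac: "is_hom to_ac"
  by (simp add: is_hom_def)

lemma is_hom_ff_const: "is_hom ff_const"
  unfolding is_hom_def ff_const_def
  by (simp del: to_ac_add to_ac_mult to_fract_add to_fract_mult
      add: one_pCons[symmetric] to_ac_add[symmetric] to_ac_mult[symmetric]
        to_fract_add[symmetric] to_fract_mult[symmetric])

definition poly_at :: "('r :: comm_ring_1 \<Rightarrow> 's :: comm_ring_1) \<Rightarrow> 's \<Rightarrow> 'r poly \<Rightarrow> 's" where
  "poly_at h x p = poly (map_poly h p) x"

lemma is_hom_poly_at: "is_hom h \<Longrightarrow> is_hom (poly_at h x)"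
  unfolding poly_at_def by (rule is_hom_poly_map_poly)

lemma poly_at_pCons: "is_hom h \<Longrightarrow> poly_at h x (pCons a p) = h a + x * poly_at h x p"
  by (simp add: poly_at_def map_poly_hom_pCons)

lemma poly_at_0 [simp]: "poly_at h x 0 = 0"
  by (simp add: poly_at_def)

lemma poly_at_const: "is_hom h \<Longrightarrow> poly_at h x [:a:] = h a"
  by (simp add: poly_at_pCons)

lemma poly_at_monom: "is_hom h \<Longrightarrow> poly_at h x (monom c k) = h c * x ^ k"
  by (simp add: poly_at_def map_poly_monom hom_0 poly_monom)

lemma poly_at_x: "is_hom h \<Longrightarrow> poly_at h x [:0, 1:] = x"
  by (simp add: poly_at_pCons poly_at_const hom_0 hom_1)

lemma poly_at_sum:
  assumes "is_hom h" "degree p \<le> k"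
  shows "poly_at h x p = (\<Sum>i\<le>k. h (coeff p i) * x ^ i)"
  unfolding poly_at_def
  by (subst poly_as_sum_of_le[of _ k])
    (use assms map_poly_degree_leq[of h p] in \<open>auto simp: coeff_map_poly hom_0\<close>)

section \<open>Simple roots in the algebraic closure\<close>

abbreviation closure_poly :: "'a :: field poly \<Rightarrow> 'a alg_closure poly" where
  "closure_poly \<equiv> map_poly to_ac"

lemma closure_poly_eq_0_iff: "closure_poly p = 0 \<longleftrightarrow> p = 0"
  by (rule map_poly_eq_0_iff) auto

lemma degree_closure_poly: "degree (closure_poly p) = degree p"
  by (rule degree_map_poly) auto

lemma poly_closure_poly_to_ac: "poly (closure_poly p) (to_ac a) = to_ac (poly p a)"
  by (induction p) (simp_all add: map_poly_pCons)

lemma closure_poly_dvd_iff: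
  fixes p g :: "'a :: field poly"
  assumes "closure_poly g dvd closure_poly p"
  shows "g dvd p"
proof (cases "g = 0")
  case True
  then show ?thesis using assms by (simp add: closure_poly_eq_0_iff)
next
  case False
  let ?r = "p mod g"
  note hom = is_hom_map_poly[OF is_hom_to_ac]
  have "closure_poly p = closure_poly (g * (p div g) + ?r)" by simp
  also have "\<dots> = closure_poly g * closure_poly (p div g) + closure_poly ?r"
    by (simp only: hom_add[OF hom] hom_mult[OF hom])
  finally have "closure_poly g dvd closure_poly ?r"
    using assms by (metis dvd_add_right_iff dvd_triv_left)
  then have "?r \<noteq> 0 \<Longrightarrow> degree g \<le> degree ?r"
    using dvd_imp_degree_le[of "closure_poly g" "closure_poly ?r"]
    by (simp add: closure_poly_eq_0_iff degree_closure_poly)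
  then have "?r = 0" using degree_mod_less[OF False, of p] by linarith
  then show ?thesis by (simp add: mod_eq_0_iff_dvd)
qed

text \<open>
  Over an algebraically closed field divisibility can be checked root by root.
\<close>

lemma dvd_of_order_le:
  fixes p g :: "'b :: alg_closed_field poly"
  assumes "g \<noteq> 0" "p \<noteq> 0" "\<And>a. poly g a = 0 \<Longrightarrow> Polynomial.order a g \<le> Polynomial.order a p"
  shows "g dvd p"
  using assms
proof (induction "degree g" arbitrary: g p rule: less_induct)
  case less
  show ?case
  proof (cases "degree g = 0")
    case True
    then show ?thesis using less.prems(1) by (auto elim!: degree_eq_zeroE simp: const_poly_dvd_iff dvd_field_iff)
  next
    case False
    then obtain a where a: "poly g a = 0" using alg_closed_imp_poly_has_root by blast
    let ?l = "[:- a, 1:]"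
    obtain g' where g': "g = ?l * g'" using a by (metis dvdE poly_eq_0_iff_dvd)
    have "Polynomial.order a g \<noteq> 0" using a less.prems(1) by (simp add: order_root)
    then have "Polynomial.order a p \<noteq> 0" using less.prems(3)[OF a] by linarith
    then have "poly p a = 0" by (simp add: order_root)
    then obtain p' where p': "p = ?l * p'" by (metis dvdE poly_eq_0_iff_dvd)
    have nz: "g' \<noteq> 0" "p' \<noteq> 0" using less.prems g' p' by auto
    have "g' dvd p'"
    proof (rule less.hyps)
      show "degree g' < degree g" using nz degree_mult_eq[of ?l g'] unfolding g' by simp
      fix b assume b: "poly g' b = 0"
      then have "Polynomial.order b g \<le> Polynomial.order b p" by (intro less.prems(3)) (simp add: g')
      then show "Polynomial.order b g' \<le> Polynomial.order b p'"
        using order_mult[OF less.prems(1)[unfolded g'], of b] order_mult[OF less.prems(2)[unfolded p'], of b]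
        unfolding g' p' by linarith
    qed (use nz in auto)
    then show ?thesis by (simp only: g' p' dvd_mult_cancel_left) simp
  qed
qed

text \<open>
  The polynomials that vanish at a common root would all be multiples of one of least degree, a nonconstant
  common divisor.
\<close>

lemma coprime_no_common_root:
  fixes p g :: "'a :: field poly"
  assumes "coprime p g" "p \<noteq> 0"
  shows "poly (closure_poly p) x \<noteq> 0 \<or> poly (closure_poly g) x \<noteq> 0"
proof (rule ccontr)
  assume "\<not> ?thesis"
  then have roots: "poly_at to_ac x p = 0" "poly_at to_ac x g = 0" by (auto simp: poly_at_def)
  define P where "P = (\<lambda>m. m \<noteq> 0 \<and> poly_at to_ac x m = 0)"
  note hom = is_hom_poly_at[OF is_hom_to_ac]
  have "P p" using assms roots by (simp add: P_def)
  then obtain m where m: "P m" "\<And>m'. P m' \<Longrightarrow> degree m \<le> degree m'"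
    using ex_has_least_nat[of P p degree] by blast
  have dvd: "m dvd r" if "poly_at to_ac x r = 0" for r
  proof -
    have "poly_at to_ac x (m * (r div m) + r mod m) = 0" using that by simp
    then have "poly_at to_ac x (r mod m) = 0"
      using m(1) unfolding hom_add[OF hom] hom_mult[OF hom] by (simp add: P_def)
    then have "\<not> degree (r mod m) < degree m \<Longrightarrow> r mod m = 0 \<or> False"
      using degree_mod_less[of m r] m(1) by (auto simp: P_def)
    then have "r mod m = 0" using \<open>poly_at to_ac x (r mod m) = 0\<close> m(2)[of "r mod m"]
      by (force simp: P_def)
    then show ?thesis by (simp add: mod_eq_0_iff_dvd)
  qed
  have "is_unit m" using assms(1) dvd[OF roots(1)] dvd[OF roots(2)] by (rule coprime_common_divisor)
  then obtain c where "m = [:c:]" "c \<noteq> 0" by (auto simp: is_unit_poly_iff dvd_field_iff)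
  then show False using m(1) by (simp add: P_def poly_at_const is_hom_to_ac)
qed

text \<open>
  A double root would be a common root of \<open>f\<close> and its derivative.
\<close>

lemma order_separable_le_1:
  fixes f :: "'a :: field poly"
  assumes "coprime f (pderiv f)" "f \<noteq> 0"
  shows "Polynomial.order x (closure_poly f) \<le> 1"
proof (rule ccontr)
  assume "\<not> ?thesis"
  then have "[:- x, 1:] ^ 2 dvd closure_poly f" by (subst order_divides) auto
  then obtain g where g: "closure_poly f = [:- x, 1:] ^ 2 * g" by (elim dvdE)
  have "closure_poly (pderiv f) = pderiv (closure_poly f)"
    by (rule poly_eqI) (simp add: coeff_map_poly coeff_pderiv del: of_nat_Suc)
  also have "\<dots> = pderiv ([:- x, 1:] * ([:- x, 1:] * g))" by (simp only: g power2_eq_square mult.assoc)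
  also have "poly \<dots> x = 0" by (simp only: pderiv_mult poly_add poly_mult) simp
  finally have "poly (closure_poly (pderiv f)) x = 0" .
  moreover have "poly (closure_poly f) x = 0" by (simp add: g)
  ultimately show False using coprime_no_common_root[OF assms, of x] by blast
qed

section \<open>Kummer extensions of the rational function field\<close>

locale superelliptic =
  fixes n :: nat and f :: "'a :: {finite, field} poly"
  assumes n_gt_1: "n > 1" and n_dvd: "n dvd CARD('a) - 1"
    and degree_f_pos: "degree f > 0" and separable: "coprime f (pderiv f)"
    and no_root: "poly f a \<noteq> 0"
begin

lemma n_pos: "n > 0" using n_gt_1 by simp

lemma f_nz: "f \<noteq> 0" using degree_f_pos by auto

lemma of_nat_n: "(of_nat n :: 'a) \<noteq> 0"
  by (rule of_nat_dvd_card_minus_1[OF n_dvd])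

definition kummer_poly :: "'a poly poly" where
  "kummer_poly = monom 1 n - [:f:]"

lemma kummer_poly_props: "degree kummer_poly = n" "lead_coeff kummer_poly = 1" "kummer_poly \<noteq> 0"
proof -
  have "degree kummer_poly = degree (monom (1 :: 'a poly) n)"
    unfolding kummer_poly_def diff_conv_add_uminus
    by (rule degree_add_eq_left) (use n_pos in \<open>simp add: degree_monom_eq\<close>)
  then show "degree kummer_poly = n" by (simp add: degree_monom_eq)
  then show "lead_coeff kummer_poly = 1"
    unfolding kummer_poly_def by (cases n) (use n_pos in simp_all)
  then show "kummer_poly \<noteq> 0" by auto
qed

end

text \<open>
  A model is a field containing elements \<open>x\<close> and \<open>y\<close> with \<open>y\<^sup>n = f(x)\<close> and \<open>x\<close> transcendental over the
  constants.  Both the function field and its embeddings into Laurent series are of this kind, and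
  statements about one can be transported to the other as the kernels of evaluation agree
  (\<open>ev2_eq_0_iff\<close>).
\<close>

locale kummer = superelliptic n f for n and f :: "'a :: {finite, field} poly" +
  fixes \<kappa> :: "'a \<Rightarrow> 'l :: field" and x y :: 'l
  assumes hom_\<kappa>: "is_hom \<kappa>"
    and transcendental: "p \<noteq> 0 \<Longrightarrow> poly_at \<kappa> x p \<noteq> 0"
    and y_power: "y ^ n = poly_at \<kappa> x f"
begin

abbreviation ev1 :: "'a poly \<Rightarrow> 'l" where "ev1 \<equiv> poly_at \<kappa> x"

definition ev2 :: "'a poly poly \<Rightarrow> 'l" where "ev2 = poly_at ev1 y"

lemma hom_ev1: "is_hom ev1" by (rule is_hom_poly_at[OF hom_\<kappa>])

lemma hom_ev2: "is_hom ev2" unfolding ev2_def by (rule is_hom_poly_at[OF hom_ev1])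

lemma ev1_eq_0_iff: "ev1 p = 0 \<longleftrightarrow> p = 0"
  using transcendental hom_0[OF hom_ev1] by auto

lemma ev1_eq_iff: "ev1 p = ev1 g \<longleftrightarrow> p = g"
  using ev1_eq_0_iff[of "p - g"] by (simp add: hom_diff[OF hom_ev1])

lemma \<kappa>_eq_iff: "\<kappa> a = \<kappa> b \<longleftrightarrow> a = b"
  using ev1_eq_iff[of "[:a:]" "[:b:]"] by (simp add: poly_at_const[OF hom_\<kappa>])

lemma y_nz: "y \<noteq> 0"
proof
  assume "y = 0"
  then have "ev1 f = 0" using y_power n_pos by (simp add: zero_power)
  then show False by (simp add: ev1_eq_0_iff f_nz)
qed

lemma ev2_const: "ev2 [:p:] = ev1 p"
  by (simp add: ev2_def poly_at_const[OF hom_ev1])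

lemma ev2_sum:
  assumes "degree u < k"
  shows "ev2 u = (\<Sum>j<k. ev1 (coeff u j) * y ^ j)"
proof -
  obtain l where "k = Suc l" using assms by (cases k) auto
  then show ?thesis using assms unfolding ev2_def
    by (subst poly_at_sum[OF hom_ev1, of u l]) (auto simp: lessThan_Suc_atMost)
qed

lemma kummer_poly_at: "poly_at ev1 t kummer_poly = t ^ n - ev1 f"
proof -
  have "poly_at ev1 t (monom 1 n) = t ^ n"
    by (simp add: poly_at_monom[OF hom_ev1] hom_1[OF hom_ev1])
  then show ?thesis
    unfolding kummer_poly_def hom_diff[OF is_hom_poly_at[OF hom_ev1]] poly_at_const[OF hom_ev1] by simp
qed

lemma ev2_kummer_poly: "ev2 kummer_poly = 0"
  by (simp add: ev2_def kummer_poly_at y_power)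

text \<open>
  Irreducibility of \<open>Y\<^sup>n - f\<close> over the rational functions, without factoring: a relation \<open>m\<close> of
  least degree \<open>k\<close> divides \<open>Y\<^sup>n - f\<close> up to a factor in \<open>x\<close>.  The roots of the latter are the \<open>z y\<close> with \<open>z\<^sup>n = 1\<close>, so
  \<open>m\<close> is, up to its leading coefficient, a product of \<open>k\<close> linear factors with such roots.  Comparing \<open>n\<close>-th powers of the constant terms,
  \<open>m\<^sub>0\<^sup>n\<close> equals \<open>f\<^sup>k\<close> up to sign and an \<open>n\<close>-th power.  At a root of \<open>f\<close>, which is simple, the orders show that
  \<open>n\<close> divides \<open>k\<close>.
\<close>

lemma lin_indep:
  assumes "ev2 u = 0" "degree u < n"
  shows "u = 0"
proof (rule ccontr)
  assume "u \<noteq> 0"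
  define P where "P = (\<lambda>m. m \<noteq> 0 \<and> ev2 m = 0)"
  have "P u" using \<open>u \<noteq> 0\<close> assms by (simp add: P_def)
  then obtain m where m: "P m" "\<And>m'. P m' \<Longrightarrow> degree m \<le> degree m'"
    using ex_has_least_nat[of P u degree] by blast
  define k where "k = degree m"
  have kn: "k < n" using m(2)[OF \<open>P u\<close>] assms(2) by (simp add: k_def)
  have mnz: "m \<noteq> 0" using m(1) by (simp add: P_def)
  have "k > 0"
  proof (rule ccontr)
    assume "\<not> k > 0"
    then obtain p where "m = [:p:]" by (metis degree_eq_zeroE k_def neq0_conv)
    then show False using m(1) by (auto simp: P_def ev2_const ev1_eq_0_iff)
  qed
  obtain g r where gr: "pseudo_divmod kummer_poly m = (g, r)" by (cases "pseudo_divmod kummer_poly m")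
  define D where "D = lead_coeff m ^ (Suc (degree kummer_poly) - degree m)"
  have D: "smult D kummer_poly = m * g + r" "r = 0 \<or> degree r < degree m"
    using pseudo_divmod[OF mnz gr] by (auto simp: D_def)
  have Dnz: "D \<noteq> 0" using mnz by (simp add: D_def)
  have "ev2 (smult D kummer_poly) = 0"
    using hom_mult[OF hom_ev2, of "[:D:]" kummer_poly] by (simp add: ev2_kummer_poly)
  then have "ev2 r = 0"
    using m(1) by (simp add: D(1) hom_add[OF hom_ev2] hom_mult[OF hom_ev2] P_def)
  then have "r = 0" using D(2) m(2)[of r] by (force simp: P_def)
  then have Dmg: "[:D:] * kummer_poly = m * g" using D(1) by simp
  then have gnz: "g \<noteq> 0" using Dnz kummer_poly_props(3) by auto
  have "degree ([:D:] * kummer_poly) = n" using Dnz kummer_poly_props by (simp add: degree_mult_eq)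
  then have dg: "k + degree g = n" using mnz gnz unfolding Dmg by (simp add: degree_mult_eq k_def)
  let ?m = "map_poly ev1 m" and ?g = "map_poly ev1 g"
  have deg: "degree ?m = k" "degree ?g = degree g"
    by (simp_all add: degree_map_poly ev1_eq_0_iff k_def)
  have nz: "?m \<noteq> 0" "?g \<noteq> 0" using mnz gnz by (simp_all add: map_poly_eq_0_iff hom_0[OF hom_ev1] ev1_eq_0_iff)
  \<comment> \<open>The roots of \<open>Y\<^sup>n - f\<close> in the model.\<close>
  let ?R = "(\<lambda>z. \<kappa> z * y) ` {z. z ^ n = 1}"
  have cardR: "card ?R = n"
  proof -
    have "inj_on (\<lambda>z. \<kappa> z * y) {z. z ^ n = 1}" using y_nz by (auto simp: inj_on_def \<kappa>_eq_iff)
    then show ?thesis using card_roots_of_unity[OF n_dvd n_pos] by (simp add: card_image)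
  qed
  have pow: "t ^ n = ev1 f" if t: "t \<in> ?R" for t
  proof -
    obtain z where z: "z ^ n = 1" "t = \<kappa> z * y" using t by auto
    have "\<kappa> z ^ n = 1" using z(1) hom_power[OF hom_\<kappa>, of z n] hom_1[OF hom_\<kappa>] by simp
    then show ?thesis by (simp add: z(2) power_mult_distrib y_power)
  qed
  have root: "poly ?m t = 0 \<or> poly ?g t = 0" if t: "t \<in> ?R" for t
  proof -
    note hom = is_hom_poly_at[OF hom_ev1, of t]
    have "poly_at ev1 t (m * g) = poly_at ev1 t [:D:] * poly_at ev1 t kummer_poly"
      unfolding Dmg[symmetric] hom_mult[OF hom] ..
    also have "\<dots> = 0" using pow[OF t] by (simp add: kummer_poly_at)
    finally show ?thesis by (simp add: hom_mult[OF hom]) (simp add: poly_at_def)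
  qed
  \<comment> \<open>The cofactor \<open>g\<close> has at most \<open>n - k\<close> roots, so at least \<open>k\<close> of these roots belong to \<open>m\<close>.\<close>
  define Z where "Z = {t \<in> ?R. poly ?m t = 0}"
  have finZ: "finite Z" by (simp add: Z_def)
  have "card {t. poly ?g t = 0} \<le> degree g" using card_poly_roots_bound[OF nz(2)] deg by simp
  moreover have "?R \<subseteq> Z \<union> {t. poly ?g t = 0}" using root by (auto simp: Z_def)
  then have "n \<le> card (Z \<union> {t. poly ?g t = 0})"
    using card_mono[of "Z \<union> {t. poly ?g t = 0}" ?R] cardR finZ poly_roots_finite[OF nz(2)] by simp
  then have "n \<le> card Z + card {t. poly ?g t = 0}" using card_Un_le le_trans by blast
  ultimately have "k \<le> card Z" using dg by linarith
  moreover have "card Z \<le> k"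
  proof -
    have "card Z \<le> card {t. poly ?m t = 0}"
      by (intro card_mono poly_roots_finite nz) (auto simp: Z_def)
    then show ?thesis using card_poly_roots_bound[OF nz(1)] deg by simp
  qed
  ultimately have cardZ: "card Z = k" by simp
  have "root_poly Z dvd ?m" by (rule root_poly_dvd[OF finZ]) (simp add: Z_def)
  then obtain e where e: "?m = root_poly Z * e" by (elim dvdE)
  then have "e \<noteq> 0" using nz by auto
  then have "degree ?m = card Z + degree e"
    by (simp add: e degree_mult_eq root_poly_nz finZ degree_root_poly)
  then have "degree e = 0" using deg cardZ by simp
  then obtain c where c: "e = [:c:]" by (elim degree_eq_zeroE)
  have "lead_coeff ?m = lead_coeff (root_poly Z) * c"
    by (simp only: e lead_coeff_mult c) simp
  also have "lead_coeff (root_poly Z) = 1"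
    by (simp add: root_poly_def lead_coeff_prod)
  finally have c': "c = ev1 (lead_coeff m)" by (simp add: deg coeff_map_poly hom_0[OF hom_ev1] k_def)
  have "ev1 (coeff m 0) = poly ?m 0"
    by (simp add: poly_0_coeff_0 coeff_map_poly hom_0[OF hom_ev1])
  also have "\<dots> = c * (\<Prod>t\<in>Z. - t)" by (simp add: e c root_poly_def poly_prod)
  finally have "ev1 (coeff m 0) ^ n = c ^ n * (\<Prod>t\<in>Z. (- 1) ^ n * t ^ n)"
    by (simp add: power_mult_distrib prod_power_distrib flip: power_minus)
  also have "(\<Prod>t\<in>Z. (- 1) ^ n * t ^ n) = (\<Prod>t\<in>Z. (- 1) ^ n * ev1 f)"
    by (intro prod.cong refl) (simp add: pow Z_def)
  also have "\<dots> = ((- 1) ^ n * ev1 f) ^ k" by (simp add: cardZ)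
  finally have "ev1 (coeff m 0 ^ n) = ev1 (lead_coeff m ^ n * ((- 1) ^ n * f) ^ k)"
    by (simp add: c' hom_mult[OF hom_ev1] hom_power[OF hom_ev1] hom_uminus[OF hom_ev1] hom_1[OF hom_ev1])
  then have "coeff m 0 ^ n = lead_coeff m ^ n * ((- 1) ^ n * f) ^ k" by (simp add: ev1_eq_iff)
  then have eq: "closure_poly (coeff m 0) ^ n
      = closure_poly (lead_coeff m) ^ n * ((- 1) ^ n * closure_poly f) ^ k"
  proof -
    note hom = is_hom_map_poly[OF is_hom_to_ac]
    show ?thesis
      using arg_cong[OF \<open>coeff m 0 ^ n = lead_coeff m ^ n * ((- 1) ^ n * f) ^ k\<close>, of closure_poly]
      by (simp only: hom_mult[OF hom] hom_power[OF hom] hom_uminus[OF hom] hom_1[OF hom])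
  qed
  have "degree (closure_poly f) > 0" using degree_f_pos by (simp add: degree_closure_poly)
  then obtain \<alpha> where \<alpha>: "poly (closure_poly f) \<alpha> = 0" using alg_closed_imp_poly_has_root by blast
  have fcnz: "closure_poly f \<noteq> 0" using f_nz by (simp add: closure_poly_eq_0_iff)
  have "Polynomial.order \<alpha> (closure_poly f) \<noteq> 0" using \<alpha> fcnz by (simp add: order_root)
  then have ord_f: "Polynomial.order \<alpha> (closure_poly f) = 1"
    using order_separable_le_1[OF separable f_nz, of \<alpha>] by linarith
  have ord_pow: "Polynomial.order \<alpha> (p ^ i) = i * Polynomial.order \<alpha> p" if "p \<noteq> 0" for p :: "'a alg_closure poly" and i
    using that by (induction i) (simp_all add: order_mult)
  have rhs: "closure_poly (lead_coeff m) ^ n * ((- 1) ^ n * closure_poly f) ^ k \<noteq> 0"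
    using mnz fcnz by (simp add: closure_poly_eq_0_iff)
  have "coeff m 0 \<noteq> 0" using eq rhs n_pos by (auto simp: power_0_left)
  have "Polynomial.order \<alpha> ((- 1) ^ n * closure_poly f) = Polynomial.order \<alpha> (closure_poly f)"
    by (cases "even n") simp_all
  then have "n * Polynomial.order \<alpha> (closure_poly (coeff m 0))
      = n * Polynomial.order \<alpha> (closure_poly (lead_coeff m)) + k"
    using arg_cong[OF eq, of "Polynomial.order \<alpha>"] rhs \<open>coeff m 0 \<noteq> 0\<close> mnz fcnz ord_f
    by (simp add: order_mult ord_pow closure_poly_eq_0_iff)
  then have "n dvd k" by (metis dvd_add_right_iff dvd_triv_left)
  then show False using kn \<open>k > 0\<close> dvd_imp_le by fastforce
qed

end

context superelliptic begin

lemma kummer_reduce: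
  obtains g r where "u = kummer_poly * g + r" "r = 0 \<or> degree r < n"
proof -
  obtain g r where gr: "pseudo_divmod u kummer_poly = (g, r)" by (cases "pseudo_divmod u kummer_poly")
  show ?thesis
    using pseudo_divmod[OF kummer_poly_props(3) gr] kummer_poly_props that[of g r] by simp
qed

end

context kummer begin

text \<open>
  The polynomial \<open>Y\<^sup>n - f\<close> is monic, so division by it needs no denominators.
\<close>

lemma reduce:
  obtains r where "ev2 u = ev2 r" "degree r < n"
proof -
  obtain g r where gr: "u = kummer_poly * g + r" "r = 0 \<or> degree r < n" by (rule kummer_reduce)
  have "ev2 u = ev2 r"
    by (simp add: gr(1) hom_add[OF hom_ev2] hom_mult[OF hom_ev2] ev2_kummer_poly)
  then show ?thesis using that gr(2) n_pos by (metis degree_0)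
qed

text \<open>
  The right-hand side does not mention the model.
\<close>

lemma ev2_eq_0_iff: "ev2 u = 0 \<longleftrightarrow> kummer_poly dvd u"
proof
  assume u: "ev2 u = 0"
  obtain g r where gr: "u = kummer_poly * g + r" "r = 0 \<or> degree r < n" by (rule kummer_reduce)
  have "ev2 r = 0"
    using u by (simp add: gr(1) hom_add[OF hom_ev2] hom_mult[OF hom_ev2] ev2_kummer_poly)
  then have "r = 0" using gr(2) lin_indep by blast
  then show "kummer_poly dvd u" using gr by simp
next
  assume "kummer_poly dvd u"
  then show "ev2 u = 0" by (auto elim!: dvdE simp: hom_mult[OF hom_ev2] ev2_kummer_poly)
qed

end

section \<open>Roots of power series\<close>

text \<open>
  The series \<open>(\<beta> + X)\<^sup>n - \<beta>\<^sup>n\<close> has no constant term and a nonzero linear term, hence a compositional inverse;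
  composing this inverse with \<open>A - \<beta>\<^sup>n\<close> gives the root.  The argument is valid in every characteristic
  prime to \<open>n\<close>.
\<close>

lemma fps_nth_root_exists:
  fixes A :: "'b :: field fps"
  assumes "(of_nat n :: 'b) \<noteq> 0" "\<beta> \<noteq> 0" "A $ 0 = \<beta> ^ n"
  obtains B where "B ^ n = A" "B $ 0 = \<beta>"
proof -
  have n: "n > 0" using assms(1) by (cases n) auto
  define P where "P = (fps_const \<beta> + fps_X) ^ n - fps_const (\<beta> ^ n)"
  have P0: "P $ 0 = 0" by (simp add: P_def fps_power_zeroth)
  have "P $ 1 = fps_deriv P $ 0" by simp
  also have "\<dots> = of_nat n * \<beta> ^ (n - 1)"
    by (simp add: P_def fps_deriv_power fps_power_zeroth)
  finally have P1: "P $ 1 \<noteq> 0" using assms by simp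
  define C where "C = A - fps_const (\<beta> ^ n)"
  have C0: "C $ 0 = 0" using assms(3) by (simp add: C_def)
  define G where "G = fps_inv P oo C"
  have i0: "fps_inv P $ 0 = 0" by (simp add: fps_inv_def)
  then have G0: "G $ 0 = 0" by (simp add: G_def)
  have "P oo G = (P oo fps_inv P) oo C"
    unfolding G_def by (rule fps_compose_assoc[OF C0 i0])
  also have "\<dots> = C" using fps_inv_right[OF P0 P1] C0 by (simp add: fps_X_fps_compose_startby0)
  finally have "P oo G = C" .
  moreover have "P oo G = (fps_const \<beta> + G) ^ n - fps_const (\<beta> ^ n)"
    by (simp add: P_def fps_compose_sub_distrib fps_compose_power[OF G0, symmetric]
        fps_compose_add_distrib fps_X_fps_compose_startby0[OF G0])
  ultimately have "(fps_const \<beta> + G) ^ n = A" by (simp add: C_def)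
  then show ?thesis using that[of "fps_const \<beta> + G"] G0 by simp
qed

section \<open>Laurent series models of the function field\<close>

lemma is_hom_fls_const: "is_hom (fls_const :: 'b :: comm_ring_1 \<Rightarrow> 'b fls)"
  by (simp add: is_hom_def fls_plus_const)

lemma is_hom_comp: "is_hom g \<Longrightarrow> is_hom h \<Longrightarrow> is_hom (\<lambda>a. g (h a))"
  unfolding is_hom_def by metis

definition fls_of_const :: "'a :: field \<Rightarrow> 'a alg_closure fls" where
  "fls_of_const a = fls_const (to_ac a)"

lemma is_hom_fls_of_const: "is_hom fls_of_const"
  unfolding fls_of_const_def[abs_def] by (rule is_hom_comp[OF is_hom_fls_const is_hom_to_ac])

lemma poly_at_closure_poly:
  "poly_at fls_of_const X0 p = poly_at fls_const X0 (closure_poly p)"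
proof (induction p)
  case (pCons a p)
  show ?case
    unfolding poly_at_pCons[OF is_hom_fls_of_const] pCons
    by (simp add: map_poly_pCons poly_at_pCons is_hom_fls_const fls_of_const_def)
qed simp

lemma fls_subdegree_unit_mult:
  fixes G :: "'b :: field fps"
  assumes "G $ 0 \<noteq> 0"
  shows "fps_to_fls G \<noteq> 0" "fls_subdegree (fps_to_fls G) = 0"
proof -
  have "subdegree G = 0" using assms by simp
  then show "fls_subdegree (fps_to_fls G) = 0" by (simp add: fls_subdegree_fls_to_fps)
  show "fps_to_fls G \<noteq> 0" using assms by auto
qed

text \<open>
  Expansion at a point: the substitution \<open>x = \<alpha> + t\<^sup>n\<close> multiplies orders by \<open>n\<close>, so that the leading power of
  \<open>t\<close> is an \<open>n\<close>-th power.
\<close>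

lemma poly_at_near_point:
  fixes p :: "'b :: field poly"
  assumes "n > 0" "p \<noteq> 0"
  obtains G where "poly_at fls_const (fls_const \<alpha> + fls_X ^ n) p
      = (fls_X ^ Polynomial.order \<alpha> p) ^ n * fps_to_fls G" "G $ 0 \<noteq> 0"
    "poly p \<alpha> \<noteq> 0 \<Longrightarrow> G $ 0 = poly p \<alpha>"
proof -
  let ?x = "fls_const \<alpha> + fls_X ^ n" and ?k = "Polynomial.order \<alpha> p"
  note hom = is_hom_poly_at[OF is_hom_fls_const, of ?x]
  have series: "\<exists>G. poly_at fls_const ?x g = fps_to_fls G \<and> G $ 0 = poly g \<alpha>" for g :: "'b poly"
  proof (induction g)
    case 0
    then show ?case by (intro exI[of _ 0]) simp
  next
    case (pCons a g)
    then obtain G where "poly_at fls_const ?x g = fps_to_fls G" "G $ 0 = poly g \<alpha>" by blast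
    then show ?case
      by (intro exI[of _ "fps_const a + (fps_const \<alpha> + fps_X ^ n) * G"])
        (use assms(1) in \<open>simp add: poly_at_pCons is_hom_fls_const fls_times_fps_to_fls fps_to_fls_power zero_power\<close>)
  qed
  obtain g where g: "p = [:- \<alpha>, 1:] ^ ?k * g" "\<not> [:- \<alpha>, 1:] dvd g"
    using order_decomp[OF assms(2)] by blast
  obtain G where G: "poly_at fls_const ?x g = fps_to_fls G" "G $ 0 = poly g \<alpha>" using series by blast
  have "poly_at fls_const ?x [:- \<alpha>, 1:] = fls_X ^ n"
    by (simp add: poly_at_pCons is_hom_fls_const)
  then have "poly_at fls_const ?x p = (fls_X ^ n) ^ ?k * fps_to_fls G"
    by (subst g(1)) (simp only: hom_mult[OF hom] hom_power[OF hom] G)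
  then have 1: "poly_at fls_const ?x p = (fls_X ^ ?k) ^ n * fps_to_fls G"
    by (simp only: power_mult[symmetric] mult.commute)
  have 2: "G $ 0 \<noteq> 0" using g(2) G(2) by (simp add: poly_eq_0_iff_dvd)
  have 3: "G $ 0 = poly p \<alpha>" if "poly p \<alpha> \<noteq> 0"
  proof -
    have "?k = 0" using that by (rule order_0I)
    then show ?thesis using g(1) G(2) by simp
  qed
  show ?thesis using that 1 2 3 by blast
qed

text \<open>
  The analogue for \<open>x = t\<^sup>-\<^sup>n\<close>.
\<close>

lemma poly_at_near_infinity:
  fixes p :: "'b :: field poly"
  assumes "n > 0" "p \<noteq> 0"
  shows "\<exists>G. poly_at fls_const (fls_X_inv ^ n) p = (fls_X_inv ^ degree p) ^ n * fps_to_fls G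
    \<and> G $ 0 = lead_coeff p"
  using assms(2)
proof (induction p)
  case 0
  then show ?case by simp
next
  case (pCons a p)
  show ?case
  proof (cases "p = 0")
    case True
    then show ?thesis by (intro exI[of _ "fps_const a"]) (simp add: poly_at_const is_hom_fls_const)
  next
    case False
    then obtain G where G: "poly_at fls_const (fls_X_inv ^ n) p = (fls_X_inv ^ degree p) ^ n * fps_to_fls G"
        "G $ 0 = lead_coeff p" using pCons by blast
    let ?k = "Suc (degree p)"
    have "fls_X_inv * fls_X = (1 :: 'b fls)" by (simp flip: fls_inverse_X)
    then have one: "(fls_X_inv ^ ?k) ^ n * (fls_X ^ ?k) ^ n = (1 :: 'b fls)"
      by (simp only: power_mult_distrib[symmetric] power_one)
    have "poly_at fls_const (fls_X_inv ^ n) (pCons a p)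
        = fls_const a + fls_X_inv ^ n * ((fls_X_inv ^ degree p) ^ n * fps_to_fls G)"
      by (simp add: poly_at_pCons is_hom_fls_const G)
    also have "\<dots> = fls_const a * ((fls_X_inv ^ ?k) ^ n * (fls_X ^ ?k) ^ n) + (fls_X_inv ^ ?k) ^ n * fps_to_fls G"
      unfolding one by (simp add: power_mult_distrib mult_ac)
    also have "\<dots> = (fls_X_inv ^ ?k) ^ n * fps_to_fls (fps_const a * (fps_X ^ ?k) ^ n + G)"
      by (simp add: fls_times_fps_to_fls fps_to_fls_power algebra_simps)
    finally show ?thesis
      using False G(2) assms(1)
      by (intro exI[of _ "fps_const a * (fps_X ^ ?k) ^ n + G"]) (simp add: fps_power_zeroth zero_power)
  qed
qed

locale laurent_model = kummer n f \<kappa> x y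
  for n and f :: "'a :: {finite, field} poly" and \<kappa> :: "'a \<Rightarrow> 'b :: field fls" and x y +
  assumes subdegree_const: "a \<noteq> 0 \<Longrightarrow> fls_subdegree (\<kappa> a) = 0"

context kummer begin

text \<open>
  The Galois group of the function field over the rational functions acts by \<open>y \<mapsto> z y\<close>.
\<close>

lemma kummer_twist:
  assumes "z ^ n = 1"
  shows "kummer n f \<kappa> x (\<kappa> z * y)"
proof unfold_locales
  have "\<kappa> z ^ n = 1" using assms hom_power[OF hom_\<kappa>, of z n] hom_1[OF hom_\<kappa>] by simp
  then show "(\<kappa> z * y) ^ n = ev1 f" by (simp add: power_mult_distrib y_power)
qed (use hom_\<kappa> transcendental in auto)

end

context superelliptic begin

lemma of_nat_n_closure: "(of_nat n :: 'a alg_closure) \<noteq> 0"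
  using of_nat_n by (metis to_ac_eq_0_iff to_ac_of_nat)

lemma laurent_modelI:
  assumes "\<And>p. p \<noteq> 0 \<Longrightarrow> poly_at fls_of_const t p \<noteq> 0" "y ^ n = poly_at fls_of_const t f"
  shows "laurent_model n f fls_of_const t y"
  by unfold_locales (use assms is_hom_fls_of_const in \<open>auto simp: fls_of_const_def\<close>)

lemma finite_model_nz:
  assumes "p \<noteq> 0"
  shows "poly_at fls_of_const (fls_const \<alpha> + fls_X ^ n) p \<noteq> 0"
    and "fls_subdegree (poly_at fls_of_const (fls_const \<alpha> + fls_X ^ n) p)
      = int n * int (Polynomial.order \<alpha> (closure_poly p))"
proof -
  have "closure_poly p \<noteq> 0" using assms by (simp add: closure_poly_eq_0_iff)
  then obtain G where G: "poly_at fls_const (fls_const \<alpha> + fls_X ^ n) (closure_poly p)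
      = (fls_X ^ Polynomial.order \<alpha> (closure_poly p)) ^ n * fps_to_fls G" "G $ 0 \<noteq> 0"
    using poly_at_near_point[OF n_pos] by metis
  note unit = fls_subdegree_unit_mult[OF G(2)]
  show "poly_at fls_of_const (fls_const \<alpha> + fls_X ^ n) p \<noteq> 0"
    using unit(1) by (simp add: poly_at_closure_poly G(1))
  show "fls_subdegree (poly_at fls_of_const (fls_const \<alpha> + fls_X ^ n) p)
      = int n * int (Polynomial.order \<alpha> (closure_poly p))"
    using unit by (simp add: poly_at_closure_poly G(1) fls_subdegree_pow)
qed

lemma infinite_model_nz:
  assumes "p \<noteq> 0"
  shows "poly_at fls_of_const (fls_X_inv ^ n) p \<noteq> 0"
    and "fls_subdegree (poly_at fls_of_const (fls_X_inv ^ n) p) = - int n * int (degree p)"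
proof -
  have nz: "closure_poly p \<noteq> 0" using assms by (simp add: closure_poly_eq_0_iff)
  then obtain G where G: "poly_at fls_const (fls_X_inv ^ n) (closure_poly p)
      = (fls_X_inv ^ degree p) ^ n * fps_to_fls G" "G $ 0 \<noteq> 0"
    using poly_at_near_infinity[OF n_pos nz] nz leading_coeff_0_iff[of "closure_poly p"]
    by (auto simp: degree_closure_poly)
  note unit = fls_subdegree_unit_mult[OF G(2)]
  show "poly_at fls_of_const (fls_X_inv ^ n) p \<noteq> 0"
    using unit(1) by (simp add: poly_at_closure_poly G(1))
  show "fls_subdegree (poly_at fls_of_const (fls_X_inv ^ n) p) = - int n * int (degree p)"
    using unit by (simp add: poly_at_closure_poly G(1) fls_subdegree_pow)
qed

lemma finite_model_exists:
  obtains y where "laurent_model n f fls_of_const (fls_const \<alpha> + fls_X ^ n) y"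
proof -
  have nz: "closure_poly f \<noteq> 0" using f_nz by (simp add: closure_poly_eq_0_iff)
  obtain G where G: "poly_at fls_const (fls_const \<alpha> + fls_X ^ n) (closure_poly f)
      = (fls_X ^ Polynomial.order \<alpha> (closure_poly f)) ^ n * fps_to_fls G" "G $ 0 \<noteq> 0"
    using poly_at_near_point[OF n_pos nz] by metis
  obtain \<beta> where \<beta>: "\<beta> ^ n = G $ 0" using nth_root_exists[OF n_pos] by blast
  then have "\<beta> \<noteq> 0" using G(2) n_pos by (auto simp: zero_power)
  then obtain B where B: "B ^ n = G" "B $ 0 = \<beta>"
    using fps_nth_root_exists[OF of_nat_n_closure _ \<beta>[symmetric]] by blast
  have "laurent_model n f fls_of_const (fls_const \<alpha> + fls_X ^ n)
      (fls_X ^ Polynomial.order \<alpha> (closure_poly f) * fps_to_fls B)"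
    by (rule laurent_modelI)
      (use finite_model_nz B in \<open>auto simp: poly_at_closure_poly G(1) power_mult_distrib fps_to_fls_power[symmetric]\<close>)
  then show ?thesis using that by blast
qed

text \<open>
  At a rational point of the curve the root can be chosen with the prescribed constant term.
\<close>

lemma rational_model_exists:
  assumes "b ^ n = poly f a"
  obtains B where "laurent_model n f fls_of_const (fls_const (to_ac a) + fls_X ^ n) (fps_to_fls B)"
    "B $ 0 = to_ac b"
proof -
  let ?\<alpha> = "to_ac a"
  have nz: "closure_poly f \<noteq> 0" using f_nz by (simp add: closure_poly_eq_0_iff)
  have val: "poly (closure_poly f) ?\<alpha> = to_ac b ^ n"
    by (simp add: poly_closure_poly_to_ac flip: assms)
  have "b \<noteq> 0" using assms no_root[of a] n_pos by (auto simp: zero_power)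
  then have "poly (closure_poly f) ?\<alpha> \<noteq> 0" by (simp add: val)
  then obtain G where G: "poly_at fls_const (fls_const ?\<alpha> + fls_X ^ n) (closure_poly f) = fps_to_fls G"
      "G $ 0 = to_ac b ^ n"
    using poly_at_near_point[OF n_pos nz, of ?\<alpha>] val by (metis mult_1 order_0I power_0 power_one)
  obtain B where B: "B ^ n = G" "B $ 0 = to_ac b"
    using fps_nth_root_exists[OF of_nat_n_closure _ G(2)] \<open>b \<noteq> 0\<close> by auto
  have "laurent_model n f fls_of_const (fls_const ?\<alpha> + fls_X ^ n) (fps_to_fls B)"
    by (rule laurent_modelI)
      (use finite_model_nz B in \<open>auto simp: poly_at_closure_poly G(1) fps_to_fls_power[symmetric]\<close>)
  then show ?thesis using that B by blast
qed

lemma infinite_model_exists: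
  obtains y where "laurent_model n f fls_of_const (fls_X_inv ^ n) y"
proof -
  have nz: "closure_poly f \<noteq> 0" using f_nz by (simp add: closure_poly_eq_0_iff)
  obtain G where G: "poly_at fls_const (fls_X_inv ^ n) (closure_poly f)
      = (fls_X_inv ^ degree (closure_poly f)) ^ n * fps_to_fls G" "G $ 0 \<noteq> 0"
    using poly_at_near_infinity[OF n_pos nz] nz by (metis leading_coeff_0_iff)
  obtain \<beta> where \<beta>: "\<beta> ^ n = G $ 0" using nth_root_exists[OF n_pos] by blast
  then have "\<beta> \<noteq> 0" using G(2) n_pos by (auto simp: zero_power)
  then obtain B where B: "B ^ n = G" "B $ 0 = \<beta>"
    using fps_nth_root_exists[OF of_nat_n_closure _ \<beta>[symmetric]] by blast
  have "laurent_model n f fls_of_const (fls_X_inv ^ n)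
      (fls_X_inv ^ degree (closure_poly f) * fps_to_fls B)"
    by (rule laurent_modelI)
      (use infinite_model_nz B in \<open>auto simp: poly_at_closure_poly G(1) power_mult_distrib fps_to_fls_power[symmetric]\<close>)
  then show ?thesis using that by blast
qed

section \<open>The function field\<close>

lemma poly_at_ff: "poly_at ff_const ff_x p = to_ac (to_fract p)"
proof (induction p)
  case 0
  then show ?case by simp
next
  case (pCons a p)
  have "to_fract (pCons a p) = to_fract ([:a:] + [:0, 1:] * p)" by simp
  also have "\<dots> = to_fract [:a:] + to_fract [:0, 1:] * to_fract p" by (simp only: to_fract_add to_fract_mult)
  finally show ?case
    unfolding poly_at_pCons[OF is_hom_ff_const] pCons by (simp add: ff_const_def ff_x_def)
qed

lemma ff_y_power: "ff_y n f ^ n = to_ac (to_fract f)"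
  unfolding ff_y_def by (rule someI_ex) (rule nth_root_exists[OF n_pos])

sublocale F: kummer n f ff_const ff_x "ff_y n f"
  by unfold_locales (auto simp: is_hom_ff_const poly_at_ff ff_y_power)

abbreviation K :: "'a ffield set" where "K \<equiv> function_field n f"

text \<open>
  A common denominator that depends on \<open>x\<close> only suffices.
\<close>

lemma in_K_iff: "h \<in> K \<longleftrightarrow> (\<exists>u D. D \<noteq> 0 \<and> h * F.ev1 D = F.ev2 u)"
proof
  assume "h \<in> K"
  then obtain w where "h = poly (map_poly to_ac w) (ff_y n f)" by (auto simp: function_field_def)
  then show "\<exists>u D. D \<noteq> 0 \<and> h * F.ev1 D = F.ev2 u"
  proof (induction w arbitrary: h)
    case 0
    then show ?case by (intro exI[of _ 0] exI[of _ 1]) (simp add: hom_0[OF F.hom_ev2])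
  next
    case (pCons r w)
    let ?h = "poly (map_poly to_ac w) (ff_y n f)"
    obtain u D where uD: "D \<noteq> 0" "?h * F.ev1 D = F.ev2 u" using pCons.IH[OF refl] by blast
    obtain p g where pg: "r = Fract p g" "g \<noteq> 0" by (cases r)
    then have r: "to_ac r * F.ev1 g = F.ev1 p"
      by (simp add: Fract_conv_to_fract poly_at_ff)
    have h: "h = to_ac r + ff_y n f * ?h" using pCons.prems by (simp add: map_poly_pCons)
    have "F.ev2 ([:p * D:] + [:g:] * pCons 0 u)
        = F.ev1 p * F.ev1 D + F.ev1 g * (ff_y n f * F.ev2 u)"
      by (simp add: hom_add[OF F.hom_ev2] hom_mult[OF F.hom_ev2] F.ev2_const hom_mult[OF F.hom_ev1]
          del: mult_pCons_left mult_pCons_right)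
        (simp add: F.ev2_def poly_at_pCons[OF F.hom_ev1] hom_0[OF F.hom_ev1])
    also have "\<dots> = h * F.ev1 (g * D)"
      by (simp add: h hom_mult[OF F.hom_ev1] algebra_simps flip: r uD(2))
    finally show ?case using uD(1) pg(2) by (metis mult_eq_0_iff)
  qed
next
  assume "\<exists>u D. D \<noteq> 0 \<and> h * F.ev1 D = F.ev2 u"
  then obtain u D where uD: "D \<noteq> 0" "h * F.ev1 D = F.ev2 u" by blast
  let ?w = "smult (1 / to_fract D) (map_poly to_fract u)"
  have "poly (map_poly to_ac (map_poly to_fract u)) (ff_y n f) = F.ev2 u"
    unfolding F.ev2_def poly_at_def[of F.ev1]
    by (subst map_poly_map_poly) (auto simp: o_def poly_at_ff fun_eq_iff intro!: arg_cong2[where f = poly] map_poly_cong)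
  then have "poly (map_poly to_ac ?w) (ff_y n f) = h"
    using uD by (simp add: map_poly_smult poly_at_ff field_simps)
  then show "h \<in> K" unfolding function_field_def by blast
qed

end

context superelliptic begin

lemma K_ev2: "F.ev2 u \<in> K"
  unfolding in_K_iff by (intro exI[of _ u] exI[of _ 1]) (simp add: hom_1[OF F.hom_ev1])

lemma K_ev1: "F.ev1 p \<in> K"
  using K_ev2[of "[:p:]"] by (simp add: F.ev2_const)

lemma K_const: "ff_const a \<in> K"
  using K_ev1[of "[:a:]"] by (simp add: poly_at_const[OF is_hom_ff_const])

lemma K_0: "0 \<in> K" and K_1: "1 \<in> K"
  using K_ev1[of 0] K_ev1[of 1] by (simp_all add: hom_1[OF F.hom_ev1])

lemma K_x: "ff_x \<in> K"
  using K_ev1[of "[:0, 1:]"] by (simp add: poly_at_x[OF is_hom_ff_const])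

lemma K_y: "ff_y n f \<in> K"
  using K_ev2[of "[:0, 1:]"] by (simp add: F.ev2_def poly_at_x[OF F.hom_ev1])

lemma K_mult:
  assumes "g \<in> K" "h \<in> K" shows "g * h \<in> K"
proof -
  obtain u D where 1: "D \<noteq> 0" "g * F.ev1 D = F.ev2 u" using assms(1) in_K_iff by blast
  obtain u' D' where 2: "D' \<noteq> 0" "h * F.ev1 D' = F.ev2 u'" using assms(2) in_K_iff by blast
  have "g * h * F.ev1 (D * D') = F.ev2 (u * u')"
    by (simp add: hom_mult[OF F.hom_ev1] hom_mult[OF F.hom_ev2] flip: 1(2) 2(2))
  then show ?thesis unfolding in_K_iff using 1(1) 2(1) by (metis mult_eq_0_iff)
qed

lemma K_add:
  assumes "g \<in> K" "h \<in> K" shows "g + h \<in> K"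
proof -
  obtain u D where 1: "D \<noteq> 0" "g * F.ev1 D = F.ev2 u" using assms(1) in_K_iff by blast
  obtain u' D' where 2: "D' \<noteq> 0" "h * F.ev1 D' = F.ev2 u'" using assms(2) in_K_iff by blast
  have "(g + h) * F.ev1 (D * D') = F.ev2 (u * [:D':] + u' * [:D:])"
    by (simp add: hom_mult[OF F.hom_ev1] hom_add[OF F.hom_ev2] hom_mult[OF F.hom_ev2]
        F.ev2_const distrib_right del: mult_pCons_left mult_pCons_right flip: 1(2) 2(2))
  then show ?thesis unfolding in_K_iff using 1(1) 2(1) by (metis mult_eq_0_iff)
qed

lemma K_power: "g \<in> K \<Longrightarrow> g ^ k \<in> K"
  by (induction k) (auto simp: K_1 K_mult)

lemma K_uminus: "g \<in> K \<Longrightarrow> - g \<in> K"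
  using K_mult[OF K_const[of "- 1"]] by (simp add: hom_uminus[OF is_hom_ff_const] hom_1[OF is_hom_ff_const])

lemma K_diff: "g \<in> K \<Longrightarrow> h \<in> K \<Longrightarrow> g - h \<in> K"
  using K_add[of g "- h"] K_uminus by simp

text \<open>
  Only polynomials in \<open>x\<close> are inverted; this is enough to make the value group of a valuation closed
  under negation (\<open>int_subgroup_cyclic\<close>).
\<close>

lemma K_inverse_ev1: "inverse (F.ev1 p) \<in> K"
proof (cases "p = 0")
  case True
  then show ?thesis by (simp add: K_0)
next
  case False
  then have "inverse (F.ev1 p) * F.ev1 p = F.ev2 1"
    using F.ev1_eq_0_iff[of p] by (simp add: hom_1[OF F.hom_ev2])
  then show ?thesis using False in_K_iff by blast
qed

lemmas K_intros = K_ev2 K_ev1 K_const K_0 K_1 K_x K_y K_mult K_add K_power K_uminus K_diff K_inverse_ev1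

end

section \<open>Places from Laurent series models\<close>

text \<open>
  A subsemigroup of the integers that contains a positive and a negative element is a group: the
  negative of \<open>a\<close> is a nonnegative combination of \<open>a\<close> and an element of opposite sign.
\<close>

lemma int_subgroup_cyclic:
  fixes G :: "int set"
  assumes add: "\<And>a b. a \<in> G \<Longrightarrow> b \<in> G \<Longrightarrow> a + b \<in> G" and N: "N \<in> G" "- N \<in> G" "N \<noteq> 0"
  obtains e where "e > 0" "G = range (\<lambda>k. e * k)"
proof -
  have zero: "0 \<in> G" using add[OF N(1,2)] by simp
  have nat_mult: "int k * a \<in> G" if "a \<in> G" for k a
    by (induction k) (use zero add that in \<open>auto simp: distrib_right\<close>)
  obtain m where m: "m > 0" "int m \<in> G" "- int m \<in> G"
  proof (cases "N > 0")
    case True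
    then show ?thesis using that[of "nat N"] N by simp
  next
    case False
    then show ?thesis using that[of "nat (- N)"] N by simp
  qed
  \<comment> \<open>\<open>- a = a (- m) + (m - 1) a\<close> for \<open>a \<ge> 0\<close>, and similarly with \<open>m\<close> for \<open>a < 0\<close>.\<close>
  have neg: "- a \<in> G" if a: "a \<in> G" for a
  proof (cases "a \<ge> 0")
    case True
    have "int (nat a) * (- int m) + int (m - 1) * a \<in> G" by (intro add nat_mult a m)
    moreover have "int (nat a) * (- int m) + int (m - 1) * a = - a"
      using True m(1) by (simp add: of_nat_diff algebra_simps)
    ultimately show ?thesis by simp
  next
    case False
    have "int (nat (- a)) * int m + int (m - 1) * a \<in> G" by (intro add nat_mult a m)
    moreover have "int (nat (- a)) * int m + int (m - 1) * a = - a"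
      using False m(1) by (simp add: of_nat_diff algebra_simps)
    ultimately show ?thesis by simp
  qed
  have mult: "k * a \<in> G" if "a \<in> G" for k a
    using nat_mult[OF that, of "nat k"] neg[OF nat_mult[OF that, of "nat (- k)"]] by (cases "k \<ge> 0") auto
  define e where "e = (LEAST i. i > 0 \<and> int i \<in> G)"
  have e: "e > 0" "int e \<in> G"
    using LeastI[of "\<lambda>i. i > 0 \<and> int i \<in> G" m] m by (auto simp: e_def)
  have "G \<subseteq> range (\<lambda>k. int e * k)"
  proof
    fix a assume a: "a \<in> G"
    have "a mod int e = a + (- (a div int e)) * int e"
      by (simp add: minus_div_mult_eq_mod[symmetric])
    then have "a mod int e \<in> G" using add[OF a mult[OF e(2)]] by metis
    moreover have "a mod int e \<ge> 0" "a mod int e < int e" using e(1) by simp_all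
    ultimately have "a mod int e = 0"
      using not_less_Least[of "nat (a mod int e)" "\<lambda>i. i > 0 \<and> int i \<in> G"] by (force simp: e_def)
    then have "a = int e * (a div int e)" by auto
    then show "a \<in> range (\<lambda>k. int e * k)" by blast
  qed
  moreover have "range (\<lambda>k. int e * k) \<subseteq> G" using mult[OF e(2)] by (auto simp: mult.commute)
  ultimately show ?thesis using that[of "int e"] e(1) by auto
qed

context laurent_model begin

text \<open>
  The order in \<open>t\<close>, transported along the embedding that sends a fraction of polynomials in \<open>x\<close> and \<open>y\<close> to
  the corresponding fraction of Laurent series.
\<close>

definition ff_val :: "'a ffield \<Rightarrow> int" where
  "ff_val h = (if h \<in> K - {0} then
     (let (u, D) = (SOME (u, D). D \<noteq> 0 \<and> h * F.ev1 D = F.ev2 u)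
      in fls_subdegree (ev2 u) - fls_subdegree (ev1 D)) else 0)"

lemma ev2_eq_0_iff_ff: "ev2 u = 0 \<longleftrightarrow> F.ev2 u = 0"
  by (simp add: ev2_eq_0_iff F.ev2_eq_0_iff)

lemma ev2_eq_iff_ff: "ev2 u = ev2 u' \<longleftrightarrow> F.ev2 u = F.ev2 u'"
  using ev2_eq_0_iff_ff[of "u - u'"] by (simp add: hom_diff[OF hom_ev2] hom_diff[OF F.hom_ev2])

text \<open>
  The choice of the fraction is immaterial because relations between polynomials hold in both models.
\<close>

lemma ff_val_eq:
  assumes "D \<noteq> 0" "h * F.ev1 D = F.ev2 u" "h \<noteq> 0"
  shows "ff_val h = fls_subdegree (ev2 u) - fls_subdegree (ev1 D)"
proof -
  let ?P = "\<lambda>(u, D). D \<noteq> 0 \<and> h * F.ev1 D = F.ev2 u"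
  obtain u' D' where sel: "(SOME p. ?P p) = (u', D')" by fastforce
  have "?P (SOME p. ?P p)" by (rule someI[of ?P "(u, D)"]) (use assms in simp)
  then have 1: "D' \<noteq> 0" "h * F.ev1 D' = F.ev2 u'" using sel by auto
  have hK: "h \<in> K" using assms in_K_iff by blast
  have nz: "F.ev2 u \<noteq> 0" "F.ev2 u' \<noteq> 0"
    using assms 1 F.ev1_eq_0_iff by (metis mult_eq_0_iff)+
  have "F.ev2 (u * [:D':]) = F.ev2 (u' * [:D:])"
    unfolding hom_mult[OF F.hom_ev2] F.ev2_const assms(2)[symmetric] 1(2)[symmetric] by (simp add: mult_ac)
  then have "ev2 (u * [:D':]) = ev2 (u' * [:D:])" by (simp only: ev2_eq_iff_ff)
  then have "ev2 u * ev1 D' = ev2 u' * ev1 D" by (simp only: hom_mult[OF hom_ev2] ev2_const)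
  then have "fls_subdegree (ev2 u * ev1 D') = fls_subdegree (ev2 u' * ev1 D)" by simp
  then have "fls_subdegree (ev2 u) + fls_subdegree (ev1 D') = fls_subdegree (ev2 u') + fls_subdegree (ev1 D)"
    using nz assms(1) 1(1) by (simp add: ev2_eq_0_iff_ff ev1_eq_0_iff)
  then show ?thesis using sel hK assms(3) by (simp add: ff_val_def)
qed

lemma ff_val_ev1: "p \<noteq> 0 \<Longrightarrow> ff_val (F.ev1 p) = fls_subdegree (ev1 p)"
  using ff_val_eq[of 1 "F.ev1 p" "[:p:]"]
  by (simp add: hom_1[OF F.hom_ev1] hom_1[OF hom_ev1] F.ev2_const ev2_const F.ev1_eq_0_iff)

lemma ff_val_mult:
  assumes "g \<in> K" "h \<in> K" "g \<noteq> 0" "h \<noteq> 0"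
  shows "ff_val (g * h) = ff_val g + ff_val h"
proof -
  obtain u D where 1: "D \<noteq> 0" "g * F.ev1 D = F.ev2 u" using assms(1) in_K_iff by blast
  obtain u' D' where 2: "D' \<noteq> 0" "h * F.ev1 D' = F.ev2 u'" using assms(2) in_K_iff by blast
  have nz: "F.ev2 u \<noteq> 0" "F.ev2 u' \<noteq> 0" using assms 1 2 F.ev1_eq_0_iff by (metis mult_eq_0_iff)+
  have "g * h * F.ev1 (D * D') = F.ev2 (u * u')"
    by (simp add: hom_mult[OF F.hom_ev1] hom_mult[OF F.hom_ev2] flip: 1(2) 2(2))
  then have "ff_val (g * h) = fls_subdegree (ev2 (u * u')) - fls_subdegree (ev1 (D * D'))"
    by (intro ff_val_eq) (use 1 2 assms in auto)
  also have "\<dots> = ff_val g + ff_val h"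
    using nz 1(1) 2(1) ff_val_eq[OF 1 assms(3)] ff_val_eq[OF 2 assms(4)]
    by (simp add: hom_mult[OF hom_ev1] hom_mult[OF hom_ev2] ev2_eq_0_iff_ff ev1_eq_0_iff)
  finally show ?thesis .
qed

lemma ff_val_add:
  assumes "g \<in> K" "h \<in> K" "g \<noteq> 0" "h \<noteq> 0" "g + h \<noteq> 0"
  shows "ff_val (g + h) \<ge> min (ff_val g) (ff_val h)"
proof -
  obtain u D where 1: "D \<noteq> 0" "g * F.ev1 D = F.ev2 u" using assms(1) in_K_iff by blast
  obtain u' D' where 2: "D' \<noteq> 0" "h * F.ev1 D' = F.ev2 u'" using assms(2) in_K_iff by blast
  have nz: "F.ev2 u \<noteq> 0" "F.ev2 u' \<noteq> 0" using assms 1 2 F.ev1_eq_0_iff by (metis mult_eq_0_iff)+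
  have DD: "D * D' \<noteq> 0" using 1 2 by simp
  let ?w = "u * [:D':] + u' * [:D:]"
  have eq: "(g + h) * F.ev1 (D * D') = F.ev2 ?w"
    by (simp add: hom_mult[OF F.hom_ev1] hom_add[OF F.hom_ev2] hom_mult[OF F.hom_ev2]
        F.ev2_const distrib_right del: mult_pCons_left mult_pCons_right flip: 1(2) 2(2))
  then have val: "ff_val (g + h) = fls_subdegree (ev2 ?w) - fls_subdegree (ev1 (D * D'))"
    using ff_val_eq[OF DD eq assms(5)] by simp
  have w: "ev2 ?w = ev2 u * ev1 D' + ev2 u' * ev1 D"
    by (simp only: hom_add[OF hom_ev2] hom_mult[OF hom_ev2] ev2_const)
  have "F.ev2 ?w \<noteq> 0" using eq assms(5) F.ev1_eq_0_iff[of "D * D'"] DD by (metis mult_eq_0_iff)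
  then have "ev2 ?w \<noteq> 0" by (simp only: ev2_eq_0_iff_ff not_False_eq_True)
  then have "fls_subdegree (ev2 ?w) \<ge> min (fls_subdegree (ev2 u * ev1 D')) (fls_subdegree (ev2 u' * ev1 D))"
    unfolding w by (rule fls_plus_subdegree)
  then show ?thesis
    using nz 1(1) 2(1) ff_val_eq[OF 1 assms(3)] ff_val_eq[OF 2 assms(4)] val
    by (simp add: hom_mult[OF hom_ev1] ev2_eq_0_iff_ff ev1_eq_0_iff min_def split: if_splits)
qed

lemma ff_val_const: "a \<noteq> 0 \<Longrightarrow> ff_val (ff_const a) = 0"
  using ff_val_ev1[of "[:a:]"] subdegree_const[of a]
  by (simp add: poly_at_const[OF is_hom_ff_const] poly_at_const[OF hom_\<kappa>])

text \<open>
  The order in \<open>t\<close> becomes a normalised valuation after division by the generator \<open>e\<close> of its value group.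
  The hypothesis ensures that this group is not trivial.
\<close>

lemma place_exists:
  assumes "p \<noteq> 0" "fls_subdegree (ev1 p) \<noteq> 0"
  obtains e v where "e > 0" "v \<in> places n f" "\<And>h. h \<in> K \<Longrightarrow> h \<noteq> 0 \<Longrightarrow> ff_val h = e * v h"
proof -
  let ?G = "ff_val ` (K - {0})"
  have add: "a + b \<in> ?G" if ab: "a \<in> ?G" "b \<in> ?G" for a b
  proof -
    obtain g h where gh: "g \<in> K - {0}" "h \<in> K - {0}" "a = ff_val g" "b = ff_val h"
      using ab by blast
    then have "a + b = ff_val (g * h)" by (simp add: ff_val_mult)
    then show ?thesis using gh by (intro image_eqI[of _ _ "g * h"]) (auto intro: K_mult)
  qed
  let ?N = "ff_val (F.ev1 p)" and ?i = "inverse (F.ev1 p)"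
  have pnz: "F.ev1 p \<noteq> 0" using assms(1) by (simp add: F.ev1_eq_0_iff)
  have "ff_val (F.ev1 p * ?i) = ?N + ff_val ?i"
    using pnz by (intro ff_val_mult K_ev1 K_inverse_ev1) auto
  moreover have "F.ev1 p * ?i = ff_const 1" using pnz by (simp add: hom_1[OF is_hom_ff_const])
  ultimately have "- ?N = ff_val ?i" by (simp add: ff_val_const)
  then have "- ?N \<in> ?G" using pnz K_inverse_ev1[of p] by auto
  moreover have "?N \<in> ?G" using pnz K_ev1[of p] by auto
  moreover have "?N \<noteq> 0" using assms by (simp add: ff_val_ev1)
  ultimately obtain e where e: "e > 0" "?G = range (\<lambda>k. e * k)"
    using int_subgroup_cyclic[OF add, of ?N] by metis
  define v where "v h = ff_val h div e" for h
  have v: "ff_val h = e * v h" if "h \<in> K" "h \<noteq> 0" for h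
  proof -
    have "ff_val h \<in> ?G" using that by blast
    then obtain k where "ff_val h = e * k" using e(2) by auto
    then show ?thesis using e(1) by (simp add: v_def)
  qed
  have v_mult: "v (g * h) = v g + v h" if "g \<in> K - {0}" "h \<in> K - {0}" for g h
    using that ff_val_mult[of g h] v[of g] v[of h] v[of "g * h"] K_mult[of g h] e(1)
    by (simp flip: distrib_left)
  have v_add: "v (g + h) \<ge> min (v g) (v h)" if "g \<in> K - {0}" "h \<in> K - {0}" "g + h \<noteq> 0" for g h
  proof -
    have "min (e * v g) (e * v h) \<le> e * v (g + h)"
      using that ff_val_add[of g h] v[of g] v[of h] v[of "g + h"] K_add[of g h] by simp
    also have "min (e * v g) (e * v h) = e * min (v g) (v h)"
      using e(1) by (simp add: min_mult_distrib_left)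
    finally show ?thesis using e(1) by simp
  qed
  have v_const: "v (ff_const a) = 0" if "a \<noteq> 0" for a
    using ff_val_const[OF that] by (simp add: v_def)
  have v_surj: "v ` (K - {0}) = UNIV"
  proof (intro equalityI subset_UNIV subsetI)
    fix k :: int
    have "e * k \<in> ?G" unfolding e(2) by blast
    then obtain h where h: "h \<in> K - {0}" "ff_val h = e * k" by (metis imageE)
    then have "v h = k" using e(1) by (simp add: v_def)
    then show "k \<in> v ` (K - {0})" using h(1) by blast
  qed
  have v_out: "v h = 0" if "h \<notin> K - {0}" for h
    unfolding v_def ff_val_def if_not_P[OF that] by simp
  have "v \<in> places n f"
    unfolding places_def Let_def using v_mult v_add v_const v_surj v_out by blast
  then show ?thesis using that e(1) v by blast
qed

end

section \<open>Valuation theory of places\<close>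

locale place = superelliptic n f for n and f :: "'a :: {finite, field} poly" +
  fixes v :: "'a place"
  assumes place: "v \<in> places n f"
begin

lemma v_mult: "g \<in> K \<Longrightarrow> h \<in> K \<Longrightarrow> g \<noteq> 0 \<Longrightarrow> h \<noteq> 0 \<Longrightarrow> v (g * h) = v g + v h"
  and v_add: "g \<in> K \<Longrightarrow> h \<in> K \<Longrightarrow> g \<noteq> 0 \<Longrightarrow> h \<noteq> 0 \<Longrightarrow> g + h \<noteq> 0 \<Longrightarrow> min (v g) (v h) \<le> v (g + h)"
  and v_const: "a \<noteq> 0 \<Longrightarrow> v (ff_const a) = 0"
  and v_surj: "v ` (K - {0}) = UNIV"
  and v_outside: "h \<notin> K - {0} \<Longrightarrow> v h = 0"
  using place unfolding places_def Let_def by blast+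

lemma v_1_attained:
  obtains h where "h \<in> K" "h \<noteq> 0" "v h = 1"
proof -
  have "1 \<in> v ` (K - {0})" unfolding v_surj by (rule UNIV_I)
  then obtain h where "h \<in> K - {0}" "1 = v h" by (elim imageE)
  then show ?thesis using that[of h] by simp
qed

text \<open>
  The functions of value at least \<open>k\<close>, including zero, at which \<open>v\<close> takes a meaningless value.
\<close>

definition at_least :: "int \<Rightarrow> 'a ffield \<Rightarrow> bool" where
  "at_least k h \<longleftrightarrow> h \<in> K \<and> (h = 0 \<or> k \<le> v h)"

lemma const_0_iff: "ff_const (a :: 'a) = 0 \<longleftrightarrow> a = 0"
  using F.\<kappa>_eq_iff[of a 0] by (simp add: hom_0[OF is_hom_ff_const])

lemma v_1: "v 1 = 0"
  using v_const[of 1] by (simp add: hom_1[OF is_hom_ff_const])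

lemma v_power: "g \<in> K \<Longrightarrow> g \<noteq> 0 \<Longrightarrow> v (g ^ k) = int k * v g"
  by (induction k) (simp_all add: v_1 v_mult K_power algebra_simps)

lemma at_least_add: "at_least k g \<Longrightarrow> at_least k h \<Longrightarrow> at_least k (g + h)"
  using v_add[of g h] K_add[of g h] by (cases "g = 0 \<or> h = 0 \<or> g + h = 0") (auto simp: at_least_def)

lemma at_least_mult: "at_least k g \<Longrightarrow> at_least l h \<Longrightarrow> at_least (k + l) (g * h)"
  using v_mult[of g h] K_mult[of g h] by (cases "g = 0"; cases "h = 0") (auto simp: at_least_def)

lemma at_least_mult_0: "at_least k g \<Longrightarrow> at_least 0 h \<Longrightarrow> at_least k (g * h)"
  using at_least_mult[of k g 0 h] by simp

lemma at_least_const: "at_least 0 (ff_const a)"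
  using v_const[of a] by (cases "a = 0") (auto simp: at_least_def K_const hom_0[OF is_hom_ff_const] K_0)

lemma at_least_0: "at_least k 0"
  by (simp add: at_least_def K_0)

lemma at_least_1: "at_least 0 1"
  by (simp add: at_least_def K_1 v_1)

lemma at_least_mono: "at_least k h \<Longrightarrow> l \<le> k \<Longrightarrow> at_least l h"
  by (auto simp: at_least_def)

lemma at_least_power: "at_least 0 h \<Longrightarrow> at_least 0 (h ^ k)"
  by (induction k) (auto simp: at_least_1 intro: at_least_mult_0)

lemma at_least_uminus: "at_least k h \<Longrightarrow> at_least k (- h)"
  using at_least_mult_0[of k h, OF _ at_least_const[of "- 1"]]
  by (simp add: hom_uminus[OF is_hom_ff_const] hom_1[OF is_hom_ff_const])

lemma at_least_diff: "at_least k g \<Longrightarrow> at_least k h \<Longrightarrow> at_least k (g - h)"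
  using at_least_add[of k g "- h"] at_least_uminus by simp

lemma at_least_sum: "(\<And>i. i \<in> S \<Longrightarrow> at_least k (g i)) \<Longrightarrow> at_least k (\<Sum>i\<in>S. g i)"
  by (induction S rule: infinite_finite_induct) (auto simp: at_least_0 at_least_add)

lemma at_least_poly_at: "at_least 0 g \<Longrightarrow> at_least 0 (poly_at ff_const g p)"
  by (induction p) (auto simp: poly_at_pCons is_hom_ff_const at_least_0
      intro!: at_least_add at_least_const at_least_mult_0)

lemma at_least_1_const_iff: "at_least 1 (ff_const a) \<longleftrightarrow> a = 0"
  by (cases "a = 0") (simp_all add: at_least_def K_const const_0_iff v_const)

text \<open>
  If the value of \<open>g + h\<close> were larger, then so would be that of \<open>g = (g + h) - h\<close>.
\<close>

lemma v_add_dominant: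
  assumes "g \<in> K" "g \<noteq> 0" "at_least (v g + 1) h"
  shows "g + h \<noteq> 0" "v (g + h) = v g"
proof -
  have g: "at_least k g \<longleftrightarrow> k \<le> v g" for k using assms by (simp add: at_least_def)
  have not: "\<not> at_least (v g + 1) (g + h)"
  proof
    assume "at_least (v g + 1) (g + h)"
    then have "at_least (v g + 1) (g + h - h)" using assms(3) by (rule at_least_diff)
    then show False using g by simp
  qed
  then show nz: "g + h \<noteq> 0" using at_least_0 by metis
  have "at_least (v g) (g + h)"
    by (rule at_least_add) (use g at_least_mono[OF assms(3)] in auto)
  then show "v (g + h) = v g" using not nz by (auto simp: at_least_def)
qed

lemma v_y: "int n * v (ff_y n f) = v (F.ev1 f)"
  using v_power[OF K_y F.y_nz, of n] by (simp add: F.y_power)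

lemma at_least_y:
  assumes "at_least 0 ff_x" shows "at_least 0 (ff_y n f)"
proof -
  have "at_least 0 (F.ev1 f)" by (rule at_least_poly_at[OF assms])
  then have "0 \<le> int n * v (ff_y n f)" using F.ev1_eq_0_iff f_nz by (simp add: at_least_def v_y)
  then show ?thesis using n_pos by (simp add: at_least_def K_y zero_le_mult_iff)
qed

lemma ff_x_nz: "ff_x \<noteq> (0 :: 'a ffield)"
  using F.ev1_eq_0_iff[of "[:0, 1:]"] by (simp add: poly_at_x[OF is_hom_ff_const])

lemma v_ev1_at_pole:
  assumes "v ff_x < 0" "p \<noteq> 0"
  shows "v (F.ev1 p) = int (degree p) * v ff_x"
  using assms(2)
proof (induction p)
  case 0
  then show ?case by simp
next
  case (pCons a p)
  show ?case
  proof (cases "p = 0")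
    case True
    then show ?thesis using pCons by (simp add: poly_at_const[OF is_hom_ff_const] v_const)
  next
    case False
    let ?g = "ff_x * F.ev1 p"
    have nz: "F.ev1 p \<noteq> 0" using False by (simp add: F.ev1_eq_0_iff)
    have vg: "v ?g = int (degree p + 1) * v ff_x"
      using pCons.IH[OF False] nz by (simp add: v_mult K_x K_ev1 ff_x_nz distrib_right)
    also have "\<dots> \<le> v ff_x" using assms(1) by (simp add: distrib_right mult_nonneg_nonpos)
    finally have "at_least (v ?g + 1) (ff_const a)"
      using assms(1) by (intro at_least_mono[OF at_least_const]) linarith
    then have "v (?g + ff_const a) = v ?g"
      by (intro v_add_dominant) (use nz ff_x_nz in \<open>auto intro: K_intros\<close>)
    then show ?thesis using vg False by (simp add: poly_at_pCons is_hom_ff_const add.commute)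
  qed
qed

end

subsection \<open>Ramification at infinity\<close>

text \<open>
  The subring generated over the constants.  Induction over its elements gives reduction modulo a
  generator without bivariate polynomials.
\<close>

inductive_set generated_ring :: "'a :: {finite, field} ffield set \<Rightarrow> 'a ffield set"
  for G where
  const: "ff_const a \<in> generated_ring G"
| gen: "g \<in> G \<Longrightarrow> g \<in> generated_ring G"
| add: "g \<in> generated_ring G \<Longrightarrow> h \<in> generated_ring G \<Longrightarrow> g + h \<in> generated_ring G"
| mult: "g \<in> generated_ring G \<Longrightarrow> h \<in> generated_ring G \<Longrightarrow> g * h \<in> generated_ring G"

lemma generated_ring_power: "g \<in> generated_ring G \<Longrightarrow> g ^ k \<in> generated_ring G"
proof (induction k)
  case 0
  show ?case using generated_ring.const[of 1 G] by (simp add: hom_1[OF is_hom_ff_const])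
next
  case (Suc k)
  then show ?case by (simp add: generated_ring.mult)
qed

lemma generated_ring_0: "0 \<in> generated_ring G"
  using generated_ring.const[of 0 G] by (simp add: hom_0[OF is_hom_ff_const])

lemma generated_ring_poly_at: "g \<in> generated_ring G \<Longrightarrow> poly_at ff_const g p \<in> generated_ring G"
  by (induction p) (auto simp: poly_at_pCons is_hom_ff_const generated_ring_0 intro: generated_ring.intros)

context place begin

lemma generated_ring_at_least:
  assumes "\<And>g. g \<in> G \<Longrightarrow> at_least 0 g" "b \<in> generated_ring G"
  shows "at_least 0 b"
  using assms(2)
  by induction (auto intro: at_least_const assms(1) at_least_add at_least_mult_0)

text \<open>
  The polynomials whose value at \<open>w\<close> has zero residue form an ideal, generated by some \<open>m\<close>.  As \<open>P\<close> is
  separable, its cofactor \<open>m'\<close> is not in the ideal.  This replaces the residue field, which may be larger than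
  the field of constants.
\<close>

lemma residue_poly_dvd:
  assumes "at_least 0 w" "P \<noteq> 0" "at_least 1 (poly_at ff_const w P)"
    and sep: "\<And>m. m dvd P \<Longrightarrow> m dvd pderiv P \<Longrightarrow> is_unit m"
  obtains m m' where "P = m * m'" "\<not> at_least 1 (poly_at ff_const w m')"
    "\<And>p. at_least 1 (poly_at ff_const w p) \<Longrightarrow> m dvd p"
proof -
  let ?e = "poly_at ff_const w"
  note hom = is_hom_poly_at[OF is_hom_ff_const, of w]
  define Q where "Q = (\<lambda>m. m \<noteq> 0 \<and> at_least 1 (?e m))"
  have "Q P" using assms by (simp add: Q_def)
  then obtain m where m: "Q m" "\<And>m'. Q m' \<Longrightarrow> degree m \<le> degree m'"
    using ex_has_least_nat[of Q P degree] by blast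
  have dvd: "m dvd p" if p: "at_least 1 (?e p)" for p
  proof -
    have "?e (p mod m) = ?e (p - m * (p div m))" by (simp add: minus_mult_div_eq_mod)
    also have "\<dots> = ?e p - ?e m * ?e (p div m)" by (simp only: hom_diff[OF hom] hom_mult[OF hom])
    finally have eq: "?e (p mod m) = ?e p - ?e m * ?e (p div m)" .
    have "at_least 1 (?e (p mod m))"
      unfolding eq using m(1)
      by (intro at_least_diff p at_least_mult_0 at_least_poly_at assms(1)) (simp add: Q_def)
    then have "\<not> Q (p mod m) \<Longrightarrow> p mod m = 0" by (simp add: Q_def)
    moreover have "degree (p mod m) < degree m \<or> p mod m = 0"
      using degree_mod_less[of m p] m(1) by (auto simp: Q_def)
    ultimately have "p mod m = 0" using m(2)[of "p mod m"] by fastforce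
    then show ?thesis by (simp add: mod_eq_0_iff_dvd)
  qed
  obtain m' where m': "P = m * m'" using dvd[OF assms(3)] by (elim dvdE)
  have "\<not> at_least 1 (?e m')"
  proof
    assume "at_least 1 (?e m')"
    then obtain r where r: "m' = m * r" using dvd by (metis dvdE)
    have "pderiv P = m * (m * pderiv r + pderiv m * r) + pderiv m * (m * r)"
      by (simp add: m' r pderiv_mult algebra_simps)
    then have "m dvd pderiv P" by (metis dvd_add dvd_triv_left mult.left_commute)
    then have "is_unit m" using sep m' by simp
    then obtain a where "m = [:a:]" "a \<noteq> 0" by (auto simp: is_unit_poly_iff dvd_field_iff)
    then show False using m(1) by (simp add: Q_def poly_at_const[OF is_hom_ff_const] at_least_1_const_iff)
  qed
  then show ?thesis using that m' dvd by blast
qed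

end

context superelliptic begin

lemma K_inverse_x: "inverse ff_x \<in> K"
  using K_inverse_ev1[of "[:0, 1:]"] by (simp add: poly_at_x[OF is_hom_ff_const])

lemma K_inverse_y: "inverse (ff_y n f) \<in> K"
proof -
  have "ff_y n f * ff_y n f ^ (n - 1) = F.ev1 f"
    using n_pos F.y_power by (simp flip: power_Suc)
  then have "ff_y n f * (ff_y n f ^ (n - 1) * inverse (F.ev1 f)) = 1"
    using F.ev1_eq_0_iff f_nz by (simp flip: mult.assoc)
  then have "inverse (ff_y n f) = ff_y n f ^ (n - 1) * inverse (F.ev1 f)"
    by (rule inverse_unique)
  then show ?thesis by (simp add: K_mult K_power K_y K_inverse_ev1)
qed

end

context place begin

lemma v_inverse: "g \<in> K \<Longrightarrow> inverse g \<in> K \<Longrightarrow> g \<noteq> 0 \<Longrightarrow> v (inverse g) = - v g"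
  using v_mult[of g "inverse g"] v_1 by simp

text \<open>
  With \<open>n' = n / c\<close> and \<open>d' = d / c\<close>, the relation \<open>n v(y) = d v(x)\<close> gives \<open>v(x) = n' s\<close> and \<open>v(y) = d' s\<close> for some
  \<open>s < 0\<close>; the point is that \<open>s = - 1\<close>.  There are monomials \<open>u\<close> and \<open>w\<close> in \<open>x\<close> and \<open>y\<close> of values \<open>- s\<close> and \<open>0\<close> that
  generate all monomials.  In the ring generated by \<open>u\<close> and \<open>w\<close>, the equation of the curve says that \<open>w\<^sup>c\<close> is
  congruent modulo \<open>u\<close> to the leading coefficient of \<open>f\<close>.  This equation for \<open>w\<close> is separable, so \<open>u\<close> is a uniformiser:
  every function has a value divisible by \<open>s\<close>, and the value \<open>1\<close> is attained.
\<close>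

lemma pole_orders:
  assumes pole: "v ff_x < 0"
  shows "v ff_x = - int (n div gcd n (degree f))" "v (ff_y n f) = - int (degree f div gcd n (degree f))"
proof -
  let ?x = "ff_x :: 'a ffield" and ?y = "ff_y n f"
  define d where "d = degree f"
  define c n' d' where "c = gcd n d" and "n' = n div c" and "d' = d div c"
  have cpos: "c > 0" using n_pos by (simp add: c_def)
  have n: "n = n' * c" and d: "d = d' * c" by (simp_all add: n'_def d'_def c_def)
  have d_pos: "d > 0" using degree_f_pos by (simp add: d_def)
  have n'_pos: "n' > 0" and d'_pos: "d' > 0" using n d n_pos d_pos by (auto intro!: Nat.gr0I)
  have cop: "coprime n' d'"
    unfolding n'_def d'_def c_def by (rule div_gcd_coprime) (use n_pos in simp)
  have "int n * v ?y = int d * v ?x"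
    using v_y v_ev1_at_pole[OF pole f_nz] by (simp add: d_def)
  then have "int c * (int n' * v ?y) = int c * (int d' * v ?x)" by (simp add: n d mult_ac)
  then have nvdv: "int n' * v ?y = int d' * v ?x" using cpos by simp
  then have "int n' dvd int d' * v ?x" by (metis dvd_triv_left)
  then have "int n' dvd v ?x"
    using cop by (simp add: coprime_dvd_mult_right_iff coprime_int_iff)
  then obtain s where s: "v ?x = int n' * s" by (elim dvdE)
  have vy: "v ?y = int d' * s" using nvdv s n'_pos by (simp add: mult.left_commute)
  have s_neg: "s < 0" using s pole n'_pos by (simp add: mult_less_0_iff)
  \<comment> \<open>The vectors \<open>(a, - b)\<close> and \<open>(- d', n')\<close> form a basis of the integer lattice, so \<open>u\<close> and
    \<open>w\<close> below generate all Laurent monomials in \<open>x\<close> and \<open>y\<close>.  The signs are chosen such that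
    \<open>1 / x\<close> and \<open>1 / y\<close> have nonnegative exponents.\<close>
  obtain b a where ba: "d' * b = n' * a + 1"
    using bezout_nat[of d' n'] d'_pos cop by (auto simp: gcd.commute coprime_iff_gcd_eq_1)
  define xi yi u w where "xi = inverse ?x" and "yi = inverse ?y"
    and "u = ?x ^ a * yi ^ b" and "w = ?y ^ n' * xi ^ d'"
  have KK: "xi \<in> K" "yi \<in> K" "u \<in> K" "w \<in> K"
    unfolding u_def w_def xi_def yi_def
    by (intro K_inverse_x K_inverse_y K_mult K_power K_x K_y)+
  have xy: "?x * xi = 1" "?y * yi = 1" using ff_x_nz F.y_nz by (simp_all add: xi_def yi_def)
  have nz: "xi \<noteq> 0" "yi \<noteq> 0" "u \<noteq> 0" "w \<noteq> 0" using ff_x_nz F.y_nz by (auto simp: xi_def yi_def u_def w_def)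
  have vxi: "v xi = - int n' * s" and vyi: "v yi = - int d' * s"
    using v_inverse[OF K_x K_inverse_x] v_inverse[OF K_y K_inverse_y] ff_x_nz F.y_nz s vy
    by (simp_all add: xi_def yi_def)
  have "v u = int a * (int n' * s) - int b * (int d' * s)"
    using KK nz ff_x_nz by (simp add: u_def v_mult v_power K_x K_power s vyi)
  also have "\<dots> = - s * (int (d' * b) - int (n' * a))" by (simp add: algebra_simps)
  finally have vu: "v u = - s" by (simp add: ba)
  have vw: "v w = 0"
    using KK nz F.y_nz by (simp add: w_def v_mult v_power K_y K_power vy vxi)
  have xi_eq: "xi = u ^ n' * w ^ b"
  proof -
    have "u ^ n' * w ^ b = ?x ^ (a * n') * xi ^ (d' * b) * (?y ^ (n' * b) * yi ^ (n' * b))"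
      unfolding u_def w_def power_mult_distrib power_mult[symmetric] by (simp only: mult_ac)
    also have "\<dots> = ?x ^ (a * n') * xi ^ (n' * a + 1)"
      by (simp only: ba power_mult_distrib[symmetric] xy power_one mult_1_right)
    also have "\<dots> = (?x * xi) ^ (a * n') * xi"
      by (simp add: power_add power_mult_distrib mult_ac)
    finally show ?thesis by (simp add: xy)
  qed
  have yi_eq: "yi = u ^ d' * w ^ a"
  proof -
    have "u ^ d' * w ^ a = ?y ^ (n' * a) * yi ^ (d' * b) * (?x ^ (d' * a) * xi ^ (d' * a))"
      unfolding u_def w_def power_mult_distrib power_mult[symmetric]
      by (simp only: mult_ac)
    also have "\<dots> = ?y ^ (n' * a) * yi ^ (n' * a + 1)"
      by (simp only: ba power_mult_distrib[symmetric] xy power_one mult_1_right)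
    also have "\<dots> = (?y * yi) ^ (n' * a) * yi"
      by (simp add: power_add power_mult_distrib mult_ac)
    finally show ?thesis by (simp add: xy)
  qed
  let ?B = "generated_ring {u, w}"
  have uw: "u \<in> ?B" "w \<in> ?B" by (auto intro: generated_ring.gen)
  have xyB: "xi \<in> ?B" "yi \<in> ?B"
    unfolding xi_eq yi_eq by (intro generated_ring.mult generated_ring_power uw)+
  have at_u: "at_least 1 u" and at_w: "at_least 0 w"
    using KK nz vu vw s_neg by (simp_all add: at_least_def)
  have at_B: "at_least 0 g" if "g \<in> ?B" for g
  proof (rule generated_ring_at_least[OF _ that])
    fix g' assume "g' \<in> {u, w}"
    then show "at_least 0 g'" using at_w at_least_mono[OF at_u zero_le_one] by blast
  qed
  \<comment> \<open>The case \<open>p = f\<close> shows that the residue of \<open>w\<close> is a root of \<open>X\<^sup>c - l\<close> with \<open>l = lead_coeff f\<close>.\<close>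
  have lead: "\<exists>g\<in>?B. F.ev1 p * xi ^ degree p = ff_const (lead_coeff p) + xi * g" for p
  proof (induction p)
    case 0
    then show ?case by (intro bexI[of _ 0]) (simp_all add: generated_ring_0 hom_0[OF is_hom_ff_const])
  next
    case (pCons e p)
    show ?case
    proof (cases "p = 0")
      case True
      then show ?thesis
        by (intro bexI[of _ 0]) (simp_all add: generated_ring_0 poly_at_const[OF is_hom_ff_const])
    next
      case False
      obtain g where g: "g \<in> ?B" "F.ev1 p * xi ^ degree p = ff_const (lead_coeff p) + xi * g"
        using pCons.IH by blast
      have "F.ev1 (pCons e p) * xi ^ Suc (degree p)
          = xi * (ff_const e * xi ^ degree p) + (?x * xi) * (F.ev1 p * xi ^ degree p)"
        by (simp add: poly_at_pCons is_hom_ff_const algebra_simps)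
      also have "\<dots> = ff_const (lead_coeff p) + xi * (ff_const e * xi ^ degree p + g)"
        unfolding xy g(2) by (simp add: algebra_simps)
      finally show ?thesis
        using False g(1)
        by (intro bexI[of _ "ff_const e * xi ^ degree p + g"])
          (auto intro!: generated_ring.add generated_ring.mult generated_ring.const generated_ring_power xyB)
    qed
  qed
  define l where "l = lead_coeff f"
  define P where "P = monom 1 c - [:l:]"
  have l: "l \<noteq> 0" using f_nz by (simp add: l_def)
  have w_c: "w ^ c = F.ev1 f * xi ^ d"
  proof -
    have "w ^ c = ?y ^ n * xi ^ d"
      by (simp add: w_def power_mult_distrib power_mult[symmetric] n d)
    then show ?thesis by (simp add: F.y_power)
  qed
  have P_w: "poly_at ff_const w P = w ^ c - ff_const l"
    by (simp add: P_def hom_diff[OF is_hom_poly_at[OF is_hom_ff_const]] poly_at_monom[OF is_hom_ff_const]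
        poly_at_const[OF is_hom_ff_const] hom_1[OF is_hom_ff_const])
  obtain g0 where g0: "g0 \<in> ?B" "poly_at ff_const w P = xi * g0"
    using lead[of f] unfolding P_w w_c by (auto simp: d_def l_def)
  define g1 where "g1 = u ^ (n' - 1) * w ^ b * g0"
  have g1: "g1 \<in> ?B" "poly_at ff_const w P = u * g1"
  proof -
    show "g1 \<in> ?B" unfolding g1_def by (intro generated_ring.mult generated_ring_power uw g0)
    have "u ^ n' = u * u ^ (n' - 1)" using n'_pos by (simp flip: power_Suc)
    then show "poly_at ff_const w P = u * g1" by (simp add: g0(2) xi_eq g1_def mult_ac)
  qed
  have c_nz: "(of_nat c :: 'a) \<noteq> 0"
    using of_nat_n unfolding n by auto
  have sep: "is_unit m" if m: "m dvd P" "m dvd pderiv P" for m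
  proof -
    have "[:0, 1:] * pderiv P - of_nat c * P = [:of_nat c * l:]"
    proof -
      have "pderiv P = monom (of_nat c) (c - 1)" by (simp add: P_def pderiv_diff pderiv_monom pderiv_pCons)
      then have "[:0, 1:] * pderiv P = monom (of_nat c) c"
        using cpos by (simp add: monom_Suc[symmetric])
      moreover have "of_nat c * P = monom (of_nat c) c - [:of_nat c * l:]"
        by (simp add: P_def right_diff_distrib of_nat_poly smult_monom)
      ultimately show ?thesis by simp
    qed
    moreover have "m dvd [:0, 1:] * pderiv P - of_nat c * P"
      using m by (intro dvd_diff dvd_mult) auto
    ultimately have "m dvd [:of_nat c * l:]" by simp
    moreover have "is_unit [:of_nat c * l:]" using c_nz l by (simp add: is_unit_const_poly_iff dvd_field_iff)
    ultimately show ?thesis by (rule dvd_unit_imp_unit)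
  qed
  have P_nz: "P \<noteq> 0"
  proof
    assume "P = 0"
    then show False using sep[of 0] by simp
  qed
  have "at_least 1 (poly_at ff_const w P)"
    unfolding g1(2) by (rule at_least_mult_0[OF at_u at_B[OF g1(1)]])
  then obtain m m' where m: "P = m * m'" "\<not> at_least 1 (poly_at ff_const w m')"
      "\<And>p. at_least 1 (poly_at ff_const w p) \<Longrightarrow> m dvd p"
    using residue_poly_dvd[OF at_w P_nz _ sep] by blast
  note hom = is_hom_poly_at[OF is_hom_ff_const, of w]
  let ?M = "poly_at ff_const w m'"
  have MB: "?M \<in> ?B" by (rule generated_ring_poly_at[OF uw(2)])
  have M: "?M \<in> K" "?M \<noteq> 0" "v ?M = 0"
    using at_B[OF MB] m(2) by (auto simp: at_least_def K_0)
  \<comment> \<open>Reduction modulo \<open>u\<close> leaves a polynomial in \<open>w\<close>.\<close>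
  have dec: "\<exists>p. \<exists>h\<in>?B. g = poly_at ff_const w p + u * h" if "g \<in> ?B" for g
    using that
  proof induction
    case (const e)
    show ?case
      by (intro exI[of _ "[:e:]"] bexI[of _ 0]) (auto simp: poly_at_const[OF is_hom_ff_const] generated_ring_0)
  next
    case (gen g)
    then consider "g = u" | "g = w" by auto
    then show ?case
    proof cases
      case 1
      then show ?thesis
        using generated_ring.const[of 1 "{u, w}"]
        by (intro exI[of _ 0] bexI[of _ 1]) (simp_all add: hom_1[OF is_hom_ff_const])
    next
      case 2
      then show ?thesis
        by (intro exI[of _ "[:0, 1:]"] bexI[of _ 0]) (auto simp: poly_at_x[OF is_hom_ff_const] generated_ring_0)
    qed
  next
    case (add g h)
    then obtain p1 h1 p2 h2 where "h1 \<in> ?B" "h2 \<in> ?B"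
      "g = poly_at ff_const w p1 + u * h1" "h = poly_at ff_const w p2 + u * h2" by blast
    then show ?case
      by (intro exI[of _ "p1 + p2"] bexI[of _ "h1 + h2"])
        (auto simp: hom_add[OF hom] algebra_simps intro: generated_ring.add)
  next
    case (mult g h)
    then obtain p1 h1 p2 h2 where *: "h1 \<in> ?B" "h2 \<in> ?B"
      "g = poly_at ff_const w p1 + u * h1" "h = poly_at ff_const w p2 + u * h2" by blast
    show ?case
    proof (intro exI[of _ "p1 * p2"] bexI)
      show "g * h = poly_at ff_const w (p1 * p2) + u * (poly_at ff_const w p1 * h2 + h1 * h)"
        by (simp add: * hom_mult[OF hom] algebra_simps)
      show "poly_at ff_const w p1 * h2 + h1 * h \<in> ?B"
        using * mult by (intro generated_ring.add generated_ring.mult generated_ring_poly_at uw) auto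
    qed
  qed
  have BK: "g \<in> K" if "g \<in> ?B" for g using at_B[OF that] by (simp add: at_least_def)
  \<comment> \<open>If \<open>v g > 0\<close>, the polynomial part of \<open>g\<close> is divisible by \<open>m\<close>; multiplication by the unit \<open>m'(w)\<close>
    turns it into a multiple of \<open>P(w)\<close>, hence of \<open>u\<close>, and one factor \<open>u\<close> of value \<open>- s\<close> can be split off.\<close>
  have v_B: "s dvd v g" if "g \<in> ?B" "g \<noteq> 0" for g
    using that
  proof (induction "nat (v g)" arbitrary: g rule: less_induct)
    case less
    have vg: "v g \<ge> 0" using at_B[OF less.prems(1)] less.prems(2) by (simp add: at_least_def)
    show ?case
    proof (cases "v g = 0")
      case False
      then have at_g: "at_least 1 g" using vg less.prems by (simp add: at_least_def BK)
      obtain p h where ph: "h \<in> ?B" "g = poly_at ff_const w p + u * h" using dec[OF less.prems(1)] by blast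
      have "at_least 1 (g - u * h)"
        by (intro at_least_diff at_g at_least_mult_0 at_u at_B ph)
      then have "m dvd p" using ph(2) m(3) by simp
      then obtain p' where p': "p = m * p'" by (elim dvdE)
      define h' where "h' = g1 * poly_at ff_const w p' + ?M * h"
      have h'B: "h' \<in> ?B"
        unfolding h'_def by (intro generated_ring.add generated_ring.mult generated_ring_poly_at uw g1 ph MB)
      have "?M * g = poly_at ff_const w P * poly_at ff_const w p' + u * (?M * h)"
        by (simp add: ph(2) p' m(1) hom_mult[OF hom] algebra_simps)
      also have "\<dots> = u * h'" by (simp add: g1(2) h'_def algebra_simps)
      finally have eq: "?M * g = u * h'" .
      have h'nz: "h' \<noteq> 0" using eq M less.prems by auto
      have "v (?M * g) = v g" using M less.prems by (simp add: v_mult BK)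
      moreover have "v (u * h') = - s + v h'" using KK nz h'nz by (simp add: v_mult BK[OF h'B] vu)
      ultimately have vh': "v g = - s + v h'" using eq by simp
      have "v h' \<ge> 0" using at_B[OF h'B] h'nz by (simp add: at_least_def)
      then have "s dvd v h'" using vh' s_neg by (intro less.hyps h'B h'nz) simp
      then show ?thesis using vh' by simp
    qed simp
  qed
  \<comment> \<open>Multiplied by powers of \<open>1 / x\<close> and \<open>1 / y\<close>, every polynomial in \<open>x\<close> and \<open>y\<close> lies in the ring generated
    by \<open>u\<close> and \<open>w\<close>.\<close>
  have clear1: "\<exists>i. F.ev1 p * xi ^ i \<in> ?B" for p
  proof -
    obtain g where "g \<in> ?B" "F.ev1 p * xi ^ degree p = ff_const (lead_coeff p) + xi * g"
      using lead by blast
    then show ?thesis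
      by (intro exI[of _ "degree p"]) (auto intro!: generated_ring.add generated_ring.mult generated_ring.const xyB)
  qed
  have clear2: "\<exists>i j. F.ev2 r * xi ^ i * yi ^ j \<in> ?B" for r
  proof (induction r)
    case 0
    show ?case by (simp add: hom_0[OF F.hom_ev2] generated_ring_0)
  next
    case (pCons p r)
    obtain i j where ij: "F.ev2 r * xi ^ i * yi ^ j \<in> ?B" using pCons.IH by blast
    obtain k where k: "F.ev1 p * xi ^ k \<in> ?B" using clear1 by blast
    have "F.ev2 (pCons p r) * xi ^ (i + k) * yi ^ Suc j
        = F.ev1 p * xi ^ k * (xi ^ i * yi ^ Suc j) + (?y * yi) * xi ^ k * (F.ev2 r * xi ^ i * yi ^ j)"
      by (simp add: F.ev2_def poly_at_pCons[OF F.hom_ev1] power_add algebra_simps)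
    also have "\<dots> \<in> ?B"
      unfolding xy mult_1_left
      by (intro generated_ring.add generated_ring.mult generated_ring_power xyB ij k)
    finally show ?case by blast
  qed
  have v_ev2: "s dvd v (F.ev2 r)" if r: "F.ev2 r \<noteq> 0" for r
  proof -
    obtain i j where ij: "F.ev2 r * xi ^ i * yi ^ j \<in> ?B" using clear2 by blast
    have "s dvd v (F.ev2 r * xi ^ i * yi ^ j)" by (rule v_B[OF ij]) (use r nz in auto)
    also have "v (F.ev2 r * xi ^ i * yi ^ j) = v (F.ev2 r) + int i * v xi + int j * v yi"
      using r nz KK by (simp add: v_mult v_power K_mult K_power K_ev2)
    finally have "s dvd v (F.ev2 r) + (- int i * int n' - int j * int d') * s"
      unfolding vxi vyi by (simp add: algebra_simps)
    then show ?thesis by (simp add: dvd_add_left_iff)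
  qed
  obtain h where h: "h \<in> K" "h \<noteq> 0" "v h = 1" by (rule v_1_attained)
  obtain r D where rD: "D \<noteq> 0" "h * F.ev1 D = F.ev2 r" using h(1) in_K_iff by blast
  have Dnz: "F.ev1 D \<noteq> 0" using rD(1) by (simp add: F.ev1_eq_0_iff)
  have "s dvd v (F.ev2 r)" by (rule v_ev2) (use rD h Dnz in \<open>auto simp flip: rD(2)\<close>)
  moreover have "s dvd v (F.ev1 D)" using v_ev2[of "[:D:]"] Dnz by (simp add: F.ev2_const)
  moreover have "v (F.ev2 r) = 1 + v (F.ev1 D)"
    using h Dnz by (simp add: v_mult K_ev1 flip: rD(2))
  ultimately have "s dvd 1" by (simp add: dvd_add_left_iff)
  then have "s = - 1" using s_neg by (simp add: zdvd1_eq)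
  then show "v ff_x = - int (n div gcd n (degree f))" "v (ff_y n f) = - int (degree f div gcd n (degree f))"
    using s vy by (simp_all add: n'_def d'_def c_def d_def)
qed

end

section \<open>The Riemann--Roch spaces of multiples of the divisor at infinity\<close>

context laurent_model begin

text \<open>
  Order at least \<open>k\<close>, with zero included.
\<close>

definition low :: "int \<Rightarrow> 'b fls \<Rightarrow> bool" where
  "low k g \<longleftrightarrow> g = 0 \<or> k \<le> fls_subdegree g"

lemma low_sum: "(\<And>i. i \<in> S \<Longrightarrow> low k (g i)) \<Longrightarrow> low k (\<Sum>i\<in>S. g i)"
proof (induction S rule: infinite_finite_induct)
  case (insert i S)
  have "low k (g i)" "low k (\<Sum>i\<in>S. g i)" using insert by auto
  then have "low k (g i + (\<Sum>i\<in>S. g i))"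
    using fls_plus_subdegree[of "g i" "\<Sum>i\<in>S. g i"]
    by (cases "g i = 0"; cases "(\<Sum>i\<in>S. g i) = 0"; cases "g i + (\<Sum>i\<in>S. g i) = 0") (auto simp: low_def)
  then show ?case using insert.hyps by simp
qed (simp_all add: low_def)

lemma low_const_mult: "low k g \<Longrightarrow> low k (\<kappa> a * g)"
  using subdegree_const[of a] \<kappa>_eq_iff[of a 0]
  by (cases "a = 0"; cases "g = 0") (auto simp: low_def hom_0[OF hom_\<kappa>])

lemma low_const_mult_iff:
  assumes "a \<noteq> 0" shows "low k (\<kappa> a * g) \<longleftrightarrow> low k g"
proof
  assume "low k (\<kappa> a * g)"
  then have "low k (\<kappa> (1 / a) * (\<kappa> a * g))" by (rule low_const_mult)
  moreover have "\<kappa> (1 / a) * (\<kappa> a * g) = \<kappa> (1 / a * a) * g" by (simp only: hom_mult[OF hom_\<kappa>] mult.assoc)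
  ultimately show "low k g" using assms by (simp add: hom_1[OF hom_\<kappa>])
qed (rule low_const_mult)

text \<open>
  The orthogonality relations of the roots of unity express \<open>n r\<^sub>j y\<^sup>j\<close> as a linear combination, with constant
  coefficients, of the conjugates of \<open>h D\<close>.
\<close>

lemma terms_low_of_twists:
  assumes h: "h \<noteq> 0" "D \<noteq> 0" "h * F.ev1 D = F.ev2 r" "degree r < n"
    and low: "\<And>z. z ^ n = 1 \<Longrightarrow> N \<le> laurent_model.ff_val n f \<kappa> x (\<kappa> z * y) h"
    and j: "j < n"
  shows "low (N + fls_subdegree (ev1 D)) (ev1 (coeff r j) * y ^ j)"
proof -
  let ?k = "N + fls_subdegree (ev1 D)"
  let ?R = "{z :: 'a. z ^ n = 1}"
  have tw: "low ?k (\<Sum>i<n. \<kappa> (z ^ i) * (ev1 (coeff r i) * y ^ i))" if z: "z \<in> ?R" for z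
  proof -
    have "kummer n f \<kappa> x (\<kappa> z * y)" using kummer_twist z by simp
    then interpret T: laurent_model n f \<kappa> x "\<kappa> z * y"
      by (simp add: laurent_model_def laurent_model_axioms_def subdegree_const)
    have "N \<le> fls_subdegree (T.ev2 r) - fls_subdegree (ev1 D)"
      using low[of z] z T.ff_val_eq[OF h(2,3,1)] by simp
    then have "low ?k (T.ev2 r)" by (simp add: low_def)
    also have "T.ev2 r = (\<Sum>i<n. \<kappa> (z ^ i) * (ev1 (coeff r i) * y ^ i))"
      unfolding T.ev2_sum[OF h(4)]
      by (simp add: power_mult_distrib hom_power[OF hom_\<kappa>] mult_ac)
    finally show ?thesis .
  qed
  have "low ?k (\<Sum>z\<in>?R. \<kappa> (z ^ (n - j)) * (\<Sum>i<n. \<kappa> (z ^ i) * (ev1 (coeff r i) * y ^ i)))"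
    by (intro low_sum low_const_mult tw)
  also have "(\<Sum>z\<in>?R. \<kappa> (z ^ (n - j)) * (\<Sum>i<n. \<kappa> (z ^ i) * (ev1 (coeff r i) * y ^ i)))
      = (\<Sum>z\<in>?R. \<Sum>i<n. \<kappa> (z ^ (n - j + i)) * (ev1 (coeff r i) * y ^ i))"
    by (simp add: sum_distrib_left power_add hom_mult[OF hom_\<kappa>] mult_ac)
  also have "\<dots> = (\<Sum>i<n. \<Sum>z\<in>?R. \<kappa> (z ^ (n - j + i)) * (ev1 (coeff r i) * y ^ i))"
    by (rule sum.swap)
  also have "\<dots> = (\<Sum>i<n. \<kappa> (\<Sum>z\<in>?R. z ^ (n - j + i)) * (ev1 (coeff r i) * y ^ i))"
    by (simp add: hom_sum[OF hom_\<kappa>] sum_distrib_right)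
  also have "\<dots> = (\<Sum>i<n. if i = j then \<kappa> (of_nat n) * (ev1 (coeff r j) * y ^ j) else 0)"
  proof (intro sum.cong refl)
    fix i assume i: "i \<in> {..<n}"
    have "n dvd n - j + i \<longleftrightarrow> i = j"
    proof
      assume "n dvd n - j + i"
      then obtain l where l: "n - j + i = n * l" by (elim dvdE)
      have "n * l > 0" "n * l < n * 2" using i j unfolding l[symmetric] by auto
      then have "l = 1" by (cases l) auto
      then show "i = j" using l i j by simp
    qed (use j in simp)
    then show "\<kappa> (\<Sum>z\<in>?R. z ^ (n - j + i)) * (ev1 (coeff r i) * y ^ i)
        = (if i = j then \<kappa> (of_nat n) * (ev1 (coeff r j) * y ^ j) else 0)"
      by (simp add: sum_roots_of_unity[OF n_dvd n_pos] hom_0[OF hom_\<kappa>])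
  qed
  also have "\<dots> = \<kappa> (of_nat n) * (ev1 (coeff r j) * y ^ j)" using j by simp
  finally show ?thesis by (simp only: low_const_mult_iff[OF of_nat_n])
qed

end

context superelliptic begin

definition poly_fun :: "(nat \<Rightarrow> 'a poly) \<Rightarrow> 'a ffield" where
  "poly_fun U = (\<Sum>j<n. F.ev1 (U j) * ff_y n f ^ j)"

lemma K_sum: "(\<And>i. i \<in> S \<Longrightarrow> g i \<in> K) \<Longrightarrow> (\<Sum>i\<in>S. g i) \<in> K"
  by (induction S rule: infinite_finite_induct) (auto simp: K_0 intro: K_add)

lemma K_poly_fun: "poly_fun U \<in> K"
  unfolding poly_fun_def by (intro K_sum K_mult K_power K_y K_ev1)

lemma placeI: "v \<in> places n f \<Longrightarrow> place n f v"
  by (simp add: place_def place_axioms_def superelliptic_axioms)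

abbreviation (input) inf_div :: "nat \<Rightarrow> 'a divisor" where
  "inf_div s \<equiv> (\<lambda>P. int s * D_inf n f P)"

text \<open>
  At a finite place \<open>x\<close> and \<open>y\<close> are both regular; at infinity \<open>pole_orders\<close> gives the pole order of each
  monomial.
\<close>

lemma poly_fun_in_RR_space:
  assumes U: "U \<in> polys_below n (degree f) (gcd n (degree f) * s)"
  shows "poly_fun U \<in> RR_space n f (inf_div s)"
proof -
  have "0 \<le> v (poly_fun U) + int s * D_inf n f v" if v: "v \<in> places n f" "poly_fun U \<noteq> 0" for v
  proof -
    interpret place n f v by (rule placeI[OF v(1)])
    show ?thesis
    proof (cases "v ff_x < 0")
      case False
      then have x: "at_least 0 ff_x" by (simp add: at_least_def K_x)
      have "at_least 0 (poly_fun U)"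
        unfolding poly_fun_def
        by (intro at_least_sum at_least_mult_0 at_least_poly_at at_least_power at_least_y x)
      then show ?thesis using v(2) by (simp add: at_least_def D_inf_def)
    next
      case True
      let ?c = "gcd n (degree f)"
      let ?n = "n div ?c" and ?d = "degree f div ?c"
      have c: "?c > 0" using n_pos by simp
      have "at_least (- int s) (F.ev1 (U j) * ff_y n f ^ j)" if j: "j < n" for j
      proof (cases "U j = 0")
        case True
        then show ?thesis by (simp add: at_least_0)
      next
        case False
        then have "degree (U j) < xcount n (degree f) (?c * s) j"
          using U j by (auto simp: polys_below_def bounded_polys_iff)
        then have "n * degree (U j) + degree f * j \<le> ?c * s" by (simp add: less_xcount_iff n_pos)
        also have "n * degree (U j) + degree f * j = ?c * (?n * degree (U j) + ?d * j)"
          by (simp add: distrib_left flip: mult.assoc)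
        finally have le: "?n * degree (U j) + ?d * j \<le> s"
          using mult_le_cancel1[of ?c "?n * degree (U j) + ?d * j" s] c by blast
        have "v (F.ev1 (U j) * ff_y n f ^ j) = int (degree (U j)) * v ff_x + int j * v (ff_y n f)"
          using False F.y_nz
          by (simp add: v_mult K_ev1 K_power K_y F.ev1_eq_0_iff v_power v_ev1_at_pole[OF \<open>v ff_x < 0\<close>])
        also have "\<dots> = - int (?n * degree (U j) + ?d * j)"
          unfolding pole_orders[OF \<open>v ff_x < 0\<close>] by simp
        finally have "- int s \<le> v (F.ev1 (U j) * ff_y n f ^ j)" using le by linarith
        then show ?thesis by (simp add: at_least_def K_mult K_ev1 K_power K_y)
      qed
      then have "at_least (- int s) (poly_fun U)" unfolding poly_fun_def by (intro at_least_sum) auto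
      then show ?thesis using v True by (simp add: at_least_def D_inf_def)
    qed
  qed
  then show ?thesis by (simp add: RR_space_def K_poly_fun)
qed

text \<open>
  Both \<open>y\<^sup>n = f(x)\<close> and the substitution \<open>x = \<alpha> + t\<^sup>n\<close> multiply orders by \<open>n\<close>.
\<close>

lemma subdegree_y_finite:
  assumes "laurent_model n f fls_of_const (fls_const \<alpha> + fls_X ^ n) y"
  shows "fls_subdegree y = int (Polynomial.order \<alpha> (closure_poly f))"
proof -
  interpret L: laurent_model n f fls_of_const "fls_const \<alpha> + fls_X ^ n" y by fact
  have "int n * fls_subdegree y = fls_subdegree (y ^ n)" by (simp add: fls_subdegree_pow)
  also have "\<dots> = int n * int (Polynomial.order \<alpha> (closure_poly f))"
    unfolding L.y_power by (rule finite_model_nz[OF f_nz])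
  finally show ?thesis using n_pos by simp
qed

lemma subdegree_y_infinite:
  assumes "laurent_model n f fls_of_const (fls_X_inv ^ n) y"
  shows "fls_subdegree y = - int (degree f)"
proof -
  interpret L: laurent_model n f fls_of_const "fls_X_inv ^ n" y by fact
  have "int n * fls_subdegree y = fls_subdegree (y ^ n)" by (simp add: fls_subdegree_pow)
  also have "\<dots> = int n * (- int (degree f))"
    unfolding L.y_power infinite_model_nz(2)[OF f_nz] by simp
  finally show ?thesis using n_pos by (metis mult_left_cancel not_gr_zero of_nat_eq_0_iff)
qed

lemma RR_space_finite_bound:
  assumes h: "h \<in> RR_space n f (inf_div s)" "h \<noteq> 0"
    and L: "laurent_model n f fls_of_const (fls_const \<alpha> + fls_X ^ n) y"
    and D: "D \<noteq> 0" "poly (closure_poly D) \<alpha> = 0"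
  shows "0 \<le> laurent_model.ff_val n f fls_of_const (fls_const \<alpha> + fls_X ^ n) y h"
proof -
  interpret L: laurent_model n f fls_of_const "fls_const \<alpha> + fls_X ^ n" y by fact
  have sub: "fls_subdegree (L.ev1 p) = int n * int (Polynomial.order \<alpha> (closure_poly p))" if "p \<noteq> 0" for p
    by (rule finite_model_nz[OF that])
  have "Polynomial.order \<alpha> (closure_poly D) \<noteq> 0"
    using D by (metis closure_poly_eq_0_iff order_root)
  then have "fls_subdegree (L.ev1 D) \<noteq> 0" using n_pos by (simp add: sub[OF D(1)])
  then obtain e v where ev: "e > 0" "v \<in> places n f" "\<And>h. h \<in> K \<Longrightarrow> h \<noteq> 0 \<Longrightarrow> L.ff_val h = e * v h"
    using L.place_exists[OF D(1)] by metis
  interpret place n f v by (rule placeI[OF ev(2)])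
  have "e * v ff_x = L.ff_val (F.ev1 [:0, 1:])"
    using ev(3)[OF K_x ff_x_nz] by (simp add: poly_at_x[OF is_hom_ff_const])
  also have "\<dots> \<ge> 0" by (subst L.ff_val_ev1) (simp_all add: sub)
  finally have "\<not> v ff_x < 0" using ev(1) by (simp add: zero_le_mult_iff)
  then have "0 \<le> v h" using h ev(2) by (auto simp: RR_space_def D_inf_def)
  then show ?thesis using ev(1) ev(3)[of h] h by (simp add: RR_space_def)
qed

text \<open>
  The factor between the order in \<open>t\<close> and the place is found by comparing their values at \<open>x\<close>, which are
  \<open>- n\<close> and \<open>- (n / c)\<close>.
\<close>

lemma RR_space_infinite_bound:
  assumes h: "h \<in> RR_space n f (inf_div s)" "h \<noteq> 0"
    and L: "laurent_model n f fls_of_const (fls_X_inv ^ n) y"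
  shows "- int (gcd n (degree f) * s) \<le> laurent_model.ff_val n f fls_of_const (fls_X_inv ^ n) y h"
proof -
  interpret L: laurent_model n f fls_of_const "fls_X_inv ^ n" y by fact
  let ?X = "[:0, 1:] :: 'a poly"
  have sub: "fls_subdegree (L.ev1 ?X) = - int n"
    using infinite_model_nz(2)[of ?X] by simp
  obtain e v where ev: "e > 0" "v \<in> places n f" "\<And>h. h \<in> K \<Longrightarrow> h \<noteq> 0 \<Longrightarrow> L.ff_val h = e * v h"
    using L.place_exists[of ?X] sub n_pos by auto
  interpret place n f v by (rule placeI[OF ev(2)])
  have "e * v ff_x = L.ff_val (F.ev1 ?X)"
    using ev(3)[OF K_x ff_x_nz] by (simp add: poly_at_x[OF is_hom_ff_const])
  also have "\<dots> = - int n" by (subst L.ff_val_ev1) (simp_all only: sub, simp_all)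
  finally have ex: "e * v ff_x = - int n" .
  then have pole: "v ff_x < 0" using ev(1) n_pos
    by (metis neg_0_less_iff_less neg_less_0_iff_less of_nat_0_less_iff mult_less_0_iff not_less_iff_gr_or_eq)
  let ?c = "gcd n (degree f)"
  have "e * int (n div ?c) = int n" using ex pole_orders(1)[OF pole] by simp
  also have "int n = int ?c * int (n div ?c)" by (simp flip: of_nat_mult)
  finally have "e = int ?c" using n_pos by (auto simp: dvd_div_eq_0_iff)
  moreover have "- int s \<le> v h" using h ev(2) pole by (auto simp: RR_space_def D_inf_def)
  then have "e * (- int s) \<le> e * v h" using ev(1) by (intro mult_left_mono) auto
  ultimately show ?thesis using ev(3)[of h] h by (simp add: RR_space_def)
qed

text \<open>
  Let \<open>h\<close> be in the space, with terms \<open>(r\<^sub>j / D) y\<^sup>j\<close>.  By averaging over the conjugates each term satisfies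
  the bounds separately.  At a root of \<open>D\<close> the order of \<open>y\<^sup>j\<close> in \<open>t\<close> is less than \<open>n\<close>, as \<open>f\<close> has simple
  roots, and it cannot compensate for a pole of \<open>r\<^sub>j / D\<close>, whose order in \<open>t\<close> is a multiple of \<open>n\<close>.  So \<open>D\<close> divides \<open>r\<^sub>j\<close>, and the
  bound at infinity limits the degree of the quotient.
\<close>

theorem RR_space_eq:
  "RR_space n f (inf_div s) = poly_fun ` polys_below n (degree f) (gcd n (degree f) * s)"
proof (intro equalityI subsetI)
  fix h assume h: "h \<in> RR_space n f (inf_div s)"
  let ?w = "gcd n (degree f) * s"
  show "h \<in> poly_fun ` polys_below n (degree f) ?w"
  proof (cases "h = 0")
    case True
    then have "h = poly_fun (\<lambda>_. 0)" by (simp add: poly_fun_def)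
    moreover have "(\<lambda>_. 0) \<in> polys_below n (degree f) ?w" by (simp add: polys_below_def)
    ultimately show ?thesis by blast
  next
    case False
    have "h \<in> K" using h by (simp add: RR_space_def)
    then obtain u D where "D \<noteq> 0" "h * F.ev1 D = F.ev2 u" using in_K_iff by blast
    moreover obtain r where "F.ev2 u = F.ev2 r" "degree r < n" by (rule F.reduce)
    ultimately have rD: "D \<noteq> 0" "h * F.ev1 D = F.ev2 r" "degree r < n" by auto
    have dvd: "D dvd coeff r j" if j: "j < n" for j
    proof (cases "coeff r j = 0")
      case False
      have "closure_poly D dvd closure_poly (coeff r j)"
      proof (rule dvd_of_order_le)
        fix \<alpha> assume \<alpha>: "poly (closure_poly D) \<alpha> = 0"
        obtain y where L: "laurent_model n f fls_of_const (fls_const \<alpha> + fls_X ^ n) y"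
          by (rule finite_model_exists)
        interpret L: laurent_model n f fls_of_const "fls_const \<alpha> + fls_X ^ n" y by (rule L)
        have "L.low (0 + fls_subdegree (L.ev1 D)) (L.ev1 (coeff r j) * y ^ j)"
        proof (rule L.terms_low_of_twists[OF \<open>h \<noteq> 0\<close> rD _ j])
          fix z :: 'a assume "z ^ n = 1"
          then have "kummer n f fls_of_const (fls_const \<alpha> + fls_X ^ n) (fls_of_const z * y)"
            by (rule L.kummer_twist)
          then have "laurent_model n f fls_of_const (fls_const \<alpha> + fls_X ^ n) (fls_of_const z * y)"
            by (simp add: laurent_model_def laurent_model_axioms_def L.subdegree_const)
          then show "0 \<le> laurent_model.ff_val n f fls_of_const (fls_const \<alpha> + fls_X ^ n) (fls_of_const z * y) h"
            by (rule RR_space_finite_bound[OF h \<open>h \<noteq> 0\<close> _ rD(1) \<alpha>])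
        qed
        moreover have "L.ev1 (coeff r j) \<noteq> 0" using False by (simp add: L.ev1_eq_0_iff)
        ultimately have "int n * int (Polynomial.order \<alpha> (closure_poly D))
            \<le> int n * int (Polynomial.order \<alpha> (closure_poly (coeff r j)))
              + int j * int (Polynomial.order \<alpha> (closure_poly f))"
          using L.y_nz by (simp add: L.low_def fls_subdegree_pow finite_model_nz(2)[OF rD(1)]
              finite_model_nz(2)[OF False] subdegree_y_finite[OF L])
        moreover have "int j * int (Polynomial.order \<alpha> (closure_poly f)) \<le> int j * 1"
          using order_separable_le_1[OF separable f_nz, of \<alpha>] by (intro mult_left_mono) auto
        ultimately have "int n * int (Polynomial.order \<alpha> (closure_poly D))
            < int n * int (Polynomial.order \<alpha> (closure_poly (coeff r j))) + int n * 1"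
          using j by linarith
        then have "int n * int (Polynomial.order \<alpha> (closure_poly D))
            < int n * (int (Polynomial.order \<alpha> (closure_poly (coeff r j))) + 1)"
          by (simp only: distrib_left)
        then show "Polynomial.order \<alpha> (closure_poly D) \<le> Polynomial.order \<alpha> (closure_poly (coeff r j))"
          using n_pos by simp
      qed (use rD(1) False in \<open>simp_all add: closure_poly_eq_0_iff\<close>)
      then show ?thesis by (rule closure_poly_dvd_iff)
    qed simp
    define U where "U j = (if j < n then coeff r j div D else 0)" for j
    have U: "coeff r j = D * U j" if "j < n" for j using dvd[OF that] that by (simp add: U_def)
    have "poly_fun U * F.ev1 D = F.ev2 r"
      unfolding F.ev2_sum[OF rD(3)] poly_fun_def
      by (simp add: sum_distrib_left U hom_mult[OF F.hom_ev1] mult_ac)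
    then have hU: "h = poly_fun U" using rD F.ev1_eq_0_iff[of D] by (metis mult_right_cancel)
    have "U \<in> polys_below n (degree f) ?w"
    proof -
      obtain y where L: "laurent_model n f fls_of_const (fls_X_inv ^ n) y"
        by (rule infinite_model_exists)
      interpret L: laurent_model n f fls_of_const "fls_X_inv ^ n" y by (rule L)
      have "U j \<in> bounded_polys (xcount n (degree f) ?w j)" if j: "j < n" for j
      proof (cases "U j = 0")
        case False
        have "L.low (- int ?w + fls_subdegree (L.ev1 D)) (L.ev1 (coeff r j) * y ^ j)"
        proof (rule L.terms_low_of_twists[OF \<open>h \<noteq> 0\<close> rD _ j])
          fix z :: 'a assume "z ^ n = 1"
          then have "kummer n f fls_of_const (fls_X_inv ^ n) (fls_of_const z * y)"
            by (rule L.kummer_twist)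
          then have "laurent_model n f fls_of_const (fls_X_inv ^ n) (fls_of_const z * y)"
            by (simp add: laurent_model_def laurent_model_axioms_def L.subdegree_const)
          then show "- int ?w \<le> laurent_model.ff_val n f fls_of_const (fls_X_inv ^ n) (fls_of_const z * y) h"
            by (rule RR_space_infinite_bound[OF h \<open>h \<noteq> 0\<close>])
        qed
        moreover have nz: "coeff r j \<noteq> 0" using False rD(1) U[OF j] by simp
        then have "L.ev1 (coeff r j) \<noteq> 0" by (simp add: L.ev1_eq_0_iff)
        ultimately have "- int ?w - int n * int (degree D)
            \<le> - int n * int (degree (coeff r j)) - int j * int (degree f)"
          using L.y_nz by (simp add: L.low_def fls_subdegree_pow infinite_model_nz(2)[OF rD(1)]
              infinite_model_nz(2)[OF nz] subdegree_y_infinite[OF L])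
        also have "degree (coeff r j) = degree D + degree (U j)"
          using False rD(1) by (simp add: U[OF j] degree_mult_eq)
        finally have "int n * int (degree (U j)) + int (degree f) * int j \<le> int ?w"
          by (simp add: algebra_simps)
        then have "n * degree (U j) + degree f * j \<le> ?w"
          by (simp only: of_nat_mult[symmetric] of_nat_add[symmetric] of_nat_le_iff)
        then show ?thesis by (simp add: bounded_polys_iff less_xcount_iff n_pos)
      qed simp
      then show ?thesis by (simp add: polys_below_def) (simp add: U_def)
    qed
    then show ?thesis using hU by blast
  qed
next
  fix h assume "h \<in> poly_fun ` polys_below n (degree f) (gcd n (degree f) * s)"
  then show "h \<in> RR_space n f (inf_div s)" using poly_fun_in_RR_space by blast
qed

lemma poly_fun_zero:
  assumes "poly_fun U = 0" "j < n"
  shows "U j = 0"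
proof -
  define r where "r = (\<Sum>i<n. monom (U i) i)"
  have c: "coeff r i = (if i < n then U i else 0)" for i
    by (simp add: r_def coeff_sum)
  have "degree r \<le> n - 1" by (rule degree_le) (auto simp: c)
  then have deg: "degree r < n" using n_pos by simp
  have "F.ev2 r = poly_fun U" unfolding F.ev2_sum[OF deg] poly_fun_def by (simp add: c)
  then have "r = 0" using assms(1) deg F.lin_indep by simp
  then show ?thesis using c[of j] assms(2) by simp
qed

lemma poly_fun_add: "poly_fun U + poly_fun V = poly_fun (\<lambda>j. U j + V j)"
  by (simp add: poly_fun_def hom_add[OF F.hom_ev1] distrib_right sum.distrib)

lemma poly_fun_diff: "poly_fun U - poly_fun V = poly_fun (\<lambda>j. U j - V j)"
  by (simp add: poly_fun_def hom_diff[OF F.hom_ev1] left_diff_distrib sum_subtractf)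

lemma poly_fun_scale: "ff_const a * poly_fun U = poly_fun (\<lambda>j. smult a (U j))"
proof -
  have "F.ev1 (smult a p) = ff_const a * F.ev1 p" for p
    using hom_mult[OF F.hom_ev1, of "[:a:]" p] by (simp add: poly_at_const[OF is_hom_ff_const])
  then show ?thesis by (simp add: poly_fun_def sum_distrib_left mult_ac)
qed

lemma polys_below_add: "U \<in> polys_below n d w \<Longrightarrow> V \<in> polys_below n d w \<Longrightarrow> (\<lambda>j. U j + V j) \<in> polys_below n d w"
  by (auto simp: polys_below_def bounded_polys_add)

lemma polys_below_smult: "U \<in> polys_below n d w \<Longrightarrow> (\<lambda>j. smult a (U j)) \<in> polys_below n d w"
  by (auto simp: polys_below_def bounded_polys_smult)

lemma card_RR_space:
  "finite (RR_space n f (inf_div s))"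
  "card (RR_space n f (inf_div s)) = CARD('a) ^ (\<Sum>j<n. xcount n (degree f) (gcd n (degree f) * s) j)"
proof -
  let ?P = "polys_below n (degree f) (gcd n (degree f) * s) :: (nat \<Rightarrow> 'a poly) set"
  have "inj_on poly_fun ?P"
  proof
    fix U V assume UV: "U \<in> ?P" "V \<in> ?P" "poly_fun U = poly_fun V"
    then have "poly_fun (\<lambda>j. U j - V j) = 0" by (simp flip: poly_fun_diff)
    then have "U j = V j" for j
      using poly_fun_zero[of "\<lambda>j. U j - V j" j] UV by (cases "j < n") (auto simp: polys_below_def)
    then show "U = V" by blast
  qed
  then show "finite (RR_space n f (inf_div s))"
    "card (RR_space n f (inf_div s)) = CARD('a) ^ (\<Sum>j<n. xcount n (degree f) (gcd n (degree f) * s) j)"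
    unfolding RR_space_eq using card_polys_below[where 'a = 'a] by (simp_all add: card_image)
qed

lemma vector_space_ff: "vector_space (\<lambda>(a :: 'a) h. ff_const a * h)"
  by unfold_locales (simp_all add: algebra_simps hom_add[OF is_hom_ff_const] hom_mult[OF is_hom_ff_const]
      hom_1[OF is_hom_ff_const])

lemma RR_dim_eq: "RR_dim n f (inf_div s) = (\<Sum>j<n. xcount n (degree f) (gcd n (degree f) * s) j)"
proof -
  interpret V: vector_space "\<lambda>(a :: 'a) h. ff_const a * h :: 'a ffield" by (rule vector_space_ff)
  have "V.subspace (RR_space n f (inf_div s))"
  proof (rule V.subspaceI)
    show "0 \<in> RR_space n f (inf_div s)" by (simp add: RR_space_def K_0)
  qed (auto simp: RR_space_eq poly_fun_add poly_fun_scale intro: polys_below_add polys_below_smult)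
  then have "CARD('a) ^ (\<Sum>j<n. xcount n (degree f) (gcd n (degree f) * s) j)
      = CARD('a) ^ RR_dim n f (inf_div s)"
    using card_subspace[OF vector_space_ff _ card_RR_space(1)] card_RR_space(2)[of s]
    by (simp add: RR_dim_def)
  then show ?thesis using card_field_ge_2[where 'a = 'a] by (simp add: power_inject_exp)
qed

end

section \<open>The affine rational points\<close>

text \<open>
  Evaluation of a bivariate polynomial at a point of the plane; the outer variable is \<open>y\<close>.
\<close>

definition value_at :: "'a :: comm_ring_1 \<Rightarrow> 'a \<Rightarrow> 'a poly poly \<Rightarrow> 'a" where
  "value_at a b = poly_at (\<lambda>p. poly p a) b"

lemma is_hom_poly_eval: "is_hom (\<lambda>p. poly p a)"
  by (simp add: is_hom_def)

lemma is_hom_value_at: "is_hom (value_at a b)"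
  unfolding value_at_def by (rule is_hom_poly_at[OF is_hom_poly_eval])

lemma value_at_const: "value_at a b [:p:] = poly p a"
  by (simp add: value_at_def poly_at_const[OF is_hom_poly_eval])

lemma value_at_y: "value_at a b [:0, 1:] = b"
  by (simp add: value_at_def poly_at_x[OF is_hom_poly_eval])

context place begin

lemma val_ring_iff: "h \<in> val_ring n f v \<longleftrightarrow> at_least 0 h"
  by (simp add: val_ring_def at_least_def)

lemma val_ideal_iff: "h \<in> val_ideal n f v \<longleftrightarrow> at_least 1 h"
  by (auto simp: val_ideal_def at_least_def)

definition has_residue :: "'a ffield \<Rightarrow> 'a \<Rightarrow> bool" where
  "has_residue h a \<longleftrightarrow> at_least 1 (h - ff_const a)"

lemma has_residue_at_least: "has_residue h a \<Longrightarrow> at_least 0 h"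
  using at_least_add[OF at_least_mono[of 1 "h - ff_const a" 0] at_least_const[of a]]
  by (simp add: has_residue_def)

lemma has_residue_const: "has_residue (ff_const a) a"
  by (simp add: has_residue_def at_least_0)

lemma has_residue_unique:
  assumes "has_residue h a" "has_residue h b" shows "a = b"
proof -
  have "at_least 1 (ff_const (b - a))"
    using at_least_diff[OF assms[unfolded has_residue_def]] by (simp add: hom_diff[OF is_hom_ff_const])
  then show ?thesis by (simp add: at_least_1_const_iff)
qed

lemma has_residue_add: "has_residue g a \<Longrightarrow> has_residue h b \<Longrightarrow> has_residue (g + h) (a + b)"
  using at_least_add[of 1 "g - ff_const a" "h - ff_const b"]
  by (simp add: has_residue_def hom_add[OF is_hom_ff_const] add_diff_add)

lemma has_residue_mult:
  assumes "has_residue g a" "has_residue h b" shows "has_residue (g * h) (a * b)"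
proof -
  have "at_least 1 ((g - ff_const a) * h + (h - ff_const b) * ff_const a)"
    using assms by (intro at_least_add at_least_mult_0 at_least_const has_residue_at_least[OF assms(2)])
      (simp_all add: has_residue_def)
  moreover have "(g - ff_const a) * h + (h - ff_const b) * ff_const a = g * h - ff_const (a * b)"
    by (simp add: hom_mult[OF is_hom_ff_const] algebra_simps)
  ultimately show ?thesis by (simp add: has_residue_def)
qed

lemma has_residue_power: "has_residue g a \<Longrightarrow> has_residue (g ^ k) (a ^ k)"
  using has_residue_const[of 1] by (induction k) (auto simp: hom_1[OF is_hom_ff_const] intro: has_residue_mult)

lemma has_residue_sum: "(\<And>i. i \<in> S \<Longrightarrow> has_residue (g i) (c i)) \<Longrightarrow> has_residue (\<Sum>i\<in>S. g i) (\<Sum>i\<in>S. c i)"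
  using has_residue_const[of 0]
  by (induction S rule: infinite_finite_induct) (auto simp: hom_0[OF is_hom_ff_const] intro: has_residue_add)

lemma has_residue_ev1:
  assumes "has_residue ff_x a" shows "has_residue (F.ev1 p) (poly p a)"
proof (induction p)
  case 0
  show ?case using has_residue_const[of 0] by (simp add: hom_0[OF is_hom_ff_const])
next
  case (pCons c p)
  then show ?case
    by (simp add: poly_at_pCons is_hom_ff_const)
      (intro has_residue_add has_residue_mult has_residue_const assms)
qed

lemma has_residue_ev2:
  assumes "has_residue ff_x a" "has_residue (ff_y n f) b"
  shows "has_residue (F.ev2 u) (value_at a b u)"
proof (induction u)
  case 0
  show ?case using has_residue_const[of 0]
    by (simp add: hom_0[OF is_hom_ff_const] hom_0[OF F.hom_ev2] hom_0[OF is_hom_value_at])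
next
  case (pCons c p)
  then show ?case
    unfolding F.ev2_def value_at_def poly_at_pCons[OF F.hom_ev1] poly_at_pCons[OF is_hom_poly_eval]
    by (intro has_residue_add has_residue_mult has_residue_ev1 assms)
qed

lemma has_residue_nonzero: "has_residue h a \<Longrightarrow> a \<noteq> 0 \<Longrightarrow> h \<noteq> 0 \<and> v h = 0"
  using has_residue_at_least[of h a] at_least_diff[of 1 h "h - ff_const a"] at_least_0[of 1]
  by (auto simp: has_residue_def at_least_1_const_iff) (force simp: at_least_def at_least_1_const_iff)

lemma has_residue_0_iff: "has_residue h 0 \<longleftrightarrow> at_least 1 h"
  by (simp add: has_residue_def hom_0[OF is_hom_ff_const])

lemma eval_at_eq: "has_residue h a \<Longrightarrow> eval_at n f v h = a"
  unfolding eval_at_def val_ideal_iff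
  by (rule the_equality) (auto simp: has_residue_def[symmetric] intro: has_residue_unique)

lemma has_residue_poly_fun:
  assumes "has_residue ff_x a" "has_residue (ff_y n f) b"
  shows "has_residue (poly_fun U) (\<Sum>j<n. poly (U j) a * b ^ j)"
  unfolding poly_fun_def
  by (intro has_residue_sum has_residue_mult has_residue_power has_residue_ev1 assms)

end

text \<open>
  The place lies over the point \<open>(a, b)\<close> of the affine plane, which is then on the curve.
\<close>

locale centred_place = place n f v for n and f :: "'a :: {finite, field} poly" and v +
  fixes a b :: 'a
  assumes residue_x: "has_residue ff_x a" and residue_y: "has_residue (ff_y n f) b"
begin

lemma residue_ev2: "has_residue (F.ev2 u) (value_at a b u)"
  by (rule has_residue_ev2[OF residue_x residue_y])

lemma on_curve: "b ^ n = poly f a"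
proof (rule has_residue_unique)
  show "has_residue (F.ev1 f) (b ^ n)"
    using has_residue_power[OF residue_y, of n] by (simp add: F.y_power)
  show "has_residue (F.ev1 f) (poly f a)" by (rule has_residue_ev1[OF residue_x])
qed

lemma b_nz: "b \<noteq> 0"
proof
  assume "b = 0"
  then show False using on_curve no_root[of a] n_pos by (simp add: zero_power)
qed

lemma ff_x_minus: "F.ev2 [:[:- a, 1:]:] = ff_x - ff_const a"
  by (simp add: F.ev2_const poly_at_pCons is_hom_ff_const hom_uminus[OF is_hom_ff_const] hom_1[OF is_hom_ff_const])

lemma x_minus_nz: "ff_x - ff_const a \<noteq> 0"
  using F.ev1_eq_0_iff[of "[:- a, 1:]"] by (simp flip: ff_x_minus add: F.ev2_const)

lemma x_minus_K: "ff_x - ff_const a \<in> K"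
  by (intro K_intros)

lemma v_x_minus: "v (ff_x - ff_const a) \<ge> 1"
  using residue_x x_minus_nz by (simp add: has_residue_def at_least_def)

text \<open>
  The tangent line at \<open>(a, b)\<close> is not vertical: with \<open>S = (y\<^sup>n - b\<^sup>n) / (y - b)\<close> one has
  \<open>S (y - b) = f(x) - f(a)\<close>, a multiple of \<open>x - a\<close>, and \<open>S\<close> takes the nonzero value \<open>n b\<^sup>n\<^sup>-\<^sup>1\<close> at the point.  Hence \<open>S u\<close> is
  a multiple of \<open>x - a\<close> for every polynomial \<open>u\<close> vanishing at the point.
\<close>

lemma cofactor:
  obtains S where "value_at a b S \<noteq> 0"
    "\<And>u. value_at a b u = 0 \<Longrightarrow> \<exists>u'. F.ev2 S * F.ev2 u = (ff_x - ff_const a) * F.ev2 u'"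
proof -
  let ?Y = "[:0, 1:] :: 'a poly poly" and ?b = "[:[:b:]:] :: 'a poly poly"
  define S where "S = (\<Sum>i<n. ?b ^ (n - Suc i) * ?Y ^ i)"
  have evb: "F.ev2 ?b = ff_const b" by (simp add: F.ev2_const poly_at_const[OF is_hom_ff_const])
  have evY: "F.ev2 ?Y = ff_y n f" by (simp add: F.ev2_def poly_at_x[OF F.hom_ev1])
  have "value_at a b S = (\<Sum>i<n. b ^ (n - Suc i) * b ^ i)"
    by (simp only: S_def hom_sum[OF is_hom_value_at] hom_mult[OF is_hom_value_at] hom_power[OF is_hom_value_at]
        value_at_const value_at_y) simp
  also have "\<dots> = (\<Sum>i<n. b ^ (n - 1))"
    by (intro sum.cong refl) (simp flip: power_add)
  also have "\<dots> \<noteq> 0" using of_nat_n b_nz by simp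
  finally have S: "value_at a b S \<noteq> 0" .
  obtain f2 where f2: "f = [:- a, 1:] * f2 + [:poly f a:]" using synthetic_div_correct'[of a f] by metis
  have "(ff_y n f - ff_const b) * F.ev2 S = ff_y n f ^ n - ff_const b ^ n"
    unfolding power_diff_sumr2 S_def
    by (simp only: hom_sum[OF F.hom_ev2] hom_mult[OF F.hom_ev2] hom_power[OF F.hom_ev2] evb evY)
  also have "\<dots> = F.ev1 f - ff_const (poly f a)"
    by (simp add: F.y_power on_curve flip: hom_power[OF is_hom_ff_const])
  also have "\<dots> = (ff_x - ff_const a) * F.ev1 f2"
    unfolding ff_x_minus[symmetric] F.ev2_const
    by (subst f2) (simp add: hom_add[OF F.hom_ev1] hom_mult[OF F.hom_ev1] poly_at_const[OF is_hom_ff_const]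
        del: mult_pCons_left)
  finally have yb: "(ff_y n f - ff_const b) * F.ev2 S = (ff_x - ff_const a) * F.ev1 f2" .
  have "\<exists>u'. F.ev2 S * F.ev2 u = (ff_x - ff_const a) * F.ev2 u'" if u: "value_at a b u = 0" for u
  proof -
    define u2 p where "u2 = synthetic_div u [:b:]" and "p = poly u [:b:]"
    have dec: "u = [:- [:b:], 1:] * u2 + [:p:]"
      unfolding u2_def p_def by (rule synthetic_div_correct'[symmetric])
    have Yb: "[:- [:b:], 1:] = ?Y - ?b" by simp
    have "value_at a b u = poly p a"
      unfolding dec Yb hom_add[OF is_hom_value_at] hom_mult[OF is_hom_value_at] hom_diff[OF is_hom_value_at]
        value_at_const value_at_y by simp
    then have "poly p a = 0" using u by simp
    then obtain p1 where p1: "p = [:- a, 1:] * p1" by (metis dvdE poly_eq_0_iff_dvd)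
    have "F.ev2 S * F.ev2 u = (ff_y n f - ff_const b) * F.ev2 S * F.ev2 u2 + F.ev2 S * F.ev1 p"
      unfolding dec Yb hom_add[OF F.hom_ev2] hom_mult[OF F.hom_ev2] hom_diff[OF F.hom_ev2] evb evY F.ev2_const
      by (simp add: poly_at_const[OF is_hom_ff_const] algebra_simps)
    also have "F.ev1 p = (ff_x - ff_const a) * F.ev1 p1"
      unfolding ff_x_minus[symmetric] F.ev2_const p1 hom_mult[OF F.hom_ev1] ..
    also have "(ff_y n f - ff_const b) * F.ev2 S * F.ev2 u2 + F.ev2 S * ((ff_x - ff_const a) * F.ev1 p1)
        = (ff_x - ff_const a) * F.ev2 ([:f2:] * u2 + S * [:p1:])"
      unfolding yb hom_add[OF F.hom_ev2] hom_mult[OF F.hom_ev2] F.ev2_const by (simp add: algebra_simps)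
    finally show ?thesis by blast
  qed
  then show ?thesis using that S by blast
qed

text \<open>
  Splitting off factors \<open>x - a\<close> by \<open>cofactor\<close> stops because each step lowers the value.  The resulting data \<open>k\<close>, \<open>S\<close>,
  \<open>u'\<close> do not refer to the place, so they determine the value of \<open>u\<close> at every place over \<open>(a, b)\<close>.
\<close>

lemma expansion:
  assumes "F.ev2 u \<noteq> 0"
  obtains k S u' where "value_at a b S \<noteq> 0" "value_at a b u' \<noteq> 0"
    "F.ev2 S * F.ev2 u = (ff_x - ff_const a) ^ k * F.ev2 u'"
proof -
  obtain S0 where S0: "value_at a b S0 \<noteq> 0"
    "\<And>u. value_at a b u = 0 \<Longrightarrow> \<exists>u'. F.ev2 S0 * F.ev2 u = (ff_x - ff_const a) * F.ev2 u'"
    by (rule cofactor) blast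
  have S0v: "F.ev2 S0 \<noteq> 0" "v (F.ev2 S0) = 0" using has_residue_nonzero[OF residue_ev2 S0(1)] by auto
  have "\<exists>k S u'. value_at a b S \<noteq> 0 \<and> value_at a b u' \<noteq> 0 \<and>
      F.ev2 S * F.ev2 u = (ff_x - ff_const a) ^ k * F.ev2 u'"
    using assms
  proof (induction "nat (v (F.ev2 u))" arbitrary: u rule: less_induct)
    case less
    show ?case
    proof (cases "value_at a b u = 0")
      case False
      then show ?thesis
        by (intro exI[of _ 0] exI[of _ 1] exI[of _ u])
          (simp add: hom_1[OF is_hom_value_at] hom_1[OF F.hom_ev2])
    next
      case True
      then obtain u1 where u1: "F.ev2 S0 * F.ev2 u = (ff_x - ff_const a) * F.ev2 u1" using S0(2) by blast
      have nz: "F.ev2 u1 \<noteq> 0" using u1 S0v less.prems by auto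
      have "v (F.ev2 u) = v (F.ev2 S0 * F.ev2 u)" using S0v less.prems by (simp add: v_mult K_ev2)
      also have "\<dots> = v (ff_x - ff_const a) + v (F.ev2 u1)"
        unfolding u1 by (intro v_mult x_minus_K K_ev2 x_minus_nz nz)
      finally have vu: "v (F.ev2 u) = v (ff_x - ff_const a) + v (F.ev2 u1)" .
      have "at_least 0 (F.ev2 u1)" using has_residue_at_least[OF residue_ev2] .
      then have "v (F.ev2 u1) \<ge> 0" using nz by (simp add: at_least_def)
      then have "nat (v (F.ev2 u1)) < nat (v (F.ev2 u))" using vu v_x_minus by simp
      then obtain k S u' where IH: "value_at a b S \<noteq> 0" "value_at a b u' \<noteq> 0"
        "F.ev2 S * F.ev2 u1 = (ff_x - ff_const a) ^ k * F.ev2 u'" using less.hyps nz by blast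
      have "F.ev2 (S * S0) * F.ev2 u = (ff_x - ff_const a) * (F.ev2 S * F.ev2 u1)"
        unfolding hom_mult[OF F.hom_ev2] mult.assoc u1 by (simp add: mult_ac)
      also have "\<dots> = (ff_x - ff_const a) ^ Suc k * F.ev2 u'" by (simp add: IH(3))
      finally show ?thesis
        using IH S0(1) by (intro exI[of _ "Suc k"] exI[of _ "S * S0"] exI[of _ u'])
          (simp add: hom_mult[OF is_hom_value_at])
    qed
  qed
  then show ?thesis using that by blast
qed

lemma v_of_expansion:
  assumes "value_at a b S \<noteq> 0" "value_at a b u' \<noteq> 0"
    "F.ev2 S * F.ev2 u = (ff_x - ff_const a) ^ k * F.ev2 u'" "F.ev2 u \<noteq> 0"
  shows "v (F.ev2 u) = int k * v (ff_x - ff_const a)"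
proof -
  have 1: "F.ev2 S \<noteq> 0" "v (F.ev2 S) = 0" "F.ev2 u' \<noteq> 0" "v (F.ev2 u') = 0"
    using has_residue_nonzero[OF residue_ev2 assms(1)] has_residue_nonzero[OF residue_ev2 assms(2)] by auto
  have "v (F.ev2 u) = v (F.ev2 S * F.ev2 u)" using 1 assms(4) by (simp add: v_mult K_ev2)
  also have "\<dots> = int k * v (ff_x - ff_const a)"
    unfolding assms(3) using 1 x_minus_nz by (simp add: v_mult v_power K_power K_ev2 x_minus_K)
  finally show ?thesis .
qed

text \<open>
  All values are multiples of \<open>v (x - a)\<close>, and \<open>1\<close> is a value.
\<close>

lemma v_x_minus_eq_1: "v (ff_x - ff_const a) = 1"
proof -
  let ?t = "v (ff_x - ff_const a)"
  have dvd: "?t dvd v (F.ev2 u)" if "F.ev2 u \<noteq> 0" for u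
    using expansion[OF that] v_of_expansion[OF _ _ _ that] by (metis dvd_triv_right)
  obtain h where h: "h \<in> K" "h \<noteq> 0" "v h = 1" by (rule v_1_attained)
  obtain r D where rD: "D \<noteq> 0" "h * F.ev1 D = F.ev2 r" using h(1) in_K_iff by blast
  have Dnz: "F.ev1 D \<noteq> 0" using rD(1) by (simp add: F.ev1_eq_0_iff)
  have "?t dvd v (F.ev2 r)" by (rule dvd) (use rD h Dnz in \<open>auto simp flip: rD(2)\<close>)
  moreover have "?t dvd v (F.ev1 D)" using dvd[of "[:D:]"] Dnz by (simp add: F.ev2_const)
  moreover have "v (F.ev2 r) = 1 + v (F.ev1 D)"
    using h Dnz by (simp add: v_mult K_ev1 flip: rD(2))
  ultimately have "?t dvd 1" by (simp add: dvd_add_left_iff)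
  then show ?thesis using v_x_minus by (simp add: zdvd1_eq)
qed

text \<open>
  A quotient of two expansions is a power of \<open>x - a\<close> times a quotient of polynomials that do not vanish
  at \<open>(a, b)\<close>, so its residue is a constant.
\<close>

lemma rational: "rational_place n f v"
proof -
  have "\<exists>c. has_residue h c" if h: "at_least 0 h" for h
  proof (cases "h = 0")
    case True
    then show ?thesis using has_residue_const[of 0] by (auto simp: hom_0[OF is_hom_ff_const])
  next
    case False
    let ?t = "ff_x - ff_const a"
    have "h \<in> K" "v h \<ge> 0" using h False by (auto simp: at_least_def)
    then obtain r D where rD: "D \<noteq> 0" "h * F.ev1 D = F.ev2 r" using in_K_iff by blast
    have Dnz: "F.ev2 [:D:] \<noteq> 0" using rD(1) by (simp add: F.ev2_const F.ev1_eq_0_iff)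
    then have rnz: "F.ev2 r \<noteq> 0" using rD(2) False by (auto simp: F.ev2_const simp flip: rD(2))
    obtain k S r' where r: "value_at a b S \<noteq> 0" "value_at a b r' \<noteq> 0"
      "F.ev2 S * F.ev2 r = ?t ^ k * F.ev2 r'" by (rule expansion[OF rnz])
    obtain l T D' where D: "value_at a b T \<noteq> 0" "value_at a b D' \<noteq> 0"
      "F.ev2 T * F.ev2 [:D:] = ?t ^ l * F.ev2 D'" by (rule expansion[OF Dnz])
    have "v (F.ev2 r) = v h + v (F.ev2 [:D:])"
      using False Dnz \<open>h \<in> K\<close> by (simp add: F.ev2_const v_mult K_ev1 flip: rD(2))
    then have "int l \<le> int k"
      using v_of_expansion[OF r rnz] v_of_expansion[OF D Dnz] \<open>v h \<ge> 0\<close> v_x_minus_eq_1 by simp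
    then have "l \<le> k" by simp
    have "?t ^ l * (h * F.ev2 (D' * S)) = h * F.ev1 D * F.ev2 S * F.ev2 T"
      using D(3) by (simp add: hom_mult[OF F.hom_ev2] F.ev2_const mult_ac)
    also have "\<dots> = ?t ^ k * (F.ev2 (r' * T))"
      using r(3) by (simp add: rD(2) hom_mult[OF F.hom_ev2] mult_ac)
    also have "?t ^ k = ?t ^ l * ?t ^ (k - l)" using \<open>l \<le> k\<close> by (simp flip: power_add)
    finally have eq: "h * F.ev2 (D' * S) = F.ev2 ([:[:- a, 1:]:] ^ (k - l) * (r' * T))"
      using x_minus_nz by (simp only: hom_mult[OF F.hom_ev2] hom_power[OF F.hom_ev2] ff_x_minus) simp
    let ?w = "D' * S"
    define q where "q = [:[:- a, 1:]:] ^ (k - l) * (r' * T)"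
    have w: "value_at a b ?w \<noteq> 0" using D r by (simp add: hom_mult[OF is_hom_value_at])
    note wv = has_residue_nonzero[OF residue_ev2 w]
    define c where "c = value_at a b q / value_at a b ?w"
    have "value_at a b (q - [:[:c:]:] * ?w) = 0"
      using w by (simp only: hom_diff[OF is_hom_value_at] hom_mult[OF is_hom_value_at] value_at_const)
        (simp add: c_def hom_mult[OF is_hom_value_at])
    then have "at_least 1 (F.ev2 (q - [:[:c:]:] * ?w))"
      using residue_ev2[of "q - [:[:c:]:] * ?w"] by (simp add: has_residue_0_iff)
    moreover have "F.ev2 (q - [:[:c:]:] * ?w) = (h - ff_const c) * F.ev2 ?w"
      unfolding hom_diff[OF F.hom_ev2] hom_mult[OF F.hom_ev2, of "[:[:c:]:]"] F.ev2_const
        poly_at_const[OF is_hom_ff_const] left_diff_distrib eq q_def ..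
    ultimately have "at_least 1 ((h - ff_const c) * F.ev2 ?w)" by simp
    then have "has_residue h c"
      using wv v_mult[OF K_diff[OF \<open>h \<in> K\<close> K_const] K_ev2, of c ?w] K_diff[OF \<open>h \<in> K\<close> K_const, of c]
      by (cases "h = ff_const c") (auto simp: has_residue_def at_least_def K_0)
    then show ?thesis by blast
  qed
  then show ?thesis by (simp add: rational_place_def place val_ring_iff val_ideal_iff has_residue_def)
qed

end

lemma centred_place_unique:
  assumes "centred_place n f v a b" "centred_place n f w a b"
  shows "v = w"
proof
  interpret v: centred_place n f v a b by fact
  interpret w: centred_place n f w a b by fact
  fix h
  show "v h = w h"
  proof (cases "h \<in> v.K - {0}")
    case True
    then obtain r D where rD: "D \<noteq> 0" "h * v.F.ev1 D = v.F.ev2 r" using v.in_K_iff by blast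
    have Dnz: "v.F.ev2 [:D:] \<noteq> 0" using rD(1) by (simp add: v.F.ev2_const v.F.ev1_eq_0_iff)
    have rnz: "v.F.ev2 r \<noteq> 0" using rD(2) True Dnz by (auto simp: v.F.ev2_const simp flip: rD(2))
    have same: "v (v.F.ev2 u) = w (v.F.ev2 u)" if u: "v.F.ev2 u \<noteq> 0" for u
    proof -
      obtain k S u' where e: "value_at a b S \<noteq> 0" "value_at a b u' \<noteq> 0"
        "v.F.ev2 S * v.F.ev2 u = (ff_x - ff_const a) ^ k * v.F.ev2 u'" by (rule v.expansion[OF u])
      show ?thesis
        using v.v_of_expansion[OF e u] w.v_of_expansion[OF e u] v.v_x_minus_eq_1 w.v_x_minus_eq_1 by simp
    qed
    have "v (v.F.ev2 r) = v h + v (v.F.ev2 [:D:])" "w (v.F.ev2 r) = w h + w (v.F.ev2 [:D:])"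
      using True Dnz by (simp_all add: v.F.ev2_const v.v_mult w.v_mult v.K_ev1 flip: rD(2))
    then show ?thesis using same[OF rnz] same[OF Dnz] by simp
  next
    case False
    then show ?thesis using v.v_outside w.v_outside by simp
  qed
qed

context superelliptic begin

text \<open>
  In the Laurent model with \<open>x = a + t\<^sup>n\<close> and \<open>y = b + \<dots>\<close> both \<open>x - a\<close> and \<open>y - b\<close> have positive order.
\<close>

lemma centred_place_exists:
  assumes "b ^ n = poly f a"
  obtains v where "centred_place n f v a b"
proof -
  obtain B where B: "laurent_model n f fls_of_const (fls_const (to_ac a) + fls_X ^ n) (fps_to_fls B)"
    "B $ 0 = to_ac b" by (rule rational_model_exists[OF assms])
  interpret L: laurent_model n f fls_of_const "fls_const (to_ac a) + fls_X ^ n" "fps_to_fls B" by (rule B(1))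
  let ?p = "[:- a, 1:]"
  have "L.ev1 ?p = fls_X ^ n"
    by (simp add: poly_at_pCons is_hom_fls_of_const) (simp add: fls_of_const_def)
  then have sub: "fls_subdegree (L.ev1 ?p) = int n" by simp
  obtain e v where ev: "e > 0" "v \<in> places n f" "\<And>h. h \<in> K \<Longrightarrow> h \<noteq> 0 \<Longrightarrow> L.ff_val h = e * v h"
    using L.place_exists[of ?p] sub n_pos by auto
  interpret place n f v by (rule placeI[OF ev(2)])
  have pos: "at_least 1 (F.ev2 u)" if "F.ev2 u \<noteq> 0 \<Longrightarrow> fls_subdegree (L.ev2 u) > 0" for u
  proof (cases "F.ev2 u = 0")
    case False
    have "L.ff_val (F.ev2 u) = fls_subdegree (L.ev2 u)"
      using L.ff_val_eq[of 1 "F.ev2 u" u] False by (simp add: hom_1[OF F.hom_ev1] hom_1[OF L.hom_ev1])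
    then have "0 < e * v (F.ev2 u)" using that False ev(3)[OF K_ev2 False] by simp
    then have "0 < v (F.ev2 u)" using ev(1) by (simp add: zero_less_mult_iff)
    then show ?thesis by (simp add: at_least_def K_ev2)
  qed (simp add: at_least_0)
  have "at_least 1 (F.ev2 [:?p:])" by (rule pos) (use sub n_pos in \<open>simp add: L.ev2_const\<close>)
  then have 1: "has_residue ff_x a"
    by (simp add: has_residue_def F.ev2_const poly_at_pCons is_hom_ff_const hom_uminus[OF is_hom_ff_const]
        hom_1[OF is_hom_ff_const])
  let ?u = "[:[:- b:], 1:] :: 'a poly poly"
  have ev2u: "L.ev2 ?u = fps_to_fls (B - fps_const (to_ac b))"
    by (simp add: L.ev2_def poly_at_pCons[OF L.hom_ev1] poly_at_const[OF is_hom_fls_of_const]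
        hom_1[OF L.hom_ev1] fls_of_const_def)
  have "at_least 1 (F.ev2 ?u)"
  proof (rule pos)
    assume "F.ev2 ?u \<noteq> 0"
    then have "L.ev2 ?u \<noteq> 0" by (simp only: L.ev2_eq_0_iff_ff not_False_eq_True)
    then have "B - fps_const (to_ac b) \<noteq> 0" unfolding ev2u by auto
    moreover have "(B - fps_const (to_ac b)) $ 0 = 0" by (simp add: B(2))
    ultimately have "subdegree (B - fps_const (to_ac b)) > 0"
      by (metis gr0I nth_subdegree_nonzero)
    then show "fls_subdegree (L.ev2 ?u) > 0"
      unfolding ev2u fls_subdegree_fls_to_fps by (simp only: of_nat_0_less_iff)
  qed
  then have 2: "has_residue (ff_y n f) b"
    by (simp add: has_residue_def F.ev2_def poly_at_pCons[OF F.hom_ev1] poly_at_const[OF is_hom_ff_const]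
        hom_1[OF F.hom_ev1] hom_uminus[OF is_hom_ff_const])
  have "centred_place n f v a b" by unfold_locales (rule 1, rule 2)
  then show ?thesis using that by blast
qed

lemma affine_point_centred:
  assumes "P \<in> affine_points n f"
  shows "centred_place n f P (eval_at n f P ff_x) (eval_at n f P (ff_y n f))"
proof -
  have P: "rational_place n f P" "ff_x \<in> val_ring n f P" using assms by (auto simp: affine_points_def)
  interpret place n f P by (rule placeI) (use P in \<open>simp add: rational_place_def\<close>)
  have res: "\<exists>c. has_residue h c" if "at_least 0 h" for h
    using P(1) that by (simp add: rational_place_def val_ring_iff val_ideal_iff has_residue_def)
  have x: "at_least 0 ff_x" using P(2) by (simp add: val_ring_iff)
  obtain a where a: "has_residue ff_x a" using res[OF x] by blast
  obtain b where b: "has_residue (ff_y n f) b" using res[OF at_least_y[OF x]] by blast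
  show ?thesis by unfold_locales (simp_all add: eval_at_eq[OF a] eval_at_eq[OF b] a b)
qed

lemma bij_betw_affine_points:
  "bij_betw (\<lambda>P. (eval_at n f P ff_x, eval_at n f P (ff_y n f))) (affine_points n f)
     {(a, b). b ^ n = poly f a}"
proof (rule bij_betw_imageI)
  show "inj_on (\<lambda>P. (eval_at n f P ff_x, eval_at n f P (ff_y n f))) (affine_points n f)"
  proof
    fix P Q assume PQ: "P \<in> affine_points n f" "Q \<in> affine_points n f"
      "(eval_at n f P ff_x, eval_at n f P (ff_y n f)) = (eval_at n f Q ff_x, eval_at n f Q (ff_y n f))"
    then show "P = Q"
      using affine_point_centred[OF PQ(1)] affine_point_centred[OF PQ(2)] centred_place_unique by simp
  qed
  show "(\<lambda>P. (eval_at n f P ff_x, eval_at n f P (ff_y n f))) ` affine_points n f = {(a, b). b ^ n = poly f a}"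
  proof safe
    fix P assume "P \<in> affine_points n f"
    then show "eval_at n f P (ff_y n f) ^ n = poly f (eval_at n f P ff_x)"
      using centred_place.on_curve[OF affine_point_centred] by blast
  next
    fix a b assume "b ^ n = poly f a"
    then obtain v where "centred_place n f v a b" by (rule centred_place_exists)
    then interpret centred_place n f v a b .
    have "v \<in> affine_points n f"
      using rational has_residue_at_least[OF residue_x] by (simp add: affine_points_def val_ring_iff)
    moreover have "(a, b) = (eval_at n f v ff_x, eval_at n f v (ff_y n f))"
      by (simp add: eval_at_eq[OF residue_x] eval_at_eq[OF residue_y])
    ultimately show "(a, b) \<in> (\<lambda>P. (eval_at n f P ff_x, eval_at n f P (ff_y n f))) ` affine_points n f"
      by blast
  qed
qed

lemma eval_at_poly_fun:
  assumes "P \<in> affine_points n f"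
  shows "eval_at n f P (poly_fun U)
    = (\<Sum>j<n. poly (U j) (eval_at n f P ff_x) * eval_at n f P (ff_y n f) ^ j)"
proof -
  interpret centred_place n f P "eval_at n f P ff_x" "eval_at n f P (ff_y n f)"
    by (rule affine_point_centred[OF assms])
  show ?thesis by (rule eval_at_eq[OF has_residue_poly_fun[OF residue_x residue_y]])
qed

end

section \<open>Hull dimensions of the codes\<close>

lemma vector_space_words: "vector_space (\<lambda>(\<alpha> :: 'a :: field) (u :: 'i \<Rightarrow> 'a) i. \<alpha> * u i)"
  by unfold_locales (auto simp: fun_eq_iff algebra_simps)

text \<open>
  Some multiple of \<open>k\<close> is congruent to \<open>1\<close> modulo the prime \<open>q\<close>, which vanishes in the field.
\<close>

lemma of_nat_nz_prime_card:
  assumes "prime CARD('a :: {finite, field})" "0 < k" "k < CARD('a)"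
  shows "(of_nat k :: 'a) \<noteq> 0"
proof
  assume k: "(of_nat k :: 'a) = 0"
  have "\<not> CARD('a) dvd k" using assms by (auto dest: dvd_imp_le)
  then have "gcd k CARD('a) = 1"
    using assms(1) by (metis coprime_iff_gcd_eq_1 gcd.commute prime_imp_coprime)
  then obtain x y where "k * x = CARD('a) * y + 1" using bezout_nat[of k "CARD('a)"] assms(2) by auto
  then have "(of_nat (k * x) :: 'a) = of_nat (CARD('a) * y + 1)" by simp
  then show False using k by (simp add: of_nat_card_field)
qed

context superelliptic begin

sublocale G: graded_code n "degree f" f "affine_points n f" "\<lambda>P. eval_at n f P ff_x" "\<lambda>P. eval_at n f P (ff_y n f)"
  by unfold_locales (use n_pos n_dvd no_root bij_betw_affine_points in auto)

lemma C_code_eq: "C_code n f s = G.word ` polys_below n (degree f) (gcd n (degree f) * s)"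
proof -
  have "(\<lambda>P. if P \<in> affine_points n f then eval_at n f P (poly_fun U) else 0) = G.word U" for U
    by (auto simp: fun_eq_iff G.word_def eval_at_poly_fun)
  then show ?thesis by (simp add: C_code_def AG_code_def RR_space_eq image_image)
qed

lemma code_hull_eq: "code_hull (affine_points n f) (C_code n f s) = G.graded_hull (gcd n (degree f) * s)"
  by (simp add: G.graded_hull_def C_code_eq)

text \<open>
  The hull is a linear subspace, so its cardinality determines its dimension.
\<close>

lemma card_hull: "card (G.graded_hull (gcd n (degree f) * s)) = CARD('a) ^ hull_dim n f s"
proof -
  let ?w = "gcd n (degree f) * s"
  interpret V: vector_space "\<lambda>(\<alpha> :: 'a) (u :: 'a place \<Rightarrow> 'a) i. \<alpha> * u i" by (rule vector_space_words)
  have add: "G.word U + G.word W = G.word (\<lambda>j. U j + W j)" for U W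
    by (auto simp: fun_eq_iff G.word_def distrib_right sum.distrib)
  have scale: "(\<lambda>i. \<alpha> * G.word U i) = G.word (\<lambda>j. smult \<alpha> (U j))" for \<alpha> U
    by (auto simp: fun_eq_iff G.word_def sum_distrib_left mult.assoc)
  let ?C = "G.word ` polys_below n (degree f) ?w"
  have C: "V.subspace ?C"
  proof (rule V.subspaceI)
    have "0 = G.word (\<lambda>_. 0)" by (auto simp: fun_eq_iff G.word_def)
    moreover have "(\<lambda>_. 0) \<in> polys_below n (degree f) ?w" by (simp add: polys_below_def)
    ultimately show "0 \<in> ?C" by blast
  qed (auto simp: add scale intro!: imageI polys_below_add polys_below_smult)
  have "V.subspace (dual_code (affine_points n f) ?C)"
    by (rule V.subspaceI) (auto simp: dual_code_def distrib_right sum.distrib mult.assoc simp flip: sum_distrib_left)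
  then have "V.subspace (G.graded_hull ?w)"
    unfolding G.graded_hull_def code_hull_def by (intro V.subspace_inter C)
  then show ?thesis
    using card_subspace[OF vector_space_words _ G.finite_hull]
    by (simp add: hull_dim_def code_dim_def code_hull_eq)
qed

lemma power_card_le_iff: "CARD('a) ^ i \<le> CARD('a) ^ j \<longleftrightarrow> i \<le> j"
  using card_field_ge_2[where 'a = 'a] by simp

lemma power_card_less_iff: "CARD('a) ^ i < CARD('a) ^ j \<longleftrightarrow> i < j"
  using card_field_ge_2[where 'a = 'a] by simp

lemma split_set_UNIV_iff: "G.split_set = UNIV \<longleftrightarrow> totally_split n f"
proof -
  have "b ^ n = poly f a \<longleftrightarrow> b \<noteq> 0 \<and> poly f a = b ^ n" for a b
    using no_root[of a] n_pos by (cases "b = 0") (auto simp: zero_power)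
  then have "totally_split n f \<longleftrightarrow> (\<forall>a. \<exists>b. b ^ n = poly f a)"
    by (simp only: totally_split_def)
  then show ?thesis unfolding G.split_set_def by auto
qed

lemma split_set_empty_iff: "G.split_set = {} \<longleftrightarrow> affine_points n f = {}"
proof -
  have "affine_points n f = {} \<longleftrightarrow> {(a, b). b ^ n = poly f a} = {}"
    unfolding bij_betw_imp_surj_on[OF bij_betw_affine_points, symmetric] image_is_empty ..
  then show ?thesis by (auto simp: G.split_set_def)
qed

lemma hull_dim_no_points:
  assumes "affine_points n f = {}" shows "hull_dim n f s = 0"
proof -
  have "G.graded_hull (gcd n (degree f) * s) \<subseteq> {\<lambda>_. 0}"
  proof
    fix u assume "u \<in> G.graded_hull (gcd n (degree f) * s)"
    then obtain U where "u = G.word U" using G.hull_subset_code by blast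
    then have "u P = 0" for P by (simp only: G.word_def) (simp add: assms)
    then show "u \<in> {\<lambda>_. 0}" by auto
  qed
  then have "CARD('a) ^ hull_dim n f s \<le> 1"
    unfolding card_hull[symmetric] using card_mono[of "{\<lambda>_. 0 :: 'a}"] by simp
  then show ?thesis using power_card_le_iff[of "hull_dim n f s" 0] by simp
qed

context
  fixes m M :: nat
  assumes M: "M = M_param CARD('a) n (degree f)" and m: "m = M div 2"
    and large: "(n - 1) * degree f \<le> gcd n (degree f) * m"
begin

text \<open>
  The defining property of \<open>M\<close>: weights \<open>w\<close>, \<open>w'\<close> with \<open>w + w' \<le> c M\<close> have total weight below \<open>(q - 1) n\<close>,
  the first one for which a power sum over the field may be nonzero.
\<close>

lemma gcd_M: "gcd n (degree f) * M + gcd n (degree f) = (CARD('a) - 1) * n"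
proof -
  let ?c = "gcd n (degree f)"
  have dvd: "?c dvd (CARD('a) - 1) * n" by simp
  have "(CARD('a) - 1) * n > 0" using n_pos card_field_ge_2[where 'a = 'a] by simp
  then have "?c \<le> (CARD('a) - 1) * n" using dvd by (rule dvd_imp_le[rotated])
  moreover have "?c * M = ?c * ((CARD('a) - 1) * n div ?c) - ?c"
    by (simp add: M M_param_def diff_mult_distrib2)
  then have "?c * M = (CARD('a) - 1) * n - ?c" unfolding dvd_mult_div_cancel[OF dvd] .
  ultimately show ?thesis by linarith
qed

definition max_dim :: nat where
  "max_dim = (\<Sum>j<n. xcount n (degree f) (gcd n (degree f) * m) j)"

lemma max_dim_eq_RR_dim: "RR_dim n f (\<lambda>P. int m * D_inf n f P) = max_dim"
  by (simp add: RR_dim_eq max_dim_def)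

lemma max_dim_pos: "max_dim > 0"
proof -
  have "0 < xcount n (degree f) (gcd n (degree f) * m) 0" by (simp add: xcount_def)
  also have "\<dots> \<le> max_dim" unfolding max_dim_def by (rule member_le_sum) (use n_pos in auto)
  finally show ?thesis .
qed

lemma h_star_eq_max_dim:
  assumes "degree f \<ge> 2" shows "h_star CARD('a) n (degree f) = int max_dim"
  unfolding h_star_def M[symmetric] m[symmetric] max_dim_def
  by (rule sum_xcount[symmetric]) (use assms n_gt_1 large in auto)

lemma m_pos: "m \<ge> 1" and m_le: "m \<le> M - m"
proof -
  have "(n - 1) * degree f > 0" using n_gt_1 degree_f_pos by simp
  then have "gcd n (degree f) * m > 0" using large by linarith
  then show "m \<ge> 1" by simp
  show "m \<le> M - m" using m by linarith
qed

text \<open>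
  The two ranges of \<open>s\<close> are complementary: \<open>s > m\<close> implies \<open>s \<ge> M - m\<close>.
\<close>

lemma hull_dim_le:
  assumes pts: "affine_points n f \<noteq> {}"
  shows "hull_dim n f s \<le> max_dim"
    and "prime CARD('a) \<Longrightarrow> \<not> totally_split n f \<Longrightarrow> hull_dim n f s < max_dim"
proof -
  let ?c = "gcd n (degree f)"
  have S: "G.split_set \<noteq> {}" using pts split_set_empty_iff by simp
  have "card (G.graded_hull (?c * s)) \<le> CARD('a) ^ max_dim
    \<and> (prime CARD('a) \<longrightarrow> G.split_set \<noteq> UNIV \<longrightarrow> card (G.graded_hull (?c * s)) < CARD('a) ^ max_dim)"
  proof (cases "s \<le> m")
    case True
    have le: "?c * s \<le> ?c * m" using True by simp
    have "(of_nat (card G.split_set) :: 'a) \<noteq> 0" if "prime CARD('a)" "G.split_set \<noteq> UNIV"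
      using that S by (intro of_nat_nz_prime_card psubset_card_mono) (auto simp: card_gt_0_iff)
    then show ?thesis using G.card_hull_small[OF le] unfolding max_dim_def by blast
  next
    case False
    then have s: "m \<le> s" "M \<le> 2 * s" "M \<le> s + m" using m by linarith+
    have "?c * m \<le> ?c * s" "?c * M \<le> ?c * (2 * s)" "?c * M \<le> ?c * (s + m)"
      by (intro mult_left_mono s; simp)+
    moreover have "?c * (2 * s) = 2 * (?c * s)" "?c * (s + m) = ?c * s + ?c * m"
      by (simp_all add: distrib_left)
    ultimately have "(n - 1) * degree f \<le> ?c * s" "(CARD('a) - 1) * n \<le> 2 * (?c * s) + ?c"
      "(CARD('a) - 1) * n \<le> ?c * s + ?c * m + ?c"
      unfolding gcd_M[symmetric] using large by linarith+
    note bounds = G.card_hull_large[of ?c, OF _ _ _ _ this(1,2) large this(3) S]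
    show ?thesis using bounds n_pos by (auto simp: max_dim_def)
  qed
  then show "hull_dim n f s \<le> max_dim"
    "prime CARD('a) \<Longrightarrow> \<not> totally_split n f \<Longrightarrow> hull_dim n f s < max_dim"
    by (simp_all add: card_hull power_card_le_iff power_card_less_iff split_set_UNIV_iff)
qed

lemma hull_dim_totally_split:
  assumes "totally_split n f"
  shows "hull_dim n f m = max_dim" "hull_dim n f (M - m) = max_dim"
proof -
  let ?c = "gcd n (degree f)"
  have U: "G.split_set = UNIV" using assms split_set_UNIV_iff by simp
  then have pts: "affine_points n f \<noteq> {}" using split_set_empty_iff by auto
  have ge: "max_dim \<le> hull_dim n f s" if s: "m \<le> s" "s + m \<le> M" for s
  proof -
    have "?c * m \<le> ?c * s" "?c * (s + m) \<le> ?c * M" by (intro mult_left_mono s; simp)+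
    moreover have "?c * M < (CARD('a) - 1) * n" using gcd_M n_pos by (metis gcd_eq_0_iff less_add_same_cancel1 not_gr_zero)
    ultimately have "?c * m \<le> ?c * s" "?c * s + ?c * m < (CARD('a) - 1) * n"
      by (simp_all add: distrib_left)
    from G.card_hull_totally_split[OF U this] show ?thesis
      by (simp add: card_hull power_card_le_iff max_dim_def)
  qed
  show "hull_dim n f m = max_dim" "hull_dim n f (M - m) = max_dim"
    using m m_le by (intro antisym hull_dim_le pts ge; linarith)+
qed

lemma h_max_cases:
  assumes "prime CARD('a)"
  shows "totally_split n f \<Longrightarrow> h_max n f = max_dim" "\<not> totally_split n f \<Longrightarrow> h_max n f < max_dim"
proof -
  have le: "hull_dim n f s \<le> max_dim" for s
    using hull_dim_le(1) hull_dim_no_points by (cases "affine_points n f = {}") auto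
  have fin: "finite (hull_dim n f ` {1..})"
    by (rule finite_subset[of _ "{..max_dim}"]) (use le in auto)
  show "h_max n f = max_dim" if "totally_split n f"
    unfolding h_max_def
  proof (rule Max_eqI[OF fin])
    show "max_dim \<in> hull_dim n f ` {1..}"
      using hull_dim_totally_split(1)[OF that] m_pos by (intro image_eqI[of _ _ m]) auto
  qed (use le in auto)
  show "h_max n f < max_dim" if ts: "\<not> totally_split n f"
  proof -
    have "h_max n f \<in> hull_dim n f ` {1..}" unfolding h_max_def by (rule Max_in[OF fin]) auto
    then obtain s where s: "h_max n f = hull_dim n f s" by blast
    show ?thesis
    proof (cases "affine_points n f = {}")
      case True
      then show ?thesis using s hull_dim_no_points max_dim_pos by simp
    next
      case False
      then show ?thesis using s hull_dim_le(2)[OF False assms ts] by simp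
    qed
  qed
qed

end

end

section \<open>The maximal hull dimension\<close>

theorem theorem6p10:
  fixes n d q c M m :: nat
  assumes q: "q = CARD('a)" "prime q"
    and nd: "n \<ge> 2" "d \<ge> 3" "n dvd q - 1"
    and c: "c = gcd n d"
    and M: "M = M_param q n d"
    and m: "m = M div 2"
    and ineq: "c * m \<ge> (n - 1) * d"
  shows
    "(\<forall>f :: 'a :: {finite, field} poly. f \<in> superelliptic_polys d \<longrightarrow> affine_points n f \<noteq> {} \<longrightarrow>
        int (h_max n f) \<le> h_star q n d \<and>
        h_star q n d = int c * int m + 1 - int (superelliptic_genus n d) \<and>
        h_star q n d = int (RR_dim n f (\<lambda>P. int m * D_inf n f P)) \<and>
        (int (h_max n f) = h_star q n d \<longleftrightarrow> totally_split n f) \<and>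
        (totally_split n f \<longrightarrow>
           hull_dim n f m = h_max n f \<and> hull_dim n f (M - m) = h_max n f) \<and>
        (\<not> totally_split n f \<longrightarrow> int (h_max n f) \<le> h_star q n d - 1)) \<and>
     (totally_split_locus n d \<noteq> ({} :: 'a poly set) \<longrightarrow>
        {f :: 'a poly. is_arg_max (h_max n) (\<lambda>f. f \<in> superelliptic_polys d) f}
          = totally_split_locus n d) \<and>
     (\<forall>f :: 'a poly. f \<in> totally_split_locus n d \<longrightarrow>
        h_max n f = RR_dim n f (\<lambda>P. int m * D_inf n f P))"
proof -
  have per_curve: "h_star q n d = int (RR_dim n f (\<lambda>P. int m * D_inf n f P))"
      "totally_split n f \<Longrightarrow> int (h_max n f) = h_star q n d"
      "\<not> totally_split n f \<Longrightarrow> int (h_max n f) < h_star q n d"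
      "totally_split n f \<Longrightarrow> hull_dim n f m = h_max n f \<and> hull_dim n f (M - m) = h_max n f"
    if f: "f \<in> superelliptic_polys d" for f :: "'a poly"
  proof -
    have deg: "degree f = d" using f by (simp add: superelliptic_polys_def)
    interpret superelliptic n f
      by unfold_locales (use f nd q in \<open>auto simp: superelliptic_polys_def\<close>)
    have M': "M = M_param CARD('a) n (degree f)" using M q deg by simp
    have large: "(n - 1) * degree f \<le> gcd n (degree f) * m" using ineq c deg by simp
    have prime: "prime CARD('a)" using q by simp
    have hs: "h_star q n d = int (max_dim m)"
      using h_star_eq_max_dim[OF M' m large] deg nd q by simp
    show "h_star q n d = int (RR_dim n f (\<lambda>P. int m * D_inf n f P))"
      using hs max_dim_eq_RR_dim[OF M' m large] by simp
    show "int (h_max n f) = h_star q n d" if "totally_split n f"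
      using hs h_max_cases(1)[OF M' m large prime that] by simp
    show "int (h_max n f) < h_star q n d" if "\<not> totally_split n f"
      using hs h_max_cases(2)[OF M' m large prime that] by simp
    show "hull_dim n f m = h_max n f \<and> hull_dim n f (M - m) = h_max n f" if "totally_split n f"
      using h_max_cases(1)[OF M' m large prime that] hull_dim_totally_split[OF M' m large that] by simp
  qed
  have star: "h_star q n d = int c * int m + 1 - int (superelliptic_genus n d)"
    by (simp add: h_star_def c M m)
  have arg_max: "{f :: 'a poly. is_arg_max (h_max n) (\<lambda>f. f \<in> superelliptic_polys d) f}
      = totally_split_locus n d" if "totally_split_locus n d \<noteq> ({} :: 'a poly set)"
  proof -
    obtain f0 :: "'a poly" where f0: "f0 \<in> superelliptic_polys d" "totally_split n f0"
      using \<open>totally_split_locus n d \<noteq> {}\<close> by (auto simp: totally_split_locus_def)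
    have "is_arg_max (h_max n) (\<lambda>f. f \<in> superelliptic_polys d) f
        \<longleftrightarrow> f \<in> superelliptic_polys d \<and> totally_split n f" for f :: "'a poly"
    proof
      assume "is_arg_max (h_max n) (\<lambda>f. f \<in> superelliptic_polys d) f"
      then have f: "f \<in> superelliptic_polys d" "\<not> h_max n f < h_max n f0"
        using f0(1) by (auto simp: is_arg_max_def)
      then show "f \<in> superelliptic_polys d \<and> totally_split n f"
        using per_curve(2)[OF f0] per_curve(3)[OF f(1)] by linarith
    next
      assume f: "f \<in> superelliptic_polys d \<and> totally_split n f"
      have "\<not> h_max n f < h_max n g" if g: "g \<in> superelliptic_polys d" for g :: "'a poly"
        using per_curve(2)[of f] per_curve(2)[OF g] per_curve(3)[OF g] f
        by (cases "totally_split n g") auto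
      then show "is_arg_max (h_max n) (\<lambda>f. f \<in> superelliptic_polys d) f"
        using f by (auto simp: is_arg_max_def)
    qed
    then show ?thesis by (auto simp: totally_split_locus_def)
  qed
  show ?thesis
  proof (intro conjI allI impI)
    fix f :: "'a poly" assume f: "f \<in> superelliptic_polys d"
    show "int (h_max n f) \<le> h_star q n d" "int (h_max n f) = h_star q n d \<longleftrightarrow> totally_split n f"
      using per_curve(2)[OF f] per_curve(3)[OF f] by (cases "totally_split n f"; simp)+
    show "int (h_max n f) \<le> h_star q n d - 1" if "\<not> totally_split n f"
      using per_curve(3)[OF f that] by simp
    show "hull_dim n f m = h_max n f" "hull_dim n f (M - m) = h_max n f" if "totally_split n f"
      using per_curve(4)[OF f that] by simp_all
  next
    fix f :: "'a poly" assume "f \<in> totally_split_locus n d"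
    then have f: "f \<in> superelliptic_polys d" "totally_split n f" by (auto simp: totally_split_locus_def)
    show "h_max n f = RR_dim n f (\<lambda>P. int m * D_inf n f P)"
      using per_curve(1)[OF f(1)] per_curve(2)[OF f] by simp
  qed (use per_curve(1) star arg_max in auto)
qed

end
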